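(* The construction $J$ described in the context (on objects $T\mapsto J(T)$, on maps $f:S\to T$ sent to the morphism represented by the span $J(S)\xleftarrow{u}\widetilde S(f)\xrightarrow{J(f)}J(T)$) provides a fully faithful functor $$J:(2\mathrm{Tree},\mathrm{Epi}_1)\hookrightarrow 2\mathrm{Net}.$$
   Context: **2-prenets.** For a totally ordered finite set $S$, an interval is a subset $I\subset S$ such that $x<y<z$ with $x,z\in I$ implies $y\in I$; $\mathrm{Int}(S)$ is the set of all intervals. For subsets, $U<V$ means $u<v$ for all $u\in U$, $v\in V$. A 2-prenet consists of totally ordered finite sets $S_0,S_1,S_2$ and parent maps $p_i:S_i\to\mathrm{Int}(S_{i-1})$, $i=1,2$ (written $p$ or $p_S$). Put $p^{-1}(t)=\{x: t\in p(x)\}$ (the children of $t$), and let $<^\circ$ be the partial order on $S_i$ generated by the relations $x<^\circ y$ for $x<y$ having a common parent. It is required that whenever $x<y$ in $S_i$, $i\ge1$, are incomparable for $<^\circ$, then $p(x)<p(y)$. For $U\subset S_i$, $p(U)=\bigcup_{x\in U}p(x)$. A 2-prenet is connected if $S_0$ consists of a single element, and pruned if for every $t\in S_i$ with $i<2$ there is $x\in S_{i+1}$ with $t\in p(x)$. A 2-prenet with tassels has in addition a subset $t(S)\subset S_2$, whose elements are called tassels; $c(S_2)=S_2\setminus t(S)$ is the set of core vertices at level 2. **Maps of prenets.** For $U\subset S_i$, $A(U)$ (resp. $B(U)$) is the set of minimal (resp. maximal) elements of the sets $p^{-1}(z)\cap U$, $z\in p(U)$. A subset $V\subset S_i$ is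 a disjoint cover of $W\subset S_{i-1}$ if the sets $p(x)$, $x\in V$, are pairwise disjoint with union $W$. A map $f:S\to T$ of 2-prenets with tassels is a collection of maps $f_i:S_i\to T_i$ such that (a) each $f_i$ preserves the partial orders $<^\circ$; (b) $f^{-1}(p_T(x))=p_S(f^{-1}(x))$ for all $x\in T_i$, $i\ge1$; (c) for each $i\ge 1$ and $x\in T_i$, $A(f^{-1}(x))$ and $B(f^{-1}(x))$ are disjoint covers of $f^{-1}(p_T(x))=p_S(f^{-1}(x))$; (d) $f(c(S_2))\subset c(T_2)$. $2\mathrm{PreNet}$ is the category of connected pruned 2-prenets with tassels and these maps. **2-nets.** A map $f:S\to T$ in $2\mathrm{PreNet}$ is a weak equivalence if $f_2$ induces a bijection $c(S_2)\to c(T_2)$ and $p_S(x)=f^{-1}p_Tf(x)$ for all $x\in S_2$. With $\mathcal W$ the class of weak equivalences, $2\mathrm{Net}=2\mathrm{PreNet}[\mathcal W^{-1}]$ is the localization, obtained by formally inverting the maps in $\mathcal W$. **2-trees.** An $l$-ordinal is a finite set with $l$ partial orders $<_0,\dots,<_{l-1}$ such that any two distinct elements are comparable for exactly one $<_i$, and $x<_iy$, $y<_jz$ imply $x<_{\min\{i,j\}}z$. A map of $l$-ordinals is a map $f$ of underlying sets such that $x<_iy$ implies $f(x)<_jf(y)$ for some $j\ge i$, or $f(x)=f(y)$, or $f(y)<_jf(x)$ for some $j>i$. A leveled 2-tree $S$ consists of totally ordered finite sets $S_0,S_1,S_2$, with $S_0$ a single element (the root), and parent maps $p_S:S_2\to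 S_1$, $S_1\to S_0$ (not required to be surjective). Each level $S_l$ carries the structure of an $l$-ordinal: for distinct $x<y$ in $S_l$ one puts $x<_iy$, where $i$ is the maximal level at which the ancestors of $x$ and $y$ coincide. A map $f:S\to T$ of leveled 2-trees is a collection of maps $f_i:S_i\to T_i$ commuting with the parent maps, such that each $f_l$ is a map of $l$-ordinals. $(2\mathrm{Tree},\mathrm{Epi}_1)$ is the category of leveled 2-trees and those maps $f$ for which $f_0$ and $f_1$ are surjective. **J on objects.** For a 2-tree $T$: $J(T)_0=T_0$, $J(T)_1=T_1$, $c(J(T)_2)=T_2$, $t(J(T)_2)=T_1\setminus p(T_2)$, $J(T)_2=c(J(T)_2)\sqcup t(J(T)_2)$. The parent map is $p_{J(T)}(x)=p_T(x)$ for $x\in c(J(T)_2)$ and $p_{J(T)}(x)=x$ for $x\in t(J(T)_2)$ (a single vertex being regarded as a one-element interval). The sets of children of the vertices of $J(T)_1$ are disjoint; their orders combine into the partial order $<^\circ$ on $J(T)_2$, which is extended to a total order by putting $x<y$ if $p(x)<p(y)$. **J on maps.** For $f:S\to T$ in $(2\mathrm{Tree},\mathrm{Epi}_1)$ put $\widetilde S=\widetilde S(f)$ with $\widetilde S_0=S_0$, $\widetilde S_1=S_1$, $\widetilde S_2=\bigsqcup_{x\in S_1}(\widetilde S_2)_x$, where $$(\widetilde S_2)_x=\begin{cases}p_S^{-1}(x)\sqcup\bigl(p_T^{-1}(f(x))\setminus f(p_S^{-1}(x))\bigr),& x\in p(S_2)\subset S_1,\\ p_T^{-1}(f(x)),&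 x\in S_1\setminus p(S_2).\end{cases}$$ On $(\widetilde S_2)_x$ the parent map is constantly $x$. The core vertices of $\widetilde S_2$ are those in $\bigsqcup_{x\in S_1}p_S^{-1}(x)$; all others are tassels. The total order on each component of $(\widetilde S_2)_x$ is that of $S_2$, respectively $T_2$; for $y\in p_S^{-1}(x)$ and $z\in p_T^{-1}(f(x))\setminus f(p_S^{-1}(x))$ one puts $y<z$ if $f(y)<_Tz$ and $z<y$ if $z<_Tf(y)$; and $(\widetilde S_2)_x<(\widetilde S_2)_{x'}$ whenever $x<x'$ in $S_1$. The map of prenets $J(f):\widetilde S\to J(T)$ is given by $J(f)_1=f_1$ and, for $y\in(\widetilde S_2)_x$, $J(f)_2(y)=f_2(y)$ if $y\in p_S^{-1}(x)$ and $J(f)_2(y)=y$ otherwise. The weak equivalence $u:\widetilde S\to J(S)$ (not unique) is any map which is the identity at levels 0 and 1, which for $x\in p(S_2)$ is the identity on $p_S^{-1}(x)$ and sends $p_T^{-1}(f(x))\setminus f(p_S^{-1}(x))$ to $p_S^{-1}(x)$ while preserving the total order on $(\widetilde S_2)_x$, and which for $x\in S_1\setminus p(S_2)$ sends the entire set of tassels $p_T^{-1}(f(x))$ to the unique tassel of $J(S)$ with parent $x$. The morphism $J(S)\to J(T)$ of $2\mathrm{Net}$ assigned to $f$ is the one represented by this span, i.e. $J(f)\circ u^{-1}$.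
   Formalization: The one-vertex tree with empty level 1 is excluded, since its J(T) is not pruned; parent maps of 2-trees are taken order preserving (else J is not full); over x without children, S̃(f) uses the children of f(x) in J(T), tassel included (else S̃ is not pruned). *)

theory Defs
  imports Main "HOL-Library.FuncSet" "HOL-Library.Disjoint_Sets"
begin

section \<open>Categories, functors and localization\<close>

record ('o, 'm) category =
  Obj :: "'o set"
  Arr :: "'m set"
  Dom :: "'m \<Rightarrow> 'o"
  Cod :: "'m \<Rightarrow> 'o"
  Ide :: "'o \<Rightarrow> 'm"
  Comp :: "'m \<Rightarrow> 'm \<Rightarrow> 'm"

text \<open>\<^term>\<open>Comp C g f\<close> is "g after f".\<close>

definition hom_set :: "('o, 'm) category \<Rightarrow> 'o \<Rightarrow> 'o \<Rightarrow> 'm set" where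
  "hom_set C X Y = {f \<in> Arr C. Dom C f = X \<and> Cod C f = Y}"

definition is_category :: "('o, 'm) category \<Rightarrow> bool" where
  "is_category C \<longleftrightarrow>
    (\<forall>f\<in>Arr C. Dom C f \<in> Obj C \<and> Cod C f \<in> Obj C) \<and>
    (\<forall>X\<in>Obj C. Ide C X \<in> hom_set C X X) \<and>
    (\<forall>X\<in>Obj C. \<forall>Y\<in>Obj C. \<forall>Z\<in>Obj C. \<forall>f\<in>hom_set C X Y. \<forall>g\<in>hom_set C Y Z.
        Comp C g f \<in> hom_set C X Z) \<and>
    (\<forall>X\<in>Obj C. \<forall>Y\<in>Obj C. \<forall>f\<in>hom_set C X Y.
        Comp C f (Ide C X) = f \<and> Comp C (Ide C Y) f = f) \<and>
    (\<forall>W\<in>Obj C. \<forall>X\<in>Obj C. \<forall>Y\<in>Obj C. \<forall>Z\<in>Obj C.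
      \<forall>f\<in>hom_set C W X. \<forall>g\<in>hom_set C X Y. \<forall>h\<in>hom_set C Y Z.
        Comp C h (Comp C g f) = Comp C (Comp C h g) f)"

definition full_subcategory :: "('o, 'm) category \<Rightarrow> ('o \<Rightarrow> bool) \<Rightarrow> ('o, 'm) category" where
  "full_subcategory C P =
    C\<lparr>Obj := {X \<in> Obj C. P X}, Arr := {f \<in> Arr C. P (Dom C f) \<and> P (Cod C f)}\<rparr>"

definition is_functor ::
  "('o, 'm) category \<Rightarrow> ('p, 'n) category \<Rightarrow> ('o \<Rightarrow> 'p) \<Rightarrow> ('m \<Rightarrow> 'n) \<Rightarrow> bool" where
  "is_functor C D F_obj F_arr \<longleftrightarrow>
    is_category C \<and> is_category D \<and>
    (\<forall>X\<in>Obj C. F_obj X \<in> Obj D) \<and>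
    (\<forall>X\<in>Obj C. \<forall>Y\<in>Obj C. \<forall>f\<in>hom_set C X Y. F_arr f \<in> hom_set D (F_obj X) (F_obj Y)) \<and>
    (\<forall>X\<in>Obj C. F_arr (Ide C X) = Ide D (F_obj X)) \<and>
    (\<forall>X\<in>Obj C. \<forall>Y\<in>Obj C. \<forall>Z\<in>Obj C. \<forall>f\<in>hom_set C X Y. \<forall>g\<in>hom_set C Y Z.
        F_arr (Comp C g f) = Comp D (F_arr g) (F_arr f))"

definition fully_faithful_functor ::
  "('o, 'm) category \<Rightarrow> ('p, 'n) category \<Rightarrow> ('o \<Rightarrow> 'p) \<Rightarrow> ('m \<Rightarrow> 'n) \<Rightarrow> bool" where
  "fully_faithful_functor C D F_obj F_arr \<longleftrightarrow>
    is_functor C D F_obj F_arr \<and>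
    (\<forall>X\<in>Obj C. \<forall>Y\<in>Obj C. bij_betw F_arr (hom_set C X Y) (hom_set D (F_obj X) (F_obj Y)))"

text \<open>
  The localization \<open>C[W\<^sup>-\<^sup>1]\<close> in the construction of Gabriel and Zisman: morphisms are zigzags of
  arrows of \<open>C\<close> and formal inverses of arrows in \<open>W\<close>, modulo the congruence generated by the
  relations of \<open>C\<close> and by \<open>Bwd w\<close> being inverse to \<open>Fwd w\<close>.  Zigzags are read in
  diagrammatic order: the head of the list is the step performed first.
\<close>

datatype 'm step = Fwd 'm | Bwd 'm

inductive zigzag :: "('o, 'm) category \<Rightarrow> 'm set \<Rightarrow> 'o \<Rightarrow> 'm step list \<Rightarrow> 'o \<Rightarrow> bool"
  for C W where
  nil: "X \<in> Obj C \<Longrightarrow> zigzag C W X [] X"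
| fwd: "f \<in> Arr C \<Longrightarrow> zigzag C W (Cod C f) s Y \<Longrightarrow> zigzag C W (Dom C f) (Fwd f # s) Y"
| bwd: "w \<in> W \<Longrightarrow> zigzag C W (Dom C w) s Y \<Longrightarrow> zigzag C W (Cod C w) (Bwd w # s) Y"

inductive zz_relation :: "('o, 'm) category \<Rightarrow> 'm set \<Rightarrow> 'm step list \<Rightarrow> 'm step list \<Rightarrow> bool"
  for C W where
  ide: "X \<in> Obj C \<Longrightarrow> zz_relation C W [Fwd (Ide C X)] []"
| comp: "f \<in> Arr C \<Longrightarrow> g \<in> Arr C \<Longrightarrow> Cod C f = Dom C g \<Longrightarrow>
    zz_relation C W [Fwd f, Fwd g] [Fwd (Comp C g f)]"
| fwd_bwd: "w \<in> W \<Longrightarrow> zz_relation C W [Fwd w, Bwd w] []"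
| bwd_fwd: "w \<in> W \<Longrightarrow> zz_relation C W [Bwd w, Fwd w] []"

text \<open>The equivalence relation on zigzags from \<open>X\<close> to \<open>Y\<close> generated by
  \<open>a @ l @ b \<sim> a @ r @ b\<close> for the defining relations \<open>l \<sim> r\<close>.\<close>

inductive zz_equiv ::
  "('o, 'm) category \<Rightarrow> 'm set \<Rightarrow> 'o \<Rightarrow> 'o \<Rightarrow> 'm step list \<Rightarrow> 'm step list \<Rightarrow> bool"
  for C W X Y where
  rel: "zz_relation C W l r \<Longrightarrow> zigzag C W X (a @ l @ b) Y \<Longrightarrow> zigzag C W X (a @ r @ b) Y \<Longrightarrow>
    zz_equiv C W X Y (a @ l @ b) (a @ r @ b)"
| refl: "zigzag C W X s Y \<Longrightarrow> zz_equiv C W X Y s s"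
| sym: "zz_equiv C W X Y s t \<Longrightarrow> zz_equiv C W X Y t s"
| trans: "zz_equiv C W X Y s t \<Longrightarrow> zz_equiv C W X Y t u \<Longrightarrow> zz_equiv C W X Y s u"

type_synonym ('o, 'm) loc_arrow = "'o \<times> 'm step list set \<times> 'o"

definition zz_class ::
  "('o, 'm) category \<Rightarrow> 'm set \<Rightarrow> 'o \<Rightarrow> 'm step list \<Rightarrow> 'o \<Rightarrow> ('o, 'm) loc_arrow" where
  "zz_class C W X s Y = (X, {t. zz_equiv C W X Y s t}, Y)"

definition localization ::
  "('o, 'm) category \<Rightarrow> 'm set \<Rightarrow> ('o, ('o, 'm) loc_arrow) category" where
  "localization C W =
    \<lparr> Obj = Obj C,
      Arr = {zz_class C W X s Y | X s Y. zigzag C W X s Y},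
      Dom = (\<lambda>(X, P, Y). X),
      Cod = (\<lambda>(X, P, Y). Y),
      Ide = (\<lambda>X. zz_class C W X [] X),
      Comp = (\<lambda>(Y', Q, Z) (X, P, Y). (X, \<Union>p\<in>P. \<Union>q\<in>Q. {t. zz_equiv C W X Z (p @ q) t}, Z)) \<rparr>"


section \<open>Levelled objects\<close>

text \<open>
  Three totally ordered finite sets, indexed by the levels 0, 1, 2; \<^term>\<open>Less S i\<close> is the strict
  order on level \<open>i\<close>.  Levels above 2 are empty.
\<close>

record 'v levels =
  Lev :: "nat \<Rightarrow> 'v set"
  Less :: "nat \<Rightarrow> 'v rel"

definition ordered_levels :: "('v, 'x) levels_scheme \<Rightarrow> bool" where
  "ordered_levels S \<longleftrightarrow>
    (\<forall>i. finite (Lev S i) \<and> Less S i \<subseteq> Lev S i \<times> Lev S i \<and>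
         strict_linear_order_on (Lev S i) (Less S i)) \<and>
    (\<forall>i>2. Lev S i = {})"

type_synonym 'v level_map = "nat \<Rightarrow> 'v \<Rightarrow> 'v"
type_synonym ('o, 'v) level_arrow = "'o \<times> 'v level_map \<times> 'o"

text \<open>Level maps are extensional, so that equality of arrows is equality of maps.\<close>

definition level_maps ::
  "('v, 'x) levels_scheme \<Rightarrow> ('v, 'y) levels_scheme \<Rightarrow> 'v level_map set" where
  "level_maps S T = {f. \<forall>i. f i \<in> Lev S i \<rightarrow>\<^sub>E Lev T i}"

definition level_category ::
  "('v, 'x) levels_scheme set \<Rightarrow>
   (('v, 'x) levels_scheme \<Rightarrow> ('v, 'x) levels_scheme \<Rightarrow> 'v level_map \<Rightarrow> bool) \<Rightarrow>
   (('v, 'x) levels_scheme, (('v, 'x) levels_scheme, 'v) level_arrow) category" where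
  "level_category Ob M =
    \<lparr> Obj = Ob,
      Arr = {(S, f, T) | S f T. S \<in> Ob \<and> T \<in> Ob \<and> f \<in> level_maps S T \<and> M S T f},
      Dom = (\<lambda>(S, f, T). S),
      Cod = (\<lambda>(S, f, T). T),
      Ide = (\<lambda>S. (S, \<lambda>i. restrict id (Lev S i), S)),
      Comp = (\<lambda>(T', g, U) (S, f, T). (S, \<lambda>i. compose (Lev S i) (g i) (f i), U)) \<rparr>"


section \<open>2-prenets with tassels\<close>

text \<open>\<^term>\<open>Par S i\<close> for \<open>i = 1, 2\<close> is the parent map from level \<open>i\<close> to intervals of level \<open>i - 1\<close>;
  its values elsewhere are irrelevant.\<close>

record 'v prenet = "'v levels" +
  Par :: "nat \<Rightarrow> 'v \<Rightarrow> 'v set"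
  Tassels :: "'v set"

definition intervals :: "('v, 'x) levels_scheme \<Rightarrow> nat \<Rightarrow> 'v set set" where
  "intervals S i = {I. I \<subseteq> Lev S i \<and>
    (\<forall>x y z. (x, y) \<in> Less S i \<longrightarrow> (y, z) \<in> Less S i \<longrightarrow> x \<in> I \<longrightarrow> z \<in> I \<longrightarrow> y \<in> I)}"

definition set_less :: "('v, 'x) levels_scheme \<Rightarrow> nat \<Rightarrow> 'v set \<Rightarrow> 'v set \<Rightarrow> bool" where
  "set_less S i U V \<longleftrightarrow> (\<forall>u\<in>U. \<forall>v\<in>V. (u, v) \<in> Less S i)"

text \<open>The children, at level \<open>i\<close>, of a vertex \<open>t\<close> of level \<open>i - 1\<close>.\<close>

definition children :: "'v prenet \<Rightarrow> nat \<Rightarrow> 'v \<Rightarrow> 'v set" where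
  "children S i t = {x \<in> Lev S i. t \<in> Par S i x}"

text \<open>The strict partial order \<open><\<^sup>\<circ>\<close>.\<close>

definition less_circ :: "'v prenet \<Rightarrow> nat \<Rightarrow> 'v rel" where
  "less_circ S i = {(x, y) \<in> Less S i. i \<ge> 1 \<and> Par S i x \<inter> Par S i y \<noteq> {}}\<^sup>+"

definition is_prenet :: "'v prenet \<Rightarrow> bool" where
  "is_prenet S \<longleftrightarrow>
    ordered_levels S \<and>
    (\<forall>i\<in>{1, 2}. \<forall>x\<in>Lev S i. Par S i x \<in> intervals S (i - 1)) \<and>
    (\<forall>i\<in>{1, 2}. \<forall>(x, y)\<in>Less S i. (x, y) \<notin> less_circ S i \<and> (y, x) \<notin> less_circ S i \<longrightarrow>
        set_less S (i - 1) (Par S i x) (Par S i y)) \<and>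
    Tassels S \<subseteq> Lev S 2"

definition connected_prenet :: "'v prenet \<Rightarrow> bool" where
  "connected_prenet S \<longleftrightarrow> (\<exists>r. Lev S 0 = {r})"

definition pruned :: "'v prenet \<Rightarrow> bool" where
  "pruned S \<longleftrightarrow> (\<forall>i<2. \<forall>t\<in>Lev S i. \<exists>x\<in>Lev S (i + 1). t \<in> Par S (i + 1) x)"

definition core :: "'v prenet \<Rightarrow> 'v set" where
  "core S = Lev S 2 - Tassels S"

definition parents :: "'v prenet \<Rightarrow> nat \<Rightarrow> 'v set \<Rightarrow> 'v set" where
  "parents S i U = (\<Union>x\<in>U. Par S i x)"

text \<open>Siblings are comparable for \<open><\<^sup>\<circ>\<close>, so "minimal" means the same for \<open><\<close> and \<open><\<^sup>\<circ>\<close> here.\<close>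

definition min_part :: "'v prenet \<Rightarrow> nat \<Rightarrow> 'v set \<Rightarrow> 'v set" where
  "min_part S i U = {x. \<exists>z\<in>parents S i U. x \<in> children S i z \<inter> U \<and>
    (\<forall>y\<in>children S i z \<inter> U. (y, x) \<notin> Less S i)}"

definition max_part :: "'v prenet \<Rightarrow> nat \<Rightarrow> 'v set \<Rightarrow> 'v set" where
  "max_part S i U = {x. \<exists>z\<in>parents S i U. x \<in> children S i z \<inter> U \<and>
    (\<forall>y\<in>children S i z \<inter> U. (x, y) \<notin> Less S i)}"

definition disjoint_cover :: "'v prenet \<Rightarrow> nat \<Rightarrow> 'v set \<Rightarrow> 'v set \<Rightarrow> bool" where
  "disjoint_cover S i V W \<longleftrightarrow> disjoint_family_on (Par S i) V \<and> parents S i V = W"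

definition preimage :: "'v prenet \<Rightarrow> 'v level_map \<Rightarrow> nat \<Rightarrow> 'v set \<Rightarrow> 'v set" where
  "preimage S f i U = {x \<in> Lev S i. f i x \<in> U}"

definition is_prenet_map :: "'v prenet \<Rightarrow> 'v prenet \<Rightarrow> 'v level_map \<Rightarrow> bool" where
  "is_prenet_map S T f \<longleftrightarrow>
    (\<forall>i. \<forall>(x, y)\<in>less_circ S i. f i x = f i y \<or> (f i x, f i y) \<in> less_circ T i) \<and>
    (\<forall>i\<in>{1, 2}. \<forall>x\<in>Lev T i.
        preimage S f (i - 1) (Par T i x) = parents S i (preimage S f i {x})) \<and>
    (\<forall>i\<in>{1, 2}. \<forall>x\<in>Lev T i.
        disjoint_cover S i (min_part S i (preimage S f i {x})) (preimage S f (i - 1) (Par T i x)) \<and>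
        disjoint_cover S i (max_part S i (preimage S f i {x})) (preimage S f (i - 1) (Par T i x))) \<and>
    f 2 ` core S \<subseteq> core T"

type_synonym 'v prenet_arrow = "('v prenet, 'v) level_arrow"

definition PreNet2 :: "('v prenet, 'v prenet_arrow) category" where
  "PreNet2 = level_category {S. is_prenet S \<and> connected_prenet S \<and> pruned S} is_prenet_map"

definition weak_equivalences :: "'v prenet_arrow set" where
  "weak_equivalences = {(S, f, T) | S f T. (S, f, T) \<in> Arr PreNet2 \<and>
    bij_betw (f 2) (core S) (core T) \<and>
    (\<forall>x\<in>Lev S 2. Par S 2 x = preimage S f 1 (Par T 2 (f 2 x)))}"

definition Net2 :: "('v prenet, ('v prenet, 'v prenet_arrow) loc_arrow) category" where
  "Net2 = localization PreNet2 weak_equivalences"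


section \<open>Leveled 2-trees\<close>

record 'a tree = "'a levels" +
  Up :: "nat \<Rightarrow> 'a \<Rightarrow> 'a"

text \<open>
  The parent maps are maps of totally ordered sets, i.e. weakly monotone; without this the relations
  \<open><\<^sub>i\<close> below need not form an ordinal.
\<close>

definition is_tree :: "'a tree \<Rightarrow> bool" where
  "is_tree S \<longleftrightarrow>
    ordered_levels S \<and> (\<exists>r. Lev S 0 = {r}) \<and>
    (\<forall>i\<in>{1, 2}. Up S i \<in> Lev S i \<rightarrow> Lev S (i - 1) \<and>
      (\<forall>(x, y)\<in>Less S i. Up S i x = Up S i y \<or> (Up S i x, Up S i y) \<in> Less S (i - 1)))"

text \<open>\<^term>\<open>is_ordinal l X R\<close>: the set \<open>X\<close> with the relations \<open>R 0, \<dots>, R (l - 1)\<close> is an \<open>l\<close>-ordinal.\<close>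

definition is_ordinal :: "nat \<Rightarrow> 'a set \<Rightarrow> (nat \<Rightarrow> 'a rel) \<Rightarrow> bool" where
  "is_ordinal l X R \<longleftrightarrow>
    finite X \<and> (\<forall>i<l. R i \<subseteq> X \<times> X \<and> irrefl (R i) \<and> trans (R i)) \<and>
    (\<forall>x\<in>X. \<forall>y\<in>X. x \<noteq> y \<longrightarrow> (\<exists>!i. i < l \<and> ((x, y) \<in> R i \<or> (y, x) \<in> R i))) \<and>
    (\<forall>i<l. \<forall>j<l. \<forall>x y z. (x, y) \<in> R i \<longrightarrow> (y, z) \<in> R j \<longrightarrow> (x, z) \<in> R (min i j))"

definition is_ordinal_map ::
  "nat \<Rightarrow> 'a set \<Rightarrow> (nat \<Rightarrow> 'a rel) \<Rightarrow> (nat \<Rightarrow> 'b rel) \<Rightarrow> ('a \<Rightarrow> 'b) \<Rightarrow> bool" where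
  "is_ordinal_map l X R R' f \<longleftrightarrow>
    (\<forall>x\<in>X. \<forall>y\<in>X. \<forall>i<l. (x, y) \<in> R i \<longrightarrow>
      (\<exists>j<l. j \<ge> i \<and> (f x, f y) \<in> R' j) \<or> f x = f y \<or> (\<exists>j<l. j > i \<and> (f y, f x) \<in> R' j))"

text \<open>The ancestor at level \<open>i\<close> of a vertex of level \<open>l\<close>, for \<open>i \<le> l\<close>.\<close>

fun ancestor :: "'a tree \<Rightarrow> nat \<Rightarrow> nat \<Rightarrow> 'a \<Rightarrow> 'a" where
  "ancestor S i 0 x = x"
| "ancestor S i (Suc l) x = (if i = Suc l then x else ancestor S i l (Up S (Suc l) x))"

text \<open>The relation \<open><\<^sub>i\<close> on level \<open>l\<close>.\<close>

definition level_ordinal :: "'a tree \<Rightarrow> nat \<Rightarrow> nat \<Rightarrow> 'a rel" where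
  "level_ordinal S l i = {(x, y) \<in> Less S l. i \<le> l \<and> ancestor S i l x = ancestor S i l y \<and>
    (\<forall>j\<le>l. ancestor S j l x = ancestor S j l y \<longrightarrow> j \<le> i)}"

lemma is_ordinal_level_ordinal:
  assumes S: "is_tree S" and l: "l \<le> 2"
  shows "is_ordinal l (Lev S l) (level_ordinal S l)"
proof -
  obtain r where r: "Lev S 0 = {r}"
    using S by (auto simp: is_tree_def)
  have fin: "finite (Lev S i)" and sub: "Less S i \<subseteq> Lev S i \<times> Lev S i"
    and tr: "trans (Less S i)" and ir: "irrefl (Less S i)" and tot: "total_on (Lev S i) (Less S i)"
    for i
    using S by (auto simp: is_tree_def ordered_levels_def strict_linear_order_on_def)
  have up1: "Up S (Suc 0) x = r" if "x \<in> Lev S (Suc 0)" for x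
    using S r that by (auto simp: is_tree_def Pi_iff)
  have up2: "Up S 2 x \<in> Lev S (Suc 0)" if "x \<in> Lev S 2" for x
    using S that by (auto simp: is_tree_def Pi_iff)
  have mono: "Up S 2 x = Up S 2 y \<or> (Up S 2 x, Up S 2 y) \<in> Less S (Suc 0)" if "(x, y) \<in> Less S 2" for x y
    using S that by (auto simp: is_tree_def)
  consider "l = 0" | "l = 1" | "l = 2"
    using l by linarith
  then show ?thesis
  proof cases
    case 1
    then show ?thesis
      using r by (auto simp: is_ordinal_def)
  next
    case 2
    have "level_ordinal S 1 0 = Less S 1"
      using sub[of 1] ir[of 1] up1 by (fastforce simp: level_ordinal_def irrefl_def le_Suc_eq)
    then show ?thesis
      using 2 fin[of 1] sub[of 1] tr[of 1] ir[of 1] tot[of 1]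
      by (auto simp: is_ordinal_def total_on_def dest: transD)
  next
    case 3
    have z: "x \<noteq> y" "x \<in> Lev S 2" "y \<in> Lev S 2" if "(x, y) \<in> Less S 2" for x y
      using that sub[of 2] ir[of 2] by (auto simp: irrefl_def)
    have o0: "level_ordinal S 2 0 = {(x, y) \<in> Less S 2. Up S 2 x \<noteq> Up S 2 y}"
      using z up1 up2 by (fastforce simp: level_ordinal_def le_Suc_eq numeral_2_eq_2)
    have o1: "level_ordinal S 2 (Suc 0) = {(x, y) \<in> Less S 2. Up S 2 x = Up S 2 y}"
      using z up1 up2 by (fastforce simp: level_ordinal_def le_Suc_eq numeral_2_eq_2)
    have asym1: "(y, x) \<notin> Less S (Suc 0)" if "(x, y) \<in> Less S (Suc 0)" for x y
      using that tr[of "Suc 0"] ir[of "Suc 0"] by (metis irrefl_def transD)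
    have asym2: "(y, x) \<notin> Less S 2" if "(x, y) \<in> Less S 2" for x y
      using that tr[of 2] ir[of 2] by (metis irrefl_def transD)
    have t2: "(x, w) \<in> Less S 2" if "(x, y) \<in> Less S 2" "(y, w) \<in> Less S 2" for x y w
      using that tr[of 2] by (metis transD)
    have ne: "Up S 2 x \<noteq> Up S 2 w"
      if "(x, y) \<in> Less S 2" "(y, w) \<in> Less S 2" "Up S 2 x \<noteq> Up S 2 y \<or> Up S 2 y \<noteq> Up S 2 w" for x y w
      using mono[OF that(1)] mono[OF that(2)] that(3) asym1 by metis
    have two: "i < 2 \<longleftrightarrow> i = 0 \<or> i = Suc 0" for i :: nat
      by auto
    have tri: "x \<noteq> y \<Longrightarrow> x \<in> Lev S 2 \<Longrightarrow> y \<in> Lev S 2 \<Longrightarrow> (x, y) \<in> Less S 2 \<or> (y, x) \<in> Less S 2" for x y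
      using tot[of 2] by (auto simp: total_on_def)
    have comp: "(x, w) \<in> level_ordinal S 2 (min i j)"
      if "i < 2" "j < 2" "(x, y) \<in> level_ordinal S 2 i" "(y, w) \<in> level_ordinal S 2 j" for i j x y w
      using that(1,2) unfolding two
      using that(3,4) t2[of x y w] ne[of x y w] by (elim disjE) (auto simp: o0 o1)
    have "trans (level_ordinal S 2 i)" if "i < 2" for i
      using comp[OF that that] by (auto intro!: transI)
    moreover have "level_ordinal S 2 i \<subseteq> Lev S 2 \<times> Lev S 2" "irrefl (level_ordinal S 2 i)" for i
      using z by (auto simp: level_ordinal_def irrefl_def)
    moreover have "\<exists>!i. i < 2 \<and> ((x, y) \<in> level_ordinal S 2 i \<or> (y, x) \<in> level_ordinal S 2 i)"
      if "x \<in> Lev S 2" "y \<in> Lev S 2" "x \<noteq> y" for x y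
      using tri[OF that(3,1,2)] unfolding two
      by (intro ex1I[of _ "if Up S 2 x = Up S 2 y then Suc 0 else 0"]) (auto simp: o0 o1)
    ultimately show ?thesis
      using 3 fin[of 2] comp unfolding is_ordinal_def by blast
  qed
qed

definition is_tree_map :: "'a tree \<Rightarrow> 'a tree \<Rightarrow> 'a level_map \<Rightarrow> bool" where
  "is_tree_map S T f \<longleftrightarrow>
    (\<forall>i\<in>{1, 2}. \<forall>x\<in>Lev S i. f (i - 1) (Up S i x) = Up T i (f i x)) \<and>
    (\<forall>l\<le>2. is_ordinal_map l (Lev S l) (level_ordinal S l) (level_ordinal T l) (f l))"

type_synonym 'a tree_arrow = "('a tree, 'a) level_arrow"

definition Tree2_Epi1 :: "('a tree, 'a tree_arrow) category" where
  "Tree2_Epi1 = level_category {S. is_tree S}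
    (\<lambda>S T f. is_tree_map S T f \<and> f 0 ` Lev S 0 = Lev T 0 \<and> f 1 ` Lev S 1 = Lev T 1)"


section \<open>The construction J\<close>

text \<open>
  Vertices of the prenets attached to trees with vertices in \<open>'a\<close>: \<open>Vtx y\<close> is a vertex \<open>y\<close> of the
  tree \<open>S\<close>, \<open>Tas x\<close> the tassel of \<open>J(S)\<close> with parent \<open>x\<close>, and \<open>Extra x z\<close> the copy of the vertex
  \<open>z\<close> of \<open>J(T)\<^sub>2\<close> in the component of S-tilde(f) over \<open>x\<close>.  The type \<open>'a vert\<close> is infinite for
  every \<open>'a\<close>, so every finite prenet is isomorphic to one with vertices in \<open>'a vert\<close>.
\<close>

datatype 'a vert = Vtx 'a | Tas 'a | Extra 'a "'a vert"

primrec stem :: "'a tree \<Rightarrow> 'a vert \<Rightarrow> 'a" where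
  "stem S (Vtx y) = Up S 2 y"
| "stem S (Tas x) = x"
| "stem S (Extra x z) = x"

text \<open>
  The prenet which agrees with the tree \<open>S\<close> up to level 1, whose second level has the vertices of \<open>S\<close>
  as core and \<open>E\<close> as set of tassels, the parent of each being its stem; \<open>R\<close> orders the vertices with
  the same stem.
\<close>

definition grow :: "'a tree \<Rightarrow> 'a vert set \<Rightarrow> 'a vert rel \<Rightarrow> 'a vert prenet" where
  "grow S E R =
    (let L = Vtx ` Lev S 2 \<union> E in
    \<lparr> Lev = (\<lambda>i. if i = 2 then L else Vtx ` Lev S i),
      Less = (\<lambda>i. if i = 2
        then {(y, z) \<in> L \<times> L. (stem S y, stem S z) \<in> Less S 1 \<or> stem S y = stem S z \<and> (y, z) \<in> R}
        else map_prod Vtx Vtx ` Less S i),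
      Par = (\<lambda>i y. {Vtx (if i = 2 then stem S y else Up S i (case y of Vtx x \<Rightarrow> x))}),
      Tassels = E \<rparr>)"

definition J_obj :: "'a tree \<Rightarrow> 'a vert prenet" where
  "J_obj T = grow T (Tas ` (Lev T 1 - Up T 2 ` Lev T 2)) (map_prod Vtx Vtx ` Less T 2)"

definition tree_children :: "'a tree \<Rightarrow> 'a \<Rightarrow> 'a set" where
  "tree_children S x = {y \<in> Lev S 2. Up S 2 y = x}"

text \<open>
  The vertices of \<open>J(T)\<^sub>2\<close> whose copies are the tassels of S-tilde(f) over \<open>x\<close>.  If \<open>x\<close> has no
  children these are all the children of \<open>f(x)\<close> in \<open>J(T)\<close>, which include the tassel of \<open>J(T)\<close> over
  \<open>f(x)\<close> in case \<open>f(x)\<close> has no children in \<open>T\<close>.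
\<close>

definition tilde_extra :: "'a tree \<Rightarrow> 'a level_map \<Rightarrow> 'a tree \<Rightarrow> 'a \<Rightarrow> 'a vert set" where
  "tilde_extra S f T x =
    (if x \<in> Up S 2 ` Lev S 2 then Vtx ` (tree_children T (f 1 x) - f 2 ` tree_children S x)
     else children (J_obj T) 2 (Vtx (f 1 x)))"

definition tilde :: "'a tree \<Rightarrow> 'a level_map \<Rightarrow> 'a tree \<Rightarrow> 'a vert prenet" where
  "tilde S f T = grow S {Extra x z | x z. x \<in> Lev S 1 \<and> z \<in> tilde_extra S f T x}
    ({(Vtx y, Vtx y') | y y'. (y, y') \<in> Less S 2} \<union>
     {(Extra x z, Extra x z') | x z z'. (z, z') \<in> Less (J_obj T) 2} \<union>
     {(Vtx y, Extra x z) | x y z. (Vtx (f 2 y), z) \<in> Less (J_obj T) 2} \<union>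
     {(Extra x z, Vtx y) | x y z. (z, Vtx (f 2 y)) \<in> Less (J_obj T) 2})"

text \<open>The map of prenets \<open>J(f)\<close> from S-tilde(f) to \<open>J(T)\<close>.\<close>

definition J_map :: "'a tree \<Rightarrow> 'a level_map \<Rightarrow> 'a tree \<Rightarrow> 'a vert level_map" where
  "J_map S f T = (\<lambda>i. \<lambda>v\<in>Lev (tilde S f T) i. case v of Vtx y \<Rightarrow> Vtx (f i y) | Extra x z \<Rightarrow> z)"

text \<open>The maps \<open>u\<close> from S-tilde(f) to \<open>J(S)\<close> along which \<open>J(f)\<close> becomes a span.\<close>

definition is_retraction ::
  "'a tree \<Rightarrow> 'a level_map \<Rightarrow> 'a tree \<Rightarrow> 'a vert level_map \<Rightarrow> bool" where
  "is_retraction S f T u \<longleftrightarrow>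
    u \<in> level_maps (tilde S f T) (J_obj S) \<and>
    (\<forall>i\<in>{0, 1}. \<forall>v\<in>Lev (tilde S f T) i. u i v = v) \<and>
    (\<forall>x\<in>Up S 2 ` Lev S 2.
      (\<forall>y\<in>tree_children S x. u 2 (Vtx y) = Vtx y) \<and>
      (\<forall>z\<in>tilde_extra S f T x. u 2 (Extra x z) \<in> Vtx ` tree_children S x) \<and>
      (\<forall>(v, v')\<in>Less (tilde S f T) 2. stem S v = x \<and> stem S v' = x \<longrightarrow>
        u 2 v = u 2 v' \<or> (u 2 v, u 2 v') \<in> Less (J_obj S) 2)) \<and>
    (\<forall>x\<in>Lev S 1 - Up S 2 ` Lev S 2. \<forall>z\<in>tilde_extra S f T x. u 2 (Extra x z) = Tas x)"

text \<open>The morphism of \<open>2Net\<close> represented by the span with legs \<open>u\<close> (inverted) and \<open>J(f)\<close>.\<close>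

definition J_span ::
  "'a tree \<Rightarrow> 'a level_map \<Rightarrow> 'a tree \<Rightarrow> 'a vert level_map \<Rightarrow>
   ('a vert prenet, 'a vert prenet_arrow) loc_arrow" where
  "J_span S f T u = zz_class PreNet2 weak_equivalences (J_obj S)
    [Bwd (tilde S f T, u, J_obj S), Fwd (tilde S f T, J_map S f T, J_obj T)] (J_obj T)"

definition J_arr :: "'a tree_arrow \<Rightarrow> ('a vert prenet, 'a vert prenet_arrow) loc_arrow" where
  "J_arr = (\<lambda>(S, f, T). J_span S f T (SOME u. is_retraction S f T u))"

text \<open>
  A tree with empty level 1 is a lone root; its image under \<open>J\<close> is not pruned, so \<open>J\<close> is only
  defined on the other trees.  The lone root receives and emits no map of trees that is surjective
  on level 1, except from and to another lone root.
\<close>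

lemma J_obj_lone_root:
  assumes "is_tree T" "Lev T 1 = {}"
  shows "J_obj T \<notin> Obj PreNet2"
proof -
  obtain r where r: "Lev T 0 = {r}"
    using assms(1) by (auto simp: is_tree_def)
  have "Lev (J_obj T) 0 = {Vtx r}" "Lev (J_obj T) 1 = {}"
    using r assms(2) by (auto simp: J_obj_def grow_def Let_def)
  then have "\<not> pruned (J_obj T)"
    by (force simp: pruned_def)
  then show ?thesis
    by (simp add: PreNet2_def level_category_def)
qed

lemma lone_root_isolated:
  assumes "(S, f, T) \<in> Arr Tree2_Epi1"
  shows "Lev S 1 = {} \<longleftrightarrow> Lev T 1 = {}"
  using assms by (auto simp: Tree2_Epi1_def level_category_def)

end

theory Submission
  imports Defs
begin

text \<open>
  \<^emph>\<open>Fullness.\<close> Call a prenet a bush if all vertices of level 1 are children of the root and the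
  parent sets of the vertices of level 2 partition level 1; \<open>J(S)\<close> and S-tilde are bushes.  If
  \<open>P \<rightarrow> X\<close> is a map from a bush and \<open>Z \<rightarrow> X\<close> a weak equivalence, then there is a bush \<open>Q\<close> with a weak
  equivalence \<open>Q \<rightarrow> P\<close> and a map \<open>Q \<rightarrow> Z\<close> completing the square.  Hence every zigzag from \<open>J(S)\<close> to
  \<open>J(T)\<close> is equivalent to a span \<open>J(S) \<leftarrow> P \<rightarrow> J(T)\<close> with \<open>P\<close> a bush.  Such a span determines a map of
  trees \<open>f\<close>, and \<open>P \<rightarrow> J(T)\<close> factors through \<open>J(f)\<close> by a weak equivalence from \<open>P\<close> to S-tilde.  It
  remains to see that two weak equivalences \<open>P \<rightarrow> J(S)\<close> which differ only in the places to which
  they send tassels are equal in the localization.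

  \<^emph>\<open>Faithfulness.\<close> Maps of prenets act on core vertices, and on the vertices of level 1 with a parent,
  up to having the same children; both actions are bijective for weak equivalences, and together
  they determine \<open>f\<close>.  Given fullness, functoriality of \<open>J\<close> also follows by comparing these actions.
\<close>

section \<open>Localizations\<close>

text \<open>Condition (c) is the hard one to carry through composites and fibre products. Out of a
  bush it is automatic, so composites are formed as arrows only out of bushes. This suffices because
  a zigzag from \<open>J_obj S\<close> is absorbed into a span from the left, one step at a time:
  only the apex of the span has to be a bush, while the other objects of the zigzag stay arbitrary.
  The localization is set up accordingly: \<open>localizable\<close> asks only for endpoints and for
  \<open>W\<close> to consist of arrows, composition is concatenation of zigzags, and the relation
  \<open>comp\<close> is applied once the composite is known to be an arrow. Two further obstacles
  come from the orders. The square over a weak equivalence cannot be filled by the whole fibre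
  product, because an order on it compatible with both projections need not exist; a smaller set of
  pairs must be selected. And the left leg of a span is not determined by its effect on core
  vertices and level 1, so equality of two such legs in the localization has to be produced by
  auxiliary prenets, one tassel at a time.\<close>

locale localizable =
  fixes C :: "('o, 'm) category" and W :: "'m set"
  assumes dom_cod: "f \<in> Arr C \<Longrightarrow> Dom C f \<in> Obj C \<and> Cod C f \<in> Obj C"
    and W_arr: "W \<subseteq> Arr C"
begin

lemma zigzag_simps [simp]:
  "zigzag C W X [] Y \<longleftrightarrow> X \<in> Obj C \<and> X = Y"
  "zigzag C W X (Fwd f # s) Y \<longleftrightarrow> f \<in> Arr C \<and> X = Dom C f \<and> zigzag C W (Cod C f) s Y"
  "zigzag C W X (Bwd w # s) Y \<longleftrightarrow> w \<in> W \<and> X = Cod C w \<and> zigzag C W (Dom C w) s Y"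
  by (auto elim: zigzag.cases intro: zigzag.intros)

lemma zigzag_objs: "zigzag C W X s Y \<Longrightarrow> X \<in> Obj C \<and> Y \<in> Obj C"
  by (induction rule: zigzag.induct) (use dom_cod W_arr in auto)

lemma zigzag_append: "zigzag C W X s Y \<Longrightarrow> zigzag C W Y t Z \<Longrightarrow> zigzag C W X (s @ t) Z"
  by (induction rule: zigzag.induct) (auto intro: zigzag.intros)

lemma W_arrD: "w \<in> W \<Longrightarrow> w \<in> Arr C"
  using W_arr by auto

lemma zigzag_Fwd: "f \<in> Arr C \<Longrightarrow> zigzag C W (Dom C f) [Fwd f] (Cod C f)"
  by (simp add: dom_cod)

lemma zigzag_Bwd: "w \<in> W \<Longrightarrow> zigzag C W (Cod C w) [Bwd w] (Dom C w)"
  by (simp add: dom_cod W_arrD)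

lemma zz_equiv_zigzag: "zz_equiv C W X Y s t \<Longrightarrow> zigzag C W X s Y \<and> zigzag C W X t Y"
  by (induction rule: zz_equiv.induct) auto

lemma zz_equiv_append_left:
  "zz_equiv C W X Y s t \<Longrightarrow> zigzag C W Z a X \<Longrightarrow> zz_equiv C W Z Y (a @ s) (a @ t)"
proof (induction rule: zz_equiv.induct)
  case (rel l r b c)
  then show ?case
    using zz_equiv.rel[of C W l r Z "a @ b" c Y] zigzag_append by auto
qed (auto intro: zz_equiv.intros zigzag_append)

lemma zz_equiv_append_right:
  "zz_equiv C W X Y s t \<Longrightarrow> zigzag C W Y b Z \<Longrightarrow> zz_equiv C W X Z (s @ b) (t @ b)"
proof (induction rule: zz_equiv.induct)
  case (rel l r a c)
  then show ?case
    using zz_equiv.rel[of C W l r X a "c @ b" Z] zigzag_append[of X "a @ l @ c" Y]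
      zigzag_append[of X "a @ r @ c" Y] by auto
qed (auto intro: zz_equiv.intros zigzag_append)

lemma zz_equiv_append:
  "zz_equiv C W X Y s s' \<Longrightarrow> zz_equiv C W Y Z t t' \<Longrightarrow> zz_equiv C W X Z (s @ t) (s' @ t')"
  by (meson zz_equiv.trans zz_equiv_append_left zz_equiv_append_right zz_equiv_zigzag)

lemma zz_class_eq_iff:
  "zigzag C W X s Y \<Longrightarrow> zz_class C W X s Y = zz_class C W X t Y \<longleftrightarrow> zz_equiv C W X Y s t"
  unfolding zz_class_def
  by (auto intro: zz_equiv.intros)

lemma hom_set_localization:
  "hom_set (localization C W) X Y = {zz_class C W X s Y | s. zigzag C W X s Y}"
  by (auto simp: hom_set_def localization_def zz_class_def)

text \<open>\<open>Comp\<close> takes the union over all pairs of representatives. Concatenation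
  respects \<open>zz_equiv\<close> on both sides, so every pair contributes the same class.\<close>

lemma Comp_localization:
  assumes "zigzag C W X s Y" "zigzag C W Y t Z"
  shows "Comp (localization C W) (zz_class C W Y t Z) (zz_class C W X s Y) = zz_class C W X (s @ t)
    Z"
proof -
  have "zz_equiv C W X Z (s @ t) v \<longleftrightarrow>
      (\<exists>p q. zz_equiv C W X Y s p \<and> zz_equiv C W Y Z t q \<and> zz_equiv C W X Z (p @ q) v)" for v
    using assms zz_equiv_append by (meson zz_equiv.refl zz_equiv.sym zz_equiv.trans)
  then show ?thesis
    by (auto simp: localization_def zz_class_def)
qed

text \<open>The category laws are those of lists under concatenation.\<close>

lemma is_category_localization: "is_category (localization C W)"
proof -
  have loc: "Obj (localization C W) = Obj C" "Ide (localization C W) X = zz_class C W X [] X"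
    "Dom (localization C W) f = fst f" "Cod (localization C W) f = snd (snd f)"
    "Arr (localization C W) = {zz_class C W X s Y | X s Y. zigzag C W X s Y}" for X f
    by (auto simp: localization_def split: prod.split)
  have nil: "X \<in> Obj C \<Longrightarrow> zigzag C W X [] X" for X
    by (rule zigzag.nil)
  show ?thesis
    unfolding is_category_def
  proof (intro conjI ballI)
    fix W' X Y Z f g h
    assume "f \<in> hom_set (localization C W) W' X" "g \<in> hom_set (localization C W) X Y"
      "h \<in> hom_set (localization C W) Y Z"
    then show "Comp (localization C W) h (Comp (localization C W) g f) =
        Comp (localization C W) (Comp (localization C W) h g) f"
      by (auto simp: hom_set_localization Comp_localization zigzag_append)
  next
    fix X Y f
    assume "X \<in> Obj (localization C W)" "Y \<in> Obj (localization C W)"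
      "f \<in> hom_set (localization C W) X Y"
    then show "Comp (localization C W) f (Ide (localization C W) X) = f"
      "Comp (localization C W) (Ide (localization C W) Y) f = f"
      by (auto simp: hom_set_localization Comp_localization nil loc)
  next
    fix X Y Z f g
    assume "f \<in> hom_set (localization C W) X Y" "g \<in> hom_set (localization C W) Y Z"
    then show "Comp (localization C W) g f \<in> hom_set (localization C W) X Z"
      using zigzag_append by (fastforce simp: hom_set_localization Comp_localization)
  qed (use zigzag_objs nil in \<open>auto simp: hom_set_localization loc zz_class_def\<close>)
qed

lemma zz_equiv_Fwd_Bwd: "w \<in> W \<Longrightarrow> zz_equiv C W (Dom C w) (Dom C w) [Fwd w, Bwd w] []"
  using zz_equiv.rel[OF zz_relation.fwd_bwd, where C = C and a = "[]" and b = "[]"]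
  by (simp add: dom_cod W_arrD)

lemma zz_equiv_Bwd_Fwd: "w \<in> W \<Longrightarrow> zz_equiv C W (Cod C w) (Cod C w) [Bwd w, Fwd w] []"
  using zz_equiv.rel[OF zz_relation.bwd_fwd, where C = C and a = "[]" and b = "[]"]
  by (simp add: dom_cod W_arrD)

lemma zz_equiv_comp:
  assumes "f \<in> Arr C" "g \<in> Arr C" "Cod C f = Dom C g" "Comp C g f \<in> Arr C"
    "Dom C (Comp C g f) = Dom C f" "Cod C (Comp C g f) = Cod C g"
  shows "zz_equiv C W (Dom C f) (Cod C g) [Fwd f, Fwd g] [Fwd (Comp C g f)]"
  using zz_equiv.rel[OF zz_relation.comp[OF assms(1-3)], where a = "[]" and b = "[]"] assms
  by (simp add: dom_cod)

text \<open>In the localization \<open>w\<close> has a two-sided inverse, so it can be cancelled: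
  append \<open>Bwd w\<close> and contract.\<close>

lemma zz_equiv_cancel_right:
  assumes "zz_equiv C W X (Cod C w) (s @ [Fwd w]) (t @ [Fwd w])" "w \<in> W"
    "zigzag C W X s (Dom C w)" "zigzag C W X t (Dom C w)"
  shows "zz_equiv C W X (Dom C w) s t"
proof -
  have *: "zz_equiv C W X (Dom C w) (r @ [Fwd w, Bwd w]) r" if "zigzag C W X r (Dom C w)" for r
    using zz_equiv_append_left[OF zz_equiv_Fwd_Bwd that] assms(2) by simp
  show ?thesis
    using zz_equiv_append_right[OF assms(1) zigzag_Bwd[OF assms(2)]] *[OF assms(3)] *[OF assms(4)]
    by simp (meson zz_equiv.sym zz_equiv.trans)
qed

lemma zz_equiv_cancel_left:
  assumes "zz_equiv C W (Dom C w) Y (Fwd w # s) (Fwd w # t)" "w \<in> W"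
    "zigzag C W (Cod C w) s Y" "zigzag C W (Cod C w) t Y"
  shows "zz_equiv C W (Cod C w) Y s t"
proof -
  have *: "zz_equiv C W (Cod C w) Y ([Bwd w, Fwd w] @ r) r" if "zigzag C W (Cod C w) r Y" for r
    using zz_equiv_append_right[OF zz_equiv_Bwd_Fwd that] assms(2) by simp
  show ?thesis
    using zz_equiv_append_left[OF assms(1) zigzag_Bwd[OF assms(2)]] *[OF assms(3)] *[OF assms(4)]
    by simp (meson zz_equiv.sym zz_equiv.trans)
qed

text \<open>Inverses of equal morphisms are equal: after \<open>Fwd v\<close>, both
  \<open>Bwd v\<close> and \<open>Bwd w\<close> give the trivial zigzag.\<close>

lemma zz_equiv_Bwd:
  assumes "v \<in> W" "w \<in> W" "Dom C v = Dom C w" "Cod C v = Cod C w"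
    and "zz_equiv C W (Dom C v) (Cod C v) [Fwd v] [Fwd w]"
  shows "zz_equiv C W (Cod C v) (Dom C v) [Bwd v] [Bwd w]"
proof (rule zz_equiv_cancel_left[of v])
  have "zz_equiv C W (Dom C v) (Dom C v) [Fwd v, Bwd w] [Fwd w, Bwd w]"
    using zz_equiv_append_right[OF assms(5), of "[Bwd w]" "Dom C v"] assms dom_cod W_arrD by simp
  then show "zz_equiv C W (Dom C v) (Dom C v) [Fwd v, Bwd v] [Fwd v, Bwd w]"
    using zz_equiv_Fwd_Bwd assms by (metis zz_equiv.sym zz_equiv.trans)
qed (use assms zigzag_Bwd in force)+

text \<open>Both sides are inverse to the composite: once it is prefixed and split into
  \<open>v\<close> followed by \<open>w\<close>, the right-hand side collapses from the inside. That
  the composite lies in \<open>W\<close> is assumed, since weak equivalences get composed only out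
  of bushes.\<close>

lemma zz_equiv_Bwd_comp:
  assumes "v \<in> W" "w \<in> W" "Cod C v = Dom C w" "Comp C w v \<in> W"
    "Dom C (Comp C w v) = Dom C v" "Cod C (Comp C w v) = Cod C w"
  shows "zz_equiv C W (Cod C w) (Dom C v) [Bwd (Comp C w v)] [Bwd w, Bwd v]"
proof (rule zz_equiv_cancel_left[of "Comp C w v", unfolded assms(5,6)])
  have A: "v \<in> Arr C" "w \<in> Arr C" "Comp C w v \<in> Arr C"
    using assms W_arr by auto
  have zz: "zigzag C W (Cod C w) [Bwd w, Bwd v] (Dom C v)"
    using assms dom_cod W_arrD by simp
  have "zz_equiv C W (Dom C v) (Dom C v) [Fwd (Comp C w v), Bwd w, Bwd v] [Fwd v, Fwd w, Bwd w, Bwd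
    v]"
    using zz_equiv_append_right[OF zz_equiv_comp[OF A(1,2) assms(3) A(3) assms(5,6)] zz]
    by (simp add: zz_equiv.sym)
  moreover have "zz_equiv C W (Dom C w) (Dom C v) [Fwd w, Bwd w, Bwd v] [Bwd v]"
    using zz_equiv_append_right[OF zz_equiv_Fwd_Bwd[OF assms(2)], of "[Bwd v]" "Dom C v"]
      assms dom_cod W_arrD by simp
  then have "zz_equiv C W (Dom C v) (Dom C v) [Fwd v, Fwd w, Bwd w, Bwd v] [Fwd v, Bwd v]"
    using zz_equiv_append_left[of "Dom C w" "Dom C v" _ _ "Dom C v" "[Fwd v]"] assms dom_cod W_arrD
    by fastforce
  moreover have "zz_equiv C W (Dom C v) (Dom C v) [Fwd v, Bwd v] []"
    "zz_equiv C W (Dom C v) (Dom C v) [Fwd (Comp C w v), Bwd (Comp C w v)] []"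
    using zz_equiv_Fwd_Bwd assms by metis+
  ultimately show "zz_equiv C W (Dom C v) (Dom C v) [Fwd (Comp C w v), Bwd (Comp C w v)]
      (Fwd (Comp C w v) # [Bwd w, Bwd v])"
    by (meson zz_equiv.sym zz_equiv.trans)
  show "zigzag C W (Cod C w) [Bwd w, Bwd v] (Dom C v)"
    by (rule zz)
  show "zigzag C W (Cod C w) [Bwd (Comp C w v)] (Dom C v)"
    using zigzag_Bwd[OF assms(4)] assms by simp
qed (rule assms)

end

text \<open>
  An assignment of relations to arrows which sends identities to \<open>E X\<close>, composites to composites and
  arrows in \<open>W\<close> to bijections modulo the equivalences \<open>E X\<close> extends to the localization.
\<close>

primrec zz_value :: "('m \<Rightarrow> 'b rel) \<Rightarrow> 'b rel \<Rightarrow> 'm step list \<Rightarrow> 'b rel" where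
  "zz_value I E [] = E"
| "zz_value I E (x # s) = (case x of Fwd f \<Rightarrow> I f | Bwd w \<Rightarrow> (I w)\<inverse>) O zz_value I E s"

locale zz_invariant = localizable +
  fixes I :: "'b \<Rightarrow> 'c rel" and E :: "'a \<Rightarrow> 'c rel"
  assumes I_left: "f \<in> Arr C \<Longrightarrow> E (Dom C f) O I f = I f"
    and I_right: "f \<in> Arr C \<Longrightarrow> I f O E (Cod C f) = I f"
    and E_sym: "X \<in> Obj C \<Longrightarrow> (E X)\<inverse> = E X"
    and E_idem: "X \<in> Obj C \<Longrightarrow> E X O E X = E X"
    and Ide_dom_cod: "X \<in> Obj C \<Longrightarrow> Dom C (Ide C X) = X \<and> Cod C (Ide C X) = X"
    and Comp_cod: "f \<in> Arr C \<Longrightarrow> g \<in> Arr C \<Longrightarrow> Cod C f = Dom C g \<Longrightarrow> Cod C (Comp C g f) = Cod C g"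
    and I_Ide: "X \<in> Obj C \<Longrightarrow> I (Ide C X) = E X"
    and I_Comp: "f \<in> Arr C \<Longrightarrow> g \<in> Arr C \<Longrightarrow> Cod C f = Dom C g \<Longrightarrow> I (Comp C g f) = I f O I g"
    and I_W: "w \<in> W \<Longrightarrow> I w O (I w)\<inverse> = E (Dom C w) \<and> (I w)\<inverse> O I w = E (Cod C w)"
begin

text \<open>For a backward step, the unit law on the right of \<open>I w\<close> becomes one on the
  left of its converse, because \<open>E\<close> is symmetric.\<close>

lemma E_zz_value: "zigzag C W X s Y \<Longrightarrow> E X O zz_value I (E Y) s = zz_value I (E Y) s"
proof (induction rule: zigzag.induct)
  case (bwd w s Y)
  then have "(I w O E (Cod C w))\<inverse> = (I w)\<inverse>"
    using I_right W_arrD by simp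
  then have "E (Cod C w) O (I w)\<inverse> = (I w)\<inverse>"
    using E_sym[of "Cod C w"] dom_cod W_arrD bwd by (simp add: converse_relcomp)
  then show ?case
    by (simp add: O_assoc[symmetric])
qed (simp_all add: E_idem O_assoc[symmetric] I_left)

text \<open>The value of the first zigzag ends with \<open>E Y\<close>, which
  \<open>E_zz_value\<close> absorbs at the seam.\<close>

lemma zz_value_append:
  "zigzag C W X s Y \<Longrightarrow> zigzag C W Y t Z \<Longrightarrow>
    zz_value I (E Z) (s @ t) = zz_value I (E Y) s O zz_value I (E Z) t"
  by (induction rule: zigzag.induct) (auto simp: E_zz_value O_assoc)

lemma zigzag_appendD:
  "zigzag C W X (s @ t) Z \<Longrightarrow> \<exists>Y. zigzag C W X s Y \<and> zigzag C W Y t Z"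
proof (induction s arbitrary: X)
  case (Cons x s)
  then show ?case
    by (cases x) auto
qed (use zigzag_objs in auto)

text \<open>The endpoints are compared as well, because the rest of a rewritten zigzag has to start
  from the same object.\<close>

lemma zz_value_relation:
  assumes "zz_relation C W l r" "zigzag C W X l Y" "zigzag C W X r Y'"
  shows "Y = Y' \<and> zz_value I (E Y) l = zz_value I (E Y) r"
  using assms
proof cases
  case (ide Z)
  then show ?thesis
    using assms(2,3) I_Ide E_idem Ide_dom_cod by simp
next
  case (comp f g)
  then show ?thesis
    using assms(2,3) by (simp add: I_Comp Comp_cod O_assoc)
next
  case (fwd_bwd w)
  then show ?thesis
    using assms(2,3) I_W[of w] E_idem by (auto simp: O_assoc[symmetric])
next
  case (bwd_fwd w)
  then show ?thesis
    using assms(2,3) I_W[of w] E_idem by (auto simp: O_assoc[symmetric])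
qed

lemma zz_value_equiv: "zz_equiv C W X Y s t \<Longrightarrow> zz_value I (E Y) s = zz_value I (E Y) t"
proof (induction rule: zz_equiv.induct)
  case (rel l r a b)
  obtain X1 Y1 where 1: "zigzag C W X a X1" "zigzag C W X1 l Y1" "zigzag C W Y1 b Y"
    using rel(2) zigzag_appendD by meson
  obtain X2 Y2 where 2: "zigzag C W X a X2" "zigzag C W X2 r Y2" "zigzag C W Y2 b Y"
    using rel(3) zigzag_appendD by meson
  \<comment> \<open>A zigzag's end is determined by its start and its steps, so both decompositions
    have the same first seam.\<close>
  have "X1 = X2"
    using 1(1) 2(1) by (induction rule: zigzag.induct) auto
  moreover have "Y1 = Y2" "zz_value I (E Y1) l = zz_value I (E Y1) r"
    using zz_value_relation[OF rel(1) 1(2), of Y2] 2(2) \<open>X1 = X2\<close> by auto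
  ultimately show ?case
    using 1 2 by (simp add: zz_value_append zigzag_append)
qed auto

end

section \<open>Ordered levels\<close>

text \<open>Levels are written 0, 1, 2; the number 1 must not be rewritten to \<open>Suc 0\<close>.\<close>

declare One_nat_def [simp del] One_nat_def [symmetric, simp]

text \<open>Counting predecessors turns a finite linear order into the order of natural numbers,
  which supplies least and greatest elements of subsets.\<close>

lemma strict_linear_rank:
  assumes "finite L" "r \<subseteq> L \<times> L" "strict_linear_order_on L r"
  obtains \<rho> :: "'a \<Rightarrow> nat" where "inj_on \<rho> L"
    "\<And>x y. x \<in> L \<Longrightarrow> y \<in> L \<Longrightarrow> (x, y) \<in> r \<longleftrightarrow> \<rho> x < \<rho> y"
proof
  define \<rho> where "\<rho> x = card {y. (y, x) \<in> r}" for x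
  have fin: "finite {y. (y, x) \<in> r}" for x
    using assms by (auto intro: finite_subset[of _ L])
  have less: "\<rho> x < \<rho> y" if "(x, y) \<in> r" for x y
    unfolding \<rho>_def
  proof (rule psubset_card_mono[OF fin])
    show "{z. (z, x) \<in> r} \<subset> {z. (z, y) \<in> r}"
      using that assms(3) by (auto simp: strict_linear_order_on_def irrefl_def dest: transD)
  qed
  have tot: "(x, y) \<in> r \<or> (y, x) \<in> r \<or> x = y" if "x \<in> L" "y \<in> L" for x y
    using that assms(3) by (auto simp: strict_linear_order_on_def total_on_def)
  show "inj_on \<rho> L"
    using tot less by (metis inj_onI less_irrefl)
  show "(x, y) \<in> r \<longleftrightarrow> \<rho> x < \<rho> y" if "x \<in> L" "y \<in> L" for x y
    using tot[OF that] less by (metis less_asym less_irrefl)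
qed

context
  fixes S :: "('v, 'x) levels_scheme"
  assumes S: "ordered_levels S"
begin

lemma finite_Lev: "finite (Lev S i)"
  and Less_Lev: "(x, y) \<in> Less S i \<Longrightarrow> x \<in> Lev S i \<and> y \<in> Lev S i"
  and Less_trans: "(x, y) \<in> Less S i \<Longrightarrow> (y, z) \<in> Less S i \<Longrightarrow> (x, z) \<in> Less S i"
  and Less_irrefl: "(x, x) \<notin> Less S i"
  and Less_linear: "x \<in> Lev S i \<Longrightarrow> y \<in> Lev S i \<Longrightarrow> x = y \<or> (x, y) \<in> Less S i \<or> (y, x) \<in> Less S i"
  and Lev_empty: "i > 2 \<Longrightarrow> Lev S i = {}"
  using S by (auto simp: ordered_levels_def strict_linear_order_on_def total_on_def irrefl_def dest:
    transD)

lemma Less_asym: "(x, y) \<in> Less S i \<Longrightarrow> (y, x) \<notin> Less S i"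
  using Less_irrefl Less_trans by blast

lemma Less_rank:
  obtains \<rho> :: "'v \<Rightarrow> nat" where "inj_on \<rho> (Lev S i)"
    "\<And>x y. x \<in> Lev S i \<Longrightarrow> y \<in> Lev S i \<Longrightarrow> (x, y) \<in> Less S i \<longleftrightarrow> \<rho> x < \<rho> y"
  using S strict_linear_rank[of "Lev S i" "Less S i"] unfolding ordered_levels_def by metis

lemma Less_min:
  assumes "K \<subseteq> Lev S i" "K \<noteq> {}"
  obtains m where "m \<in> K" "\<And>x. x \<in> K \<Longrightarrow> x = m \<or> (m, x) \<in> Less S i"
proof -
  obtain \<rho> :: "'v \<Rightarrow> nat" where \<rho>: "inj_on \<rho> (Lev S i)"
    "\<And>x y. x \<in> Lev S i \<Longrightarrow> y \<in> Lev S i \<Longrightarrow> (x, y) \<in> Less S i \<longleftrightarrow> \<rho> x < \<rho> y"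
    using Less_rank by metis
  obtain m where m: "m \<in> K" "\<forall>x. x \<in> K \<longrightarrow> \<rho> m \<le> \<rho> x"
    using assms(2) ex_has_least_nat[of "\<lambda>x. x \<in> K" _ \<rho>] by blast
  show ?thesis
  proof
    show "x = m \<or> (m, x) \<in> Less S i" if "x \<in> K" for x
      using that m assms(1) \<rho>(2)[of x m] Less_linear[of m i x] by (auto simp: subset_iff not_less)
  qed (rule m)
qed

lemma Less_max:
  assumes "K \<subseteq> Lev S i" "K \<noteq> {}"
  obtains m where "m \<in> K" "\<And>x. x \<in> K \<Longrightarrow> x = m \<or> (x, m) \<in> Less S i"
proof -
  obtain \<rho> :: "'v \<Rightarrow> nat" where \<rho>: "inj_on \<rho> (Lev S i)"
    "\<And>x y. x \<in> Lev S i \<Longrightarrow> y \<in> Lev S i \<Longrightarrow> (x, y) \<in> Less S i \<longleftrightarrow> \<rho> x < \<rho> y"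
    using Less_rank by metis
  have "finite (\<rho> ` K)" "\<rho> ` K \<noteq> {}"
    using assms finite_subset[OF assms(1) finite_Lev] by auto
  then have "Max (\<rho> ` K) \<in> \<rho> ` K" "\<And>x. x \<in> K \<Longrightarrow> \<rho> x \<le> Max (\<rho> ` K)"
    by (auto intro: Max_in)
  then obtain m where m: "m \<in> K" "\<And>x. x \<in> K \<Longrightarrow> \<rho> x \<le> \<rho> m"
    by auto
  show ?thesis
  proof
    show "x = m \<or> (x, m) \<in> Less S i" if "x \<in> K" for x
      using that m(1) m(2)[OF that] assms(1) \<rho>(2)[of m x] Less_linear[of m i x]
      by (auto simp: subset_iff not_less)
  qed (rule m)
qed

text \<open>Rounding down is a monotone retraction of a chain onto a nonempty subset. It serves to
  collapse tassels onto core siblings without disturbing the order.\<close>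

lemma Less_retraction:
  assumes "K \<subseteq> Lev S i" "K \<noteq> {}"
  obtains \<theta> where "\<And>x. \<theta> x \<in> K" "\<And>x. x \<in> K \<Longrightarrow> \<theta> x = x"
    "\<And>x y. (x, y) \<in> Less S i \<Longrightarrow> \<theta> x = \<theta> y \<or> (\<theta> x, \<theta> y) \<in> Less S i"
proof -
  obtain m where m: "m \<in> K" "\<And>x. x \<in> K \<Longrightarrow> x = m \<or> (m, x) \<in> Less S i"
    using Less_min[OF assms] by metis
  \<comment> \<open>The least element \<open>m\<close> belongs to every \<open>B x\<close>, so that
    elements below all of \<open>K\<close> have something to round to.\<close>
  define B where "B x = insert m {k \<in> K. k = x \<or> (k, x) \<in> Less S i}" for x
  have "\<exists>k. k \<in> B x \<and> (\<forall>y\<in>B x. y = k \<or> (y, k) \<in> Less S i)" for x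
  proof -
    have "B x \<subseteq> Lev S i" "B x \<noteq> {}"
      using m(1) assms(1) by (auto simp: B_def)
    then show ?thesis
      by (rule Less_max) blast
  qed
  then obtain \<theta> where \<theta>: "\<forall>x. \<theta> x \<in> B x \<and> (\<forall>y\<in>B x. y = \<theta> x \<or> (y, \<theta> x) \<in> Less S i)"
    using choice[of "\<lambda>x k. k \<in> B x \<and> (\<forall>y\<in>B x. y = k \<or> (y, k) \<in> Less S i)"] by blast
  show ?thesis
  proof
    show "\<theta> x \<in> K" for x
      using \<theta> m(1) by (auto simp: B_def)
    show "\<theta> x = x" if "x \<in> K" for x
    proof -
      have "x \<in> B x" "\<theta> x \<in> B x"
        using that \<theta> by (auto simp: B_def)
      then have "x = \<theta> x \<or> (x, \<theta> x) \<in> Less S i" "\<theta> x = m \<or> \<theta> x = x \<or> (\<theta> x, x) \<in> Less S i"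
        using \<theta> by (auto simp: B_def)
      then show ?thesis
        using m(2)[OF that] Less_asym[of x "\<theta> x" i] by auto
    qed
    show "\<theta> x = \<theta> y \<or> (\<theta> x, \<theta> y) \<in> Less S i" if "(x, y) \<in> Less S i" for x y
    proof -
      have "\<theta> x \<in> B x"
        using \<theta> by auto
      then have "\<theta> x \<in> B y"
        using that Less_trans[of "\<theta> x" x i y] by (auto simp: B_def)
      then show ?thesis
        using \<theta> by auto
    qed
  qed
qed

end

section \<open>Maps of prenets\<close>

lemma PreNet2_simps [simp]:
  "Obj PreNet2 = {S. is_prenet S \<and> connected_prenet S \<and> pruned S}"
  "Dom PreNet2 (S, f, T) = S" "Cod PreNet2 (S, f, T) = T"
  "Ide PreNet2 S = (S, \<lambda>i. restrict id (Lev S i), S)"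
  "Comp PreNet2 (T', g, U) (S, f, T) = (S, \<lambda>i. compose (Lev S i) (g i) (f i), U)"
  by (auto simp: PreNet2_def level_category_def)

lemma Arr_PreNet2:
  "(S, f, T) \<in> Arr PreNet2 \<longleftrightarrow>
    S \<in> Obj PreNet2 \<and> T \<in> Obj PreNet2 \<and> f \<in> level_maps S T \<and> is_prenet_map S T f"
  by (auto simp: PreNet2_def level_category_def)

interpretation PreNet2: localizable PreNet2 "weak_equivalences :: 'v prenet_arrow set"
  by unfold_locales (auto simp: PreNet2_def level_category_def weak_equivalences_def)

lemma Par_subset: "is_prenet S \<Longrightarrow> i \<in> {1, 2} \<Longrightarrow> x \<in> Lev S i \<Longrightarrow> Par S i x \<subseteq> Lev S (i - 1)"
  unfolding is_prenet_def intervals_def by blast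

lemma less_circ_subset: "ordered_levels S \<Longrightarrow> less_circ S i \<subseteq> Less S i"
proof -
  assume S: "ordered_levels S"
  have "{(x, y) \<in> Less S i. i \<ge> 1 \<and> Par S i x \<inter> Par S i y \<noteq> {}}\<^sup>+ \<subseteq> (Less S i)\<^sup>+"
    by (rule trancl_mono_subset) auto
  also have "\<dots> = Less S i"
    using Less_trans[OF S] by (auto intro!: trancl_id transI)
  finally show ?thesis
    by (simp add: less_circ_def)
qed

lemma less_circ_siblings:
  "(x, y) \<in> Less S i \<Longrightarrow> i \<ge> 1 \<Longrightarrow> Par S i x \<inter> Par S i y \<noteq> {} \<Longrightarrow> (x, y) \<in> less_circ S i"
  by (auto simp: less_circ_def)

lemma less_circ_antisym:
  assumes "ordered_levels S" "x = y \<or> (x, y) \<in> less_circ S i" "(y, x) \<in> less_circ S i"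
  shows False
  using assms less_circ_subset[OF assms(1), of i] Less_asym[OF assms(1)] by blast

context
  fixes S T :: "'v prenet" and f :: "'v level_map"
  assumes f: "(S, f, T) \<in> Arr PreNet2"
begin

lemma arr_ordered: "ordered_levels S" "ordered_levels T"
  using f[unfolded Arr_PreNet2] by (auto simp: is_prenet_def)

lemma arr_Lev: "x \<in> Lev S i \<Longrightarrow> f i x \<in> Lev T i"
  using f[unfolded Arr_PreNet2] by (auto simp: level_maps_def)

lemma arr_less_circ: "(x, y) \<in> less_circ S i \<Longrightarrow> f i x = f i y \<or> (f i x, f i y) \<in> less_circ T i"
  using f[unfolded Arr_PreNet2] by (fastforce simp: is_prenet_map_def)

lemma arr_Par:
  assumes "i \<in> {1, 2}" "x \<in> Lev T i" "a \<in> Lev S (i - 1)"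
  shows "f (i - 1) a \<in> Par T i x \<longleftrightarrow> (\<exists>c\<in>Lev S i. a \<in> Par S i c \<and> f i c = x)"
proof -
  have "\<forall>i\<in>{1, 2}. \<forall>x\<in>Lev T i. preimage S f (i - 1) (Par T i x) = parents S i (preimage S f i {x})"
    using f[unfolded Arr_PreNet2] unfolding is_prenet_map_def by blast
  then have "preimage S f (i - 1) (Par T i x) = parents S i (preimage S f i {x})"
    using assms(1,2) by blast
  then have "a \<in> preimage S f (i - 1) (Par T i x) \<longleftrightarrow> a \<in> parents S i (preimage S f i {x})"
    by simp
  then show ?thesis
    using assms(3) by (auto simp: preimage_def parents_def)
qed

lemma arr_core: "x \<in> core S \<Longrightarrow> f 2 x \<in> core T"
  using f[unfolded Arr_PreNet2] by (auto simp: is_prenet_map_def)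

text \<open>Level 0 is a single vertex, so a vertex of level 1 has either no parent or the root as
  its parent.\<close>

lemma arr_root: "Par S 1 a \<noteq> {} \<and> a \<in> Lev S 1 \<longleftrightarrow> Par S 1 a = Lev S 0 \<and> a \<in> Lev S 1"
  using f[unfolded Arr_PreNet2] Par_subset[of S 1 a] by (auto simp: connected_prenet_def)

lemma arr_parented: "a \<in> Lev S 1 \<Longrightarrow> Par S 1 a \<noteq> {} \<Longrightarrow> Par T 1 (f 1 a) \<noteq> {}"
  using arr_Par[of 1 "f 1 a"] arr_Lev[of a 1] f[unfolded Arr_PreNet2] Par_subset[of S 1 a] by auto

text \<open>Condition (b) on level 1, read at the root: the root of \<open>S\<close> lies over a
  parent of \<open>y\<close>, hence is a parent of some vertex over \<open>y\<close>.\<close>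

lemma arr_parented_surj:
  assumes "y \<in> Lev T 1" "Par T 1 y \<noteq> {}"
  obtains a where "a \<in> Lev S 1" "Par S 1 a \<noteq> {}" "f 1 a = y"
proof -
  obtain r r' where r: "Lev S 0 = {r}" "Lev T 0 = {r'}"
    using f[unfolded Arr_PreNet2] by (auto simp: connected_prenet_def)
  have "r' \<in> Par T 1 y"
    using assms f[unfolded Arr_PreNet2] r Par_subset[of T 1 y] by auto
  moreover have "f 0 r = r'"
    using arr_Lev[of r 0] r by auto
  ultimately show ?thesis
    using that arr_Par[of 1 y r] r assms by auto
qed

end

lemma weak_equivalencesD:
  assumes "(S, f, T) \<in> weak_equivalences"
  shows "(S, f, T) \<in> Arr PreNet2" "bij_betw (f 2) (core S) (core T)"
    "x \<in> Lev S 2 \<Longrightarrow> Par S 2 x = {a \<in> Lev S 1. f 1 a \<in> Par T 2 (f 2 x)}"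
  using assms by (auto simp: weak_equivalences_def preimage_def)

lemma weak_equivalencesI:
  assumes "(S, f, T) \<in> Arr PreNet2" "bij_betw (f 2) (core S) (core T)"
    "\<And>x. x \<in> Lev S 2 \<Longrightarrow> Par S 2 x = {a \<in> Lev S 1. f 1 a \<in> Par T 2 (f 2 x)}"
  shows "(S, f, T) \<in> weak_equivalences"
  using assms by (auto simp: weak_equivalences_def preimage_def)

section \<open>Bushes\<close>

text \<open>
  Condition (c) on maps of prenets is automatic when the source is a bush: siblings have the same
  parents, so that the minimal elements of any set are a disjoint cover.
\<close>

definition is_bush :: "'v prenet \<Rightarrow> bool" where
  "is_bush P \<longleftrightarrow> P \<in> Obj PreNet2 \<and> (\<forall>a\<in>Lev P 1. Par P 1 a = Lev P 0) \<and>
    (\<forall>c\<in>Lev P 2. Par P 2 c \<noteq> {}) \<and>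
    (\<forall>c\<in>Lev P 2. \<forall>d\<in>Lev P 2. Par P 2 c = Par P 2 d \<or> Par P 2 c \<inter> Par P 2 d = {})"

context
  fixes P :: "'v prenet"
  assumes P: "is_bush P"
begin

lemma bush_Obj: "is_prenet P" "connected_prenet P" "pruned P"
  using P by (auto simp: is_bush_def)

lemma bush_ordered: "ordered_levels P"
  using P by (simp add: is_bush_def is_prenet_def)

lemma bush_Par1: "a \<in> Lev P 1 \<Longrightarrow> Par P 1 a = Lev P 0"
  and bush_Par2: "c \<in> Lev P 2 \<Longrightarrow> Par P 2 c \<noteq> {}"
  using P by (auto simp: is_bush_def)

lemma bush_Par2_eq:
  "c \<in> Lev P 2 \<Longrightarrow> d \<in> Lev P 2 \<Longrightarrow> a \<in> Par P 2 c \<Longrightarrow> a \<in> Par P 2 d \<Longrightarrow> Par P 2 c = Par P 2 d"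
  using P unfolding is_bush_def by blast

lemma bush_Par_eq:
  assumes "i \<in> {1, 2}" "c \<in> Lev P i" "d \<in> Lev P i"
  shows "Par P i c \<inter> Par P i d \<noteq> {} \<longleftrightarrow> Par P i c = Par P i d"
proof (cases "i = 1")
  case True
  have "Lev P 0 \<noteq> {}"
    using bush_Obj by (auto simp: connected_prenet_def)
  then show ?thesis
    using assms True bush_Par1 by simp
next
  case False
  then have i: "i = 2"
    using assms(1) by auto
  show ?thesis
    using assms(2,3) bush_Par2 bush_Par2_eq[of c d] unfolding i by blast
qed

lemma bush_child: "a \<in> Lev P 1 \<Longrightarrow> \<exists>c\<in>Lev P 2. a \<in> Par P 2 c"
  using bush_Obj(3) unfolding pruned_def
  by (metis one_add_one one_less_numeral_iff semiring_norm(76))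

text \<open>In a bush, having a common parent means having equal parent sets, which is transitive.
  So the sibling relation is its own transitive closure.\<close>

lemma less_circ_bush:
  "less_circ P i = (if i \<in> {1, 2} then {(x, y) \<in> Less P i. Par P i x = Par P i y} else {})"
proof (cases "i \<in> {1, 2}")
  case True
  have *: "Par P i x \<inter> Par P i y \<noteq> {} \<longleftrightarrow> Par P i x = Par P i y" if "(x, y) \<in> Less P i" for x y
    using bush_Par_eq[OF True] Less_Lev[OF bush_ordered that] by blast
  have "1 \<le> i"
    using True by auto
  then have "{(x, y) \<in> Less P i. i \<ge> 1 \<and>
    Par P i x \<inter> Par P i y \<noteq> {}} = {(x, y) \<in> Less P i. Par P i x = Par P i y}"
    using * by (intro equalityI subrelI) blast+
  moreover have "trans {(x, y) \<in> Less P i. Par P i x = Par P i y}"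
    by (rule transI) (auto intro: Less_trans[OF bush_ordered])
  ultimately show ?thesis
    unfolding less_circ_def using True by simp
next
  case False
  then have "i = 0 \<or> i > 2"
    by auto
  then have "{(x, y) \<in> Less P i. i \<ge> 1 \<and> Par P i x \<inter> Par P i y \<noteq> {}} = {}"
    using Lev_empty[OF bush_ordered, of i] Less_Lev[OF bush_ordered, of _ _ i] by fastforce
  then have "less_circ P i = {}"
    unfolding less_circ_def by (metis trancl_empty)
  then show ?thesis
    using False by simp
qed

lemma bush_disjoint_cover:
  assumes i: "i \<in> {1, 2}" and U: "U \<subseteq> Lev P i"
  shows "disjoint_cover P i (min_part P i U) (parents P i U)"
    and "disjoint_cover P i (max_part P i U) (parents P i U)"
proof -
  have K: "children P i z \<inter> U \<subseteq> Lev P i" "z \<in> parents P i U \<Longrightarrow> children P i z \<inter> U \<noteq> {}" for z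
    using U by (auto simp: children_def parents_def)
  show "disjoint_cover P i (min_part P i U) (parents P i U)"
    unfolding disjoint_cover_def disjoint_family_on_def
  proof (intro conjI ballI impI)
    show "parents P i (min_part P i U) = parents P i U"
    proof (intro equalityI subsetI)
      fix z
      assume z: "z \<in> parents P i U"
      then obtain m where m: "m \<in> children P i z \<inter> U"
        "\<And>x. x \<in> children P i z \<inter> U \<Longrightarrow> x = m \<or> (m, x) \<in> Less P i"
        using Less_min[OF bush_ordered K(1) K(2)] by blast
      have "(y, m) \<notin> Less P i" if "y \<in> children P i z \<inter> U" for y
        using m(2)[OF that] Less_asym[OF bush_ordered] Less_irrefl[OF bush_ordered] by blast
      then have "m \<in> min_part P i U"
        using z m(1) unfolding min_part_def by blast
      then show "z \<in> parents P i (min_part P i U)"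
        using m(1) by (auto simp: parents_def children_def)
    qed (auto simp: parents_def min_part_def)
    fix m m'
    assume mm: "m \<in> min_part P i U" "m' \<in> min_part P i U" "m \<noteq> m'"
    show "Par P i m \<inter> Par P i m' = {}"
    proof (rule ccontr)
      assume "Par P i m \<inter> Par P i m' \<noteq> {}"
      moreover have L: "m \<in> Lev P i" "m' \<in> Lev P i" "m \<in> U" "m' \<in> U"
        using mm U by (auto simp: min_part_def)
      ultimately have "Par P i m = Par P i m'"
        using bush_Par_eq[OF i] by blast
      then have "(m, m') \<notin> Less P i" "(m', m) \<notin> Less P i"
        using mm L by (auto simp: min_part_def children_def)
      then show False
        using Less_linear[OF bush_ordered L(1,2)] mm(3) by blast
    qed
  qed
  show "disjoint_cover P i (max_part P i U) (parents P i U)"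
    unfolding disjoint_cover_def disjoint_family_on_def
  proof (intro conjI ballI impI)
    show "parents P i (max_part P i U) = parents P i U"
    proof (intro equalityI subsetI)
      fix z
      assume z: "z \<in> parents P i U"
      then obtain m where m: "m \<in> children P i z \<inter> U"
        "\<And>x. x \<in> children P i z \<inter> U \<Longrightarrow> x = m \<or> (x, m) \<in> Less P i"
        using Less_max[OF bush_ordered K(1) K(2)] by blast
      have "(m, y) \<notin> Less P i" if "y \<in> children P i z \<inter> U" for y
        using m(2)[OF that] Less_asym[OF bush_ordered] Less_irrefl[OF bush_ordered] by blast
      then have "m \<in> max_part P i U"
        using z m(1) unfolding max_part_def by blast
      then show "z \<in> parents P i (max_part P i U)"
        using m(1) by (auto simp: parents_def children_def)
    qed (auto simp: parents_def max_part_def)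
    fix m m'
    assume mm: "m \<in> max_part P i U" "m' \<in> max_part P i U" "m \<noteq> m'"
    show "Par P i m \<inter> Par P i m' = {}"
    proof (rule ccontr)
      assume "Par P i m \<inter> Par P i m' \<noteq> {}"
      moreover have L: "m \<in> Lev P i" "m' \<in> Lev P i" "m \<in> U" "m' \<in> U"
        using mm U by (auto simp: max_part_def)
      ultimately have "Par P i m = Par P i m'"
        using bush_Par_eq[OF i] by blast
      then have "(m, m') \<notin> Less P i" "(m', m) \<notin> Less P i"
        using mm L by (auto simp: max_part_def children_def)
      then show False
        using Less_linear[OF bush_ordered L(1,2)] mm(3) by blast
    qed
  qed
qed

end

text \<open>The order axiom of prenets concerns only pairs incomparable for
  \<open>less_circ\<close>. On level 1 any two vertices share the root, and on level 2 equal
  nonempty parent sets make siblings, which leaves the second alternative of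
  \<open>less\<close>.\<close>

lemma is_bushI:
  assumes P: "ordered_levels P" and r: "Lev P 0 = {r}" and ne: "Lev P 1 \<noteq> {}"
    and Par1: "\<And>a. a \<in> Lev P 1 \<Longrightarrow> Par P 1 a = Lev P 0"
    and Par2: "\<And>c. c \<in> Lev P 2 \<Longrightarrow> Par P 2 c \<in> intervals P 1 - {{}}"
    and eq: "\<And>a c d. c \<in> Lev P 2 \<Longrightarrow> d \<in> Lev P 2 \<Longrightarrow> a \<in> Par P 2 c \<Longrightarrow> a \<in> Par P 2 d \<Longrightarrow>
      Par P 2 c = Par P 2 d"
    and child: "\<And>a. a \<in> Lev P 1 \<Longrightarrow> \<exists>c\<in>Lev P 2. a \<in> Par P 2 c"
    and less: "\<And>c d. (c, d) \<in> Less P 2 \<Longrightarrow>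
      Par P 2 c = Par P 2 d \<or> set_less P 1 (Par P 2 c) (Par P 2 d)"
    and tas: "Tassels P \<subseteq> Lev P 2"
  shows "is_bush P"
proof -
  have *: "set_less P (i - 1) (Par P i x) (Par P i y)"
    if xy: "(x, y) \<in> Less P i" "(x, y) \<notin> less_circ P i" and i: "i \<in> {1, 2}" for i x y
  proof (cases "i = 1")
    case True
    then show ?thesis
      using less_circ_siblings[OF xy(1)] xy Less_Lev[OF P xy(1)] Par1 r by auto
  next
    case False
    then have i: "i = 2"
      using i by auto
    then have "Par P 2 x \<noteq> Par P 2 y"
      using xy less_circ_siblings[of x y P 2] Par2 Less_Lev[OF P xy(1)] by auto
    then show ?thesis
      using less xy i by auto
  qed
  have "Lev P 0 \<in> intervals P 0"
    by (auto simp: intervals_def dest: Less_Lev[OF P])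
  then have "is_prenet P"
    unfolding is_prenet_def
  proof (intro conjI ballI)
    fix i xy
    assume "i \<in> {1, 2}" "xy \<in> Less P i"
    then show "case xy of (x, y) \<Rightarrow> (x, y) \<notin> less_circ P i \<and> (y, x) \<notin> less_circ P i \<longrightarrow>
        set_less P (i - 1) (Par P i x) (Par P i y)"
      using * by (cases xy) blast
  qed (use P Par1 Par2 tas in auto)
  moreover have "pruned P"
    using Par1 ne child r by (auto simp: pruned_def less_2_cases_iff)
  moreover have "connected_prenet P"
    using r by (simp add: connected_prenet_def)
  ultimately show ?thesis
    using Par1 Par2 eq unfolding is_bush_def by (intro conjI) (simp_all, blast)
qed

text \<open>\<open>surj1\<close> and \<open>surj2\<close> are condition (b) read vertex by vertex;
  condition (c) comes from \<open>bush_disjoint_cover\<close>.\<close>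

lemma bush_arrI:
  assumes P: "is_bush P" and X: "X \<in> Obj PreNet2" and f: "f \<in> level_maps P X"
    and mono1: "\<And>a b. (a, b) \<in> Less P 1 \<Longrightarrow> f 1 a = f 1 b \<or> (f 1 a, f 1 b) \<in> less_circ X 1"
    and mono2: "\<And>c d. (c, d) \<in> Less P 2 \<Longrightarrow> Par P 2 c = Par P 2 d \<Longrightarrow>
      f 2 c = f 2 d \<or> (f 2 c, f 2 d) \<in> less_circ X 2"
    and surj1: "\<And>x. x \<in> Lev X 1 \<Longrightarrow> Par X 1 x \<noteq> {} \<longleftrightarrow> x \<in> f 1 ` Lev P 1"
    and surj2: "\<And>a x. a \<in> Lev P 1 \<Longrightarrow> x \<in> Lev X 2 \<Longrightarrow>
      f 1 a \<in> Par X 2 x \<longleftrightarrow> (\<exists>c\<in>Lev P 2. a \<in> Par P 2 c \<and> f 2 c = x)"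
    and core: "\<And>c. c \<in> core P \<Longrightarrow> f 2 c \<in> core X"
  shows "(P, f, X) \<in> Arr PreNet2"
proof -
  obtain r r' where r: "Lev P 0 = {r}" "Lev X 0 = {r'}"
    using bush_Obj[OF P] X by (auto simp: connected_prenet_def)
  have fr: "f 0 r = r'"
    using f r by (auto simp: level_maps_def)
  have "preimage P f (i - 1) (Par X i x) = parents P i (preimage P f i {x})"
    if i: "i \<in> {1, 2}" and x: "x \<in> Lev X i" for i x
  proof (cases "i = 1")
    case True
    have "Par X 1 x \<subseteq> {r'}"
      using Par_subset[of X 1 x] X x r True by auto
    then have "Par X 1 x = (if x \<in> f 1 ` Lev P 1 then {r'} else {})"
      using surj1[of x] x True by auto
    then show ?thesis
      using True r fr bush_Par1[OF P] by (auto simp: preimage_def parents_def)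
  next
    case False
    then have i: "i = 2"
      using i by auto
    have "Par P 2 c \<subseteq> Lev P 1" if "c \<in> Lev P 2" for c
      using Par_subset[of P 2 c] bush_Obj[OF P] that by auto
    then show ?thesis
      using surj2[of _ x] x i by (fastforce simp: preimage_def parents_def)
  qed
  moreover have "preimage P f i {x} \<subseteq> Lev P i" for i x
    by (auto simp: preimage_def)
  moreover have *: "f i x = f i y \<or> (f i x, f i y) \<in> less_circ X i"
    if "(x, y) \<in> less_circ P i" for i x y
    using that mono1 mono2 unfolding less_circ_bush[OF P] by (auto split: if_splits)
  ultimately have "is_prenet_map P X f"
    unfolding is_prenet_map_def
  proof (intro conjI allI ballI)
    fix i xy
    assume "xy \<in> less_circ P i"
    then show "case xy of (x, y) \<Rightarrow> f i x = f i y \<or> (f i x, f i y) \<in> less_circ X i"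
      using * by (cases xy) blast
  qed (use bush_disjoint_cover[OF P] core in auto)
  then show ?thesis
    using bush_Obj[OF P] X f by (simp add: Arr_PreNet2)
qed

text \<open>If parent sets are preimages, then (b) reduces to surjectivity, and siblings have
  siblings as images, so that monotony for \<open>Less\<close> already gives monotony for
  \<open>less_circ\<close>.\<close>

lemma bush_weI:
  assumes P: "is_bush P" and Q: "is_bush Q" and f: "f \<in> level_maps P Q"
    and Par: "\<And>c. c \<in> Lev P 2 \<Longrightarrow> Par P 2 c = {a \<in> Lev P 1. f 1 a \<in> Par Q 2 (f 2 c)}"
    and surj: "f 1 ` Lev P 1 = Lev Q 1" "f 2 ` Lev P 2 = Lev Q 2"
    and mono1: "\<And>a b. (a, b) \<in> Less P 1 \<Longrightarrow> f 1 a = f 1 b \<or> (f 1 a, f 1 b) \<in> Less Q 1"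
    and mono2: "\<And>c d. (c, d) \<in> Less P 2 \<Longrightarrow> Par P 2 c = Par P 2 d \<Longrightarrow>
      f 2 c = f 2 d \<or> (f 2 c, f 2 d) \<in> Less Q 2"
    and core: "bij_betw (f 2) (core P) (core Q)"
  shows "(P, f, Q) \<in> weak_equivalences"
proof -
  have fL: "f i x \<in> Lev Q i" if "x \<in> Lev P i" for i x
    using f that by (auto simp: level_maps_def)
  have PP: "a \<in> Par P 2 c \<longleftrightarrow> a \<in> Lev P 1 \<and> f 1 a \<in> Par Q 2 (f 2 c)" if "c \<in> Lev P 2" for a c
    by (simp add: Par[OF that])
  have "(P, f, Q) \<in> Arr PreNet2"
  proof (rule bush_arrI[OF P _ f])
    show "Q \<in> Obj PreNet2"
      using bush_Obj[OF Q] by simp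
    show "f 1 a = f 1 b \<or> (f 1 a, f 1 b) \<in> less_circ Q 1" if "(a, b) \<in> Less P 1" for a b
    proof -
      have "Par Q 1 (f 1 a) = Lev Q 0" "Par Q 1 (f 1 b) = Lev Q 0"
        using Less_Lev[OF bush_ordered[OF P] that] fL bush_Par1[OF Q] by blast+
      then show ?thesis
        using mono1[OF that] unfolding less_circ_bush[OF Q] by auto
    qed
    show "f 2 c = f 2 d \<or> (f 2 c, f 2 d) \<in> less_circ Q 2"
      if cd: "(c, d) \<in> Less P 2" "Par P 2 c = Par P 2 d" for c d
    proof -
      have L: "c \<in> Lev P 2" "d \<in> Lev P 2"
        using Less_Lev[OF bush_ordered[OF P] cd(1)] by auto
      obtain a where "a \<in> Par P 2 c" "a \<in> Par P 2 d"
        using bush_Par2[OF P L(1)] cd(2) by auto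
      then have "f 1 a \<in> Par Q 2 (f 2 c)" "f 1 a \<in> Par Q 2 (f 2 d)"
        using PP L by auto
      then have "Par Q 2 (f 2 c) = Par Q 2 (f 2 d)"
        by (rule bush_Par2_eq[OF Q fL[OF L(1)] fL[OF L(2)]])
      then show ?thesis
        using mono2[OF cd] unfolding less_circ_bush[OF Q] by auto
    qed
    show "Par Q 1 x \<noteq> {} \<longleftrightarrow> x \<in> f 1 ` Lev P 1" if "x \<in> Lev Q 1" for x
    proof -
      have "Lev Q 0 \<noteq> {}"
        using bush_Obj[OF Q] by (auto simp: connected_prenet_def)
      then show ?thesis
        using that surj(1) bush_Par1[OF Q that] by simp
    qed
    show "f 1 a \<in> Par Q 2 x \<longleftrightarrow> (\<exists>c\<in>Lev P 2. a \<in> Par P 2 c \<and> f 2 c = x)"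
      if "a \<in> Lev P 1" "x \<in> Lev Q 2" for a x
    proof
      assume "f 1 a \<in> Par Q 2 x"
      moreover obtain c where "c \<in> Lev P 2" "f 2 c = x"
        using \<open>x \<in> Lev Q 2\<close> unfolding surj(2)[symmetric] by blast
      ultimately show "\<exists>c\<in>Lev P 2. a \<in> Par P 2 c \<and> f 2 c = x"
        using PP[of c a] \<open>a \<in> Lev P 1\<close> by blast
    next
      assume "\<exists>c\<in>Lev P 2. a \<in> Par P 2 c \<and> f 2 c = x"
      then show "f 1 a \<in> Par Q 2 x"
        using PP[of _ a] by blast
    qed
    show "f 2 c \<in> core Q" if "c \<in> core P" for c
      using bij_betwE[OF core] that by blast
  qed
  then show ?thesis
    using core Par by (rule weak_equivalencesI)
qed

text \<open>This manufactures new bushes. When parent sets are defined as preimages along a monotone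
  surjection to a bush, its axioms lift: intervals pull back, and strict inequalities on level 1 are
  reflected.\<close>

lemma bush_pullback:
  assumes P: "is_bush P" and Q: "ordered_levels Q" "Lev Q 0 = Lev P 0" "Tassels Q \<subseteq> Lev Q 2"
    and Par1: "\<And>a. a \<in> Lev Q 1 \<Longrightarrow> Par Q 1 a = Lev Q 0"
    and Par2: "\<And>c. c \<in> Lev Q 2 \<Longrightarrow> Par Q 2 c = {a \<in> Lev Q 1. f 1 a \<in> Par P 2 (f 2 c)}"
    and f: "f \<in> level_maps Q P" and surj: "f 1 ` Lev Q 1 = Lev P 1" "f 2 ` Lev Q 2 = Lev P 2"
    and mono1: "\<And>a b. (a, b) \<in> Less Q 1 \<Longrightarrow> f 1 a = f 1 b \<or> (f 1 a, f 1 b) \<in> Less P 1"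
    and mono2: "\<And>c d. (c, d) \<in> Less Q 2 \<Longrightarrow> f 2 c = f 2 d \<or> (f 2 c, f 2 d) \<in> Less P 2"
    and core: "bij_betw (f 2) (core Q) (core P)"
  shows "is_bush Q" "(Q, f, P) \<in> weak_equivalences"
proof -
  obtain r where r: "Lev P 0 = {r}"
    using bush_Obj[OF P] by (auto simp: connected_prenet_def)
  have ne: "Lev P 1 \<noteq> {}"
    using bush_Obj[OF P] r by (fastforce simp: pruned_def)
  have fL: "f i x \<in> Lev P i" if "x \<in> Lev Q i" for i x
    using f that by (auto simp: level_maps_def)
  have PL: "Par P 2 c \<subseteq> Lev P 1" if "c \<in> Lev P 2" for c
    using Par_subset[of P 2 c] bush_Obj[OF P] that by auto
  have neq: "Par Q 2 c \<noteq> {}" if "c \<in> Lev Q 2" for c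
  proof -
    obtain a where "a \<in> Par P 2 (f 2 c)"
      using bush_Par2[OF P, of "f 2 c"] fL \<open>c \<in> Lev Q 2\<close> by auto
    moreover from this have "a \<in> f 1 ` Lev Q 1"
      using PL[of "f 2 c"] fL[OF \<open>c \<in> Lev Q 2\<close>] surj(1) by auto
    then obtain b where "b \<in> Lev Q 1" "f 1 b = a"
      by auto
    ultimately show ?thesis
      using Par2[OF \<open>c \<in> Lev Q 2\<close>] by auto
  qed
  have int: "Par Q 2 c \<in> intervals Q 1" if c: "c \<in> Lev Q 2" for c
  proof -
    have I: "Par P 2 (f 2 c) \<in> intervals P 1"
      using bush_Obj[OF P] fL[OF c] by (auto simp: is_prenet_def)
    have "f 1 y \<in> Par P 2 (f 2 c)"
      if "(x, y) \<in> Less Q 1" "(y, z) \<in> Less Q 1" "f 1 x \<in> Par P 2 (f 2 c)"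
        "f 1 z \<in> Par P 2 (f 2 c)" for x y z
    proof -
      have "f 1 x = f 1 y \<or> (f 1 x, f 1 y) \<in> Less P 1" "f 1 y = f 1 z \<or> (f 1 y, f 1 z) \<in> Less P 1"
        using that mono1 by blast+
      then show ?thesis
        using that(3,4) I unfolding intervals_def by (metis (no_types, lifting) mem_Collect_eq)
    qed
    then show ?thesis
      using Par2[OF c] Less_Lev[OF Q(1)] unfolding intervals_def by blast
  qed
  show "is_bush Q"
  proof (rule is_bushI[OF Q(1), of r])
    show "Par Q 2 c = Par Q 2 d \<or> set_less Q 1 (Par Q 2 c) (Par Q 2 d)" if cd:
      "(c, d) \<in> Less Q 2" for c d
    proof (cases "Par P 2 (f 2 c) = Par P 2 (f 2 d)")
      case True
      then show ?thesis
        using Par2 Less_Lev[OF Q(1) cd] by auto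
    next
      case False
      have L: "c \<in> Lev Q 2" "d \<in> Lev Q 2"
        using Less_Lev[OF Q(1) cd] by auto
      have less: "(f 2 c, f 2 d) \<in> Less P 2"
        using False mono2[OF cd] by auto
      have "(f 2 c, f 2 d) \<notin> less_circ P 2" "(f 2 d, f 2 c) \<notin> less_circ P 2"
        using False unfolding less_circ_bush[OF P] by auto
      then have "set_less P 1 (Par P 2 (f 2 c)) (Par P 2 (f 2 d))"
        using less bush_Obj(1)[OF P] by (fastforce simp: is_prenet_def)
      then have "set_less Q 1 (Par Q 2 c) (Par Q 2 d)"
        unfolding set_less_def
      proof (intro ballI)
        fix a b
        assume ab: "a \<in> Par Q 2 c" "b \<in> Par Q 2 d"
        then have "a \<in> Lev Q 1" "b \<in> Lev Q 1" "(f 1 a, f 1 b) \<in> Less P 1"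
          using Par2[OF L(1)] Par2[OF L(2)] \<open>set_less P 1 _ _\<close> by (auto simp: set_less_def)
        \<comment> \<open>Level 1 of \<open>Q\<close> is linearly ordered and \<open>f 1\<close> is
          monotone, so a strict inequality between images leaves only one order upstairs.\<close>
        then show "(a, b) \<in> Less Q 1"
          using Less_linear[OF Q(1), of a 1 b] mono1[of b a] Less_asym[OF bush_ordered[OF P], of
            "f 1 a" "f 1 b"]
            Less_irrefl[OF bush_ordered[OF P], of "f 1 a" 1] by metis
      qed
      then show ?thesis
        by simp
    qed
    show "\<exists>c\<in>Lev Q 2. a \<in> Par Q 2 c" if "a \<in> Lev Q 1" for a
    proof -
      obtain c where "c \<in> Lev P 2" "f 1 a \<in> Par P 2 c"
        using bush_child[OF P fL[OF \<open>a \<in> Lev Q 1\<close>]] by auto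
      moreover from this have "c \<in> f 2 ` Lev Q 2"
        using surj(2) by simp
      then obtain d where "d \<in> Lev Q 2" "f 2 d = c"
        by auto
      ultimately show ?thesis
        using Par2[of d] that by auto
    qed
    show "Par Q 2 c = Par Q 2 d"
      if "c \<in> Lev Q 2" "d \<in> Lev Q 2" "a \<in> Par Q 2 c" "a \<in> Par Q 2 d" for a c d
    proof -
      have "f 1 a \<in> Par P 2 (f 2 c)" "f 1 a \<in> Par P 2 (f 2 d)"
        using that Par2 by blast+
      then have "Par P 2 (f 2 c) = Par P 2 (f 2 d)"
        by (rule bush_Par2_eq[OF P fL[OF that(1)] fL[OF that(2)]])
      then show ?thesis
        using Par2 that by simp
    qed
  qed (use Q r ne surj(1) Par1 neq int in auto)
  then show "(Q, f, P) \<in> weak_equivalences"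
    by (rule bush_weI[OF _ P f Par2 surj mono1 mono2 core])
qed

text \<open>Conditions (a), (b) and (d) compose directly; (c) for the composite is free because its
  source is a bush.\<close>

lemma bush_comp_arr:
  assumes P: "is_bush P" and f: "(P, f, X) \<in> Arr PreNet2" and g: "(X, g, Y) \<in> Arr PreNet2"
  shows "(P, \<lambda>i. compose (Lev P i) (g i) (f i), Y) \<in> Arr PreNet2"
proof -
  note L = Less_Lev[OF bush_ordered[OF P]]
  define h where "h i = compose (Lev P i) (g i) (f i)" for i
  have h: "h i x = g i (f i x)" if "x \<in> Lev P i" for i x
    using that by (simp add: h_def compose_eq)
  have mono: "h i x = h i y \<or> (h i x, h i y) \<in> less_circ Y i"
    if "(x, y) \<in> Less P i" "Par P i x = Par P i y" "i \<in> {1, 2}" for x y i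
  proof -
    have "(x, y) \<in> less_circ P i"
      using that by (simp add: less_circ_bush[OF P])
    then have "f i x = f i y \<or> (f i x, f i y) \<in> less_circ X i"
      by (rule arr_less_circ[OF f])
    then show ?thesis
      using arr_less_circ[OF g, of "f i x" "f i y" i] L[OF that(1)] h by auto
  qed
  have "(P, h, Y) \<in> Arr PreNet2"
  proof (rule bush_arrI[OF P])
    show "Y \<in> Obj PreNet2"
      using g by (simp add: Arr_PreNet2)
    show "h \<in> level_maps P Y"
      using arr_Lev[OF f] arr_Lev[OF g] by (auto simp: level_maps_def h_def compose_def)
    show "h 1 a = h 1 b \<or> (h 1 a, h 1 b) \<in> less_circ Y 1" if "(a, b) \<in> Less P 1" for a b
      using mono[OF that] bush_Par1[OF P] L[OF that] by auto
    show "h 2 c = h 2 d \<or> (h 2 c, h 2 d) \<in> less_circ Y 2"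
      if "(c, d) \<in> Less P 2" "Par P 2 c = Par P 2 d" for c d
      using mono[OF that] by auto
    show "Par Y 1 y \<noteq> {} \<longleftrightarrow> y \<in> h 1 ` Lev P 1" if y: "y \<in> Lev Y 1" for y
    proof
      assume "Par Y 1 y \<noteq> {}"
      then obtain x where x: "x \<in> Lev X 1" "Par X 1 x \<noteq> {}" "g 1 x = y"
        by (rule arr_parented_surj[OF g y])
      obtain a where "a \<in> Lev P 1" "f 1 a = x"
        by (rule arr_parented_surj[OF f x(1,2)])
      then show "y \<in> h 1 ` Lev P 1"
        using h[of a 1] x(3) by force
    next
      assume "y \<in> h 1 ` Lev P 1"
      then obtain a where a: "a \<in> Lev P 1" "h 1 a = y"
        by auto
      then have "Par P 1 a \<noteq> {}"
        using bush_Par1[OF P] bush_Obj[OF P] by (auto simp: connected_prenet_def)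
      then have "Par Y 1 (g 1 (f 1 a)) \<noteq> {}"
        using arr_parented[OF f a(1)] arr_parented[OF g] arr_Lev[OF f a(1)] by blast
      then show "Par Y 1 y \<noteq> {}"
        using h[OF a(1)] a(2) by simp
    qed
    show "h 1 a \<in> Par Y 2 y \<longleftrightarrow> (\<exists>c\<in>Lev P 2. a \<in> Par P 2 c \<and> h 2 c = y)"
      if ay: "a \<in> Lev P 1" "y \<in> Lev Y 2" for a y
    proof -
      have "g 1 (f 1 a) \<in> Par Y 2 y \<longleftrightarrow> (\<exists>x\<in>Lev X 2. f 1 a \<in> Par X 2 x \<and> g 2 x = y)"
        using arr_Par[OF g, of 2 y "f 1 a"] arr_Lev[OF f ay(1)] ay(2) by simp
      also have "\<dots> \<longleftrightarrow> (\<exists>x\<in>Lev X 2. (\<exists>c\<in>Lev P 2. a \<in> Par P 2 c \<and> f 2 c = x) \<and> g 2 x = y)"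
        using arr_Par[OF f, of 2 _ a] ay(1) by simp
      also have "\<dots> \<longleftrightarrow> (\<exists>c\<in>Lev P 2. a \<in> Par P 2 c \<and> h 2 c = y)"
        using arr_Lev[OF f, of _ 2] h[of _ 2] by force
      finally show ?thesis
        using h[OF ay(1)] by simp
    qed
    show "h 2 c \<in> core Y" if "c \<in> core P" for c
      using arr_core[OF g arr_core[OF f that]] that h[of c 2] by (simp add: core_def)
  qed
  then show ?thesis
    by (simp add: h_def[abs_def])
qed

lemma bush_comp_we:
  assumes P: "is_bush P" and f: "(P, f, X) \<in> weak_equivalences" and g:
    "(X, g, Y) \<in> weak_equivalences"
  shows "(P, \<lambda>i. compose (Lev P i) (g i) (f i), Y) \<in> weak_equivalences"
proof (rule weak_equivalencesI)
  note Df = weak_equivalencesD[OF f] and Dg = weak_equivalencesD[OF g]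
  show "(P, \<lambda>i. compose (Lev P i) (g i) (f i), Y) \<in> Arr PreNet2"
    by (rule bush_comp_arr[OF P Df(1) Dg(1)])
  have "bij_betw (g 2 \<circ> f 2) (core P) (core Y)"
    by (rule bij_betw_trans[OF Df(2) Dg(2)])
  then show "bij_betw (compose (Lev P 2) (g 2) (f 2)) (core P) (core Y)"
    by (rule bij_betw_cong[THEN iffD1, rotated]) (simp add: core_def compose_eq)
  fix x
  assume x: "x \<in> Lev P 2"
  have "f 1 a \<in> Par X 2 (f 2 x) \<longleftrightarrow> g 1 (f 1 a) \<in> Par Y 2 (g 2 (f 2 x))" if "a \<in> Lev P 1" for a
    using Dg(3)[OF arr_Lev[OF Df(1) x]] arr_Lev[OF Df(1) that] by simp
  then show "Par P 2 x = {a \<in> Lev P 1. compose (Lev P 1) (g 1) (f 1) a \<in> Par Y 2 (compose (Lev P 2)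
    (g 2) (f 2) x)}"
    using Df(3)[OF x] x by (auto simp: compose_eq)
qed

section \<open>Trees\<close>

context
  fixes S :: "'a tree"
  assumes S: "is_tree S"
begin

lemma tree_ordered: "ordered_levels S"
  using S by (simp add: is_tree_def)

lemma tree_root: "\<exists>r. Lev S 0 = {r}"
  using S by (simp add: is_tree_def)

lemma tree_Up1: "x \<in> Lev S 1 \<Longrightarrow> Up S 1 x \<in> Lev S 0"
  and tree_Up2: "y \<in> Lev S 2 \<Longrightarrow> Up S 2 y \<in> Lev S 1"
  using S by (auto simp: is_tree_def)

lemma tree_mono: "(y, y') \<in> Less S 2 \<Longrightarrow> Up S 2 y = Up S 2 y' \<or> (Up S 2 y, Up S 2 y') \<in> Less S 1"
  using S by (auto simp: is_tree_def)

lemma level_ordinal_simps: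
  "level_ordinal S 1 0 = Less S 1"
  "level_ordinal S 2 0 = {(x, y) \<in> Less S 2. Up S 2 x \<noteq> Up S 2 y}"
  "level_ordinal S 2 1 = {(x, y) \<in> Less S 2. Up S 2 x = Up S 2 y}"
proof -
  \<comment> \<open>\<open>ancestor\<close> recurses on \<open>Suc\<close>, so for these
    computations 1 is unfolded again.\<close>
  note [simp del] = One_nat_def [symmetric]
  note [simp] = One_nat_def
  obtain r where r: "Lev S 0 = {r}"
    using tree_root by auto
  have L: "(x, y) \<in> Less S i \<Longrightarrow> x \<in> Lev S i \<and> y \<in> Lev S i \<and> x \<noteq> y" for x y i
    using Less_Lev[OF tree_ordered] Less_irrefl[OF tree_ordered] by blast
  have up: "x \<in> Lev S 1 \<Longrightarrow> Up S 1 x = r" "y \<in> Lev S 2 \<Longrightarrow> Up S 2 y \<in> Lev S 1" for x y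
    using tree_Up1[of x] tree_Up2[of y] r by auto
  show "level_ordinal S 1 0 = Less S 1"
    using L[of _ _ 1] up by (fastforce simp: level_ordinal_def le_Suc_eq)
  show "level_ordinal S 2 0 = {(x, y) \<in> Less S 2. Up S 2 x \<noteq> Up S 2 y}"
    using L[of _ _ 2] up by (fastforce simp: level_ordinal_def le_Suc_eq numeral_2_eq_2)
  show "level_ordinal S 2 1 = {(x, y) \<in> Less S 2. Up S 2 x = Up S 2 y}"
    using L[of _ _ 2] up by (fastforce simp: level_ordinal_def le_Suc_eq numeral_2_eq_2)
qed

end

text \<open>Elementary form of the arrows between trees. On level 2 only siblings are constrained:
  for other pairs the ordinal condition follows from monotony on level 1. On level 0 there is
  nothing to say beyond membership in \<open>level_maps\<close>.\<close>

definition is_epi_map :: "'a tree \<Rightarrow> 'a tree \<Rightarrow> 'a level_map \<Rightarrow> bool" where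
  "is_epi_map S T f \<longleftrightarrow> f \<in> level_maps S T \<and> f 1 ` Lev S 1 = Lev T 1 \<and>
    (\<forall>y\<in>Lev S 2. Up T 2 (f 2 y) = f 1 (Up S 2 y)) \<and>
    (\<forall>(x, x')\<in>Less S 1. f 1 x = f 1 x' \<or> (f 1 x, f 1 x') \<in> Less T 1) \<and>
    (\<forall>(y, y')\<in>Less S 2. Up S 2 y = Up S 2 y' \<longrightarrow> f 2 y = f 2 y' \<or> (f 2 y, f 2 y') \<in> Less T 2)"

lemma is_epi_mapD:
  assumes "is_epi_map S T f"
  shows "x \<in> Lev S i \<Longrightarrow> f i x \<in> Lev T i" "f \<in> level_maps S T" "f 1 ` Lev S 1 = Lev T 1"
    "y \<in> Lev S 2 \<Longrightarrow> Up T 2 (f 2 y) = f 1 (Up S 2 y)"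
    "(x, x') \<in> Less S 1 \<Longrightarrow> f 1 x = f 1 x' \<or> (f 1 x, f 1 x') \<in> Less T 1"
    "(y, y') \<in> Less S 2 \<Longrightarrow> Up S 2 y = Up S 2 y' \<Longrightarrow> f 2 y = f 2 y' \<or> (f 2 y, f 2 y') \<in> Less T 2"
  using assms by (auto simp: is_epi_map_def level_maps_def)

lemma is_epi_mapI:
  assumes "f \<in> level_maps S T" "f 1 ` Lev S 1 = Lev T 1"
    "\<And>y. y \<in> Lev S 2 \<Longrightarrow> Up T 2 (f 2 y) = f 1 (Up S 2 y)"
    "\<And>x x'. (x, x') \<in> Less S 1 \<Longrightarrow> f 1 x = f 1 x' \<or> (f 1 x, f 1 x') \<in> Less T 1"
    "\<And>y y'. (y, y') \<in> Less S 2 \<Longrightarrow> Up S 2 y = Up S 2 y' \<Longrightarrow> f 2 y = f 2 y' \<or> (f 2 y, f 2 y') \<in> Less T 2"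
  shows "is_epi_map S T f"
  using assms unfolding is_epi_map_def by blast

lemma is_ordinal_map_2:
  assumes "is_tree S" "is_tree T"
  shows "is_ordinal_map 2 X (level_ordinal S 2) (level_ordinal T 2) g \<longleftrightarrow>
    (\<forall>x\<in>X. \<forall>y\<in>X. (x, y) \<in> Less S 2 \<longrightarrow> g x = g y \<or>
      (if Up S 2 x = Up S 2 y then (g x, g y) \<in> Less T 2 \<and> Up T 2 (g x) = Up T 2 (g y)
       else (g x, g y) \<in> Less T 2 \<or> (g y, g x) \<in> Less T 2 \<and> Up T 2 (g y) = Up T 2 (g x)))"
proof -
  have all: "(\<forall>i<2. P i) \<longleftrightarrow> P 0 \<and> P (1 :: nat)" and ex: "(\<exists>i<2. P i) \<longleftrightarrow> P 0 \<or> P (1 :: nat)" for P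
    by (auto simp: less_2_cases_iff)
  show ?thesis
    unfolding is_ordinal_map_def all ex level_ordinal_simps[OF assms(1)] level_ordinal_simps[OF
      assms(2)]
    by (intro ball_cong refl) auto
qed

lemma tree_map_iff:
  assumes S: "is_tree S" and T: "is_tree T" and f: "f \<in> level_maps S T"
  shows "is_tree_map S T f \<and> f 0 ` Lev S 0 = Lev T 0 \<and> f 1 ` Lev S 1 = Lev T 1 \<longleftrightarrow> is_epi_map S T f"
proof -
  have fL: "f i x \<in> Lev T i" if "x \<in> Lev S i" for i x
    using f that by (auto simp: level_maps_def)
  obtain r r' where r: "Lev S 0 = {r}" "Lev T 0 = {r'}"
    using tree_root[OF S] tree_root[OF T] by auto
  have f0: "f 0 r = r'"
    using fL[of r 0] r by auto
  have up1: "Up S 1 x = r" if "x \<in> Lev S 1" for x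
    using tree_Up1[OF S that] r by auto
  have up1': "Up T 1 x = r'" if "x \<in> Lev T 1" for x
    using tree_Up1[OF T that] r by auto
  have ord1: "is_ordinal_map 1 (Lev S 1) (level_ordinal S 1) (level_ordinal T 1) (f 1) \<longleftrightarrow>
      (\<forall>(x, x')\<in>Less S 1. f 1 x = f 1 x' \<or> (f 1 x, f 1 x') \<in> Less T 1)"
    using Less_Lev[OF tree_ordered[OF S], of _ _ 1]
    by (fastforce simp: is_ordinal_map_def level_ordinal_simps(1)[OF S] level_ordinal_simps(1)[OF
      T])
  have ord0: "is_ordinal_map 0 (Lev S 0) (level_ordinal S 0) (level_ordinal T 0) (f 0)"
    by (simp add: is_ordinal_map_def)
  have comm: "(\<forall>i\<in>{1, 2}. \<forall>x\<in>Lev S i. f (i - 1) (Up S i x) = Up T i (f i x)) \<longleftrightarrow>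
      (\<forall>y\<in>Lev S 2. Up T 2 (f 2 y) = f 1 (Up S 2 y))"
    using f0 up1 up1' fL by auto
  have ord2: "is_ordinal_map 2 (Lev S 2) (level_ordinal S 2) (level_ordinal T 2) (f 2) \<longleftrightarrow>
      (\<forall>(y, y')\<in>Less S 2. Up S 2 y = Up S 2 y' \<longrightarrow> f 2 y = f 2 y' \<or> (f 2 y, f 2 y') \<in> Less T 2)"
    if C: "\<And>y. y \<in> Lev S 2 \<Longrightarrow> Up T 2 (f 2 y) = f 1 (Up S 2 y)"
      and M: "\<And>x x'. (x, x') \<in> Less S 1 \<Longrightarrow> f 1 x = f 1 x' \<or> (f 1 x, f 1 x') \<in> Less T 1"
  proof -
    \<comment> \<open>For non-siblings the ordinal condition excludes just one case:
      \<open>f 2 y\<close> preceding \<open>f 2 x\<close> under a different parent. Monotony on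
      level 1 and of the parent map of \<open>T\<close> rules it out.\<close>
    have *: "f 2 x = f 2 y \<or> (f 2 x, f 2 y) \<in> Less T 2 \<or>
      (f 2 y, f 2 x) \<in> Less T 2 \<and> Up T 2 (f 2 y) = Up T 2 (f 2 x)"
      if xy: "(x, y) \<in> Less S 2" and ne: "Up S 2 x \<noteq> Up S 2 y" for x y
    proof -
      have L: "x \<in> Lev S 2" "y \<in> Lev S 2"
        using Less_Lev[OF tree_ordered[OF S] xy] by auto
      have "Up T 2 (f 2 x) = Up T 2 (f 2 y) \<or> (Up T 2 (f 2 x), Up T 2 (f 2 y)) \<in> Less T 1"
        using M[of "Up S 2 x" "Up S 2 y"] tree_mono[OF S xy] ne C L by auto
      moreover have "f 2 x = f 2 y \<or> (f 2 x, f 2 y) \<in> Less T 2 \<or> (f 2 y, f 2 x) \<in> Less T 2"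
        by (rule Less_linear[OF tree_ordered[OF T] fL[OF L(1)] fL[OF L(2)]])
      ultimately show ?thesis
        using tree_mono[OF T, of "f 2 y" "f 2 x"] Less_asym[OF tree_ordered[OF T]] by metis
    qed
    show ?thesis
      unfolding is_ordinal_map_2[OF S T]
      using * Less_Lev[OF tree_ordered[OF S], of _ _ 2] C by (auto split: prod.splits) metis+
  qed
  have "is_tree_map S T f \<longleftrightarrow> (\<forall>y\<in>Lev S 2. Up T 2 (f 2 y) = f 1 (Up S 2 y)) \<and>
      (\<forall>(x, x')\<in>Less S 1. f 1 x = f 1 x' \<or> (f 1 x, f 1 x') \<in> Less T 1) \<and>
      (\<forall>(y, y')\<in>Less S 2. Up S 2 y = Up S 2 y' \<longrightarrow> f 2 y = f 2 y' \<or> (f 2 y, f 2 y') \<in> Less T 2)"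
    (is "_ \<longleftrightarrow> ?C \<and> ?M \<and> _")
  proof -
    have all: "(\<forall>l\<le>2. P l) \<longleftrightarrow> P 0 \<and> P 1 \<and> P (2 :: nat)" for P
      by (metis le_SucE le_zero_eq numeral_2_eq_2 One_nat_def le_refl le_SucI)
    have "is_ordinal_map 2 (Lev S 2) (level_ordinal S 2) (level_ordinal T 2) (f 2) \<longleftrightarrow>
      (\<forall>(y, y')\<in>Less S 2. Up S 2 y = Up S 2 y' \<longrightarrow> f 2 y = f 2 y' \<or> (f 2 y, f 2 y') \<in> Less T 2)"
      if ?C ?M
      by (rule ord2) (use that in blast)+
    then show ?thesis
      unfolding is_tree_map_def comm all ord1 using ord0 by blast
  qed
  moreover have "f 0 ` Lev S 0 = Lev T 0"
    using r f0 by simp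
  ultimately show ?thesis
    using f unfolding is_epi_map_def by blast
qed

section \<open>The category of trees with nonempty level 1\<close>

abbreviation (input) tree_category :: "('a tree, 'a tree_arrow) category" where
  "tree_category \<equiv> full_subcategory Tree2_Epi1 (\<lambda>T. Lev T 1 \<noteq> {})"

lemma Trees_simps:
  "Obj tree_category = {S. is_tree S \<and> Lev S 1 \<noteq> {}}"
  "Dom tree_category (S, f, T) = S" "Cod tree_category (S, f, T) = T"
  "Ide tree_category S = (S, \<lambda>i. restrict id (Lev S i), S)"
  "Comp tree_category (T', g, U) (S, f, T) = (S, \<lambda>i. compose (Lev S i) (g i) (f i), U)"
  by (simp_all add: full_subcategory_def Tree2_Epi1_def level_category_def)

lemma Arr_Trees: "(S, f, T) \<in> Arr tree_category \<longleftrightarrow>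
  S \<in> Obj tree_category \<and> T \<in> Obj tree_category \<and> is_epi_map S T f"
proof -
  have "(S, f, T) \<in> Arr tree_category \<longleftrightarrow>
    S \<in> Obj tree_category \<and> T \<in> Obj tree_category \<and> f \<in> level_maps S T \<and>
      (is_tree_map S T f \<and> f 0 ` Lev S 0 = Lev T 0 \<and> f 1 ` Lev S 1 = Lev T 1)"
    by (simp add: full_subcategory_def Tree2_Epi1_def level_category_def) blast
  then show ?thesis
    using tree_map_iff[of S T f] is_epi_mapD(2)[of S T f] unfolding Trees_simps by blast
qed

lemma hom_set_Trees:
  "\<phi> \<in> hom_set tree_category S T \<longleftrightarrow> (\<exists>f. \<phi> = (S, f, T) \<and> (S, f, T) \<in> Arr tree_category)"
  by (cases \<phi>) (auto simp: hom_set_def Trees_simps Arr_Trees)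

lemma is_epi_map_comp:
  assumes S: "is_tree S" and f: "is_epi_map S T f" and g: "is_epi_map T U g"
  shows "is_epi_map S U (\<lambda>i. compose (Lev S i) (g i) (f i))"
proof -
  note L = Less_Lev[OF tree_ordered[OF S]]
  note F = is_epi_mapD[OF f] and G = is_epi_mapD[OF g]
  define h where "h i = compose (Lev S i) (g i) (f i)" for i
  have h: "h i x = g i (f i x)" if "x \<in> Lev S i" for i x
    using that by (simp add: h_def compose_eq)
  have "h \<in> level_maps S U"
    using F(1) G(1) by (auto simp: level_maps_def h_def compose_def)
  moreover have "h 1 ` Lev S 1 = g 1 ` (f 1 ` Lev S 1)"
    using h by force
  then have "h 1 ` Lev S 1 = Lev U 1"
    using F(3) G(3) by simp
  moreover have "Up U 2 (h 2 y) = h 1 (Up S 2 y)" if "y \<in> Lev S 2" for y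
    using F(1)[of y 2] F(4)[OF that] G(4)[of "f 2 y"] h that tree_Up2[OF S that] by auto
  moreover have "h 1 x = h 1 x' \<or> (h 1 x, h 1 x') \<in> Less U 1" if "(x, x') \<in> Less S 1" for x x'
    using F(5)[OF that] G(5)[of "f 1 x" "f 1 x'"] L[OF that] h by auto
  moreover have "h 2 y = h 2 y' \<or> (h 2 y, h 2 y') \<in> Less U 2"
    if "(y, y') \<in> Less S 2" "Up S 2 y = Up S 2 y'" for y y'
    using F(6)[OF that] G(6)[of "f 2 y" "f 2 y'"] F(4) L[OF that(1)] h that(2) by auto
  ultimately have "is_epi_map S U h"
    by (rule is_epi_mapI)
  then show ?thesis
    by (simp add: h_def[abs_def])
qed

lemma is_category_Trees: "is_category tree_category"
  unfolding is_category_def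
proof (intro conjI ballI)
  fix \<phi> :: "'a tree_arrow"
  assume "\<phi> \<in> Arr tree_category"
  then show "Dom tree_category \<phi> \<in> Obj tree_category" "Cod tree_category \<phi> \<in> Obj tree_category"
    by (cases \<phi>; simp add: Trees_simps Arr_Trees)+
next
  fix S :: "'a tree"
  assume "S \<in> Obj tree_category"
  moreover have "is_epi_map S S (\<lambda>i. restrict id (Lev S i))" if "is_tree S"
    using Less_Lev[OF tree_ordered[OF that]] tree_Up2[OF that]
    by (auto simp: is_epi_map_def level_maps_def)
  ultimately show "Ide tree_category S \<in> hom_set tree_category S S"
    unfolding hom_set_Trees Arr_Trees Trees_simps by auto
next
  fix S T U :: "'a tree" and \<phi> \<psi>
  assume "\<phi> \<in> hom_set tree_category S T" "\<psi> \<in> hom_set tree_category T U"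
  then show "Comp tree_category \<psi> \<phi> \<in> hom_set tree_category S U"
    unfolding hom_set_Trees by (auto simp: Trees_simps Arr_Trees intro: is_epi_map_comp)
next
  fix S T :: "'a tree" and \<phi>
  assume "\<phi> \<in> hom_set tree_category S T"
  then obtain f where \<phi>: "\<phi> = (S, f, T)" and f: "f i \<in> Lev S i \<rightarrow>\<^sub>E Lev T i" for i
    unfolding hom_set_Trees by (auto simp: Trees_simps Arr_Trees is_epi_map_def level_maps_def)
  have "compose (Lev S i) (f i) (restrict id (Lev S i)) = f i"
    "compose (Lev S i) (restrict id (Lev T i)) (f i) = f i" for i
    using PiE_arb[OF f] PiE_mem[OF f] by (auto simp: compose_def fun_eq_iff)
  then show "Comp tree_category \<phi> (Ide tree_category S) = \<phi>"
    "Comp tree_category (Ide tree_category T) \<phi> = \<phi>"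
    by (simp_all add: Trees_simps \<phi>)
next
  fix S T U V :: "'a tree" and \<phi> \<psi> \<chi>
  assume "\<phi> \<in> hom_set tree_category S T" "\<psi> \<in> hom_set tree_category T U"
    "\<chi> \<in> hom_set tree_category U V"
  then obtain f g h where *: "\<phi> = (S, f, T)" "\<psi> = (T, g, U)" "\<chi> = (U, h, V)"
    and "f \<in> level_maps S T"
    unfolding hom_set_Trees by (auto simp: Trees_simps Arr_Trees is_epi_map_def)
  then have "f i \<in> Lev S i \<rightarrow> Lev T i" for i
    by (auto simp: level_maps_def)
  then have "compose (Lev S i) (h i) (compose (Lev S i) (g i) (f i)) =
      compose (Lev S i) (compose (Lev T i) (h i) (g i)) (f i)" for i
    by (rule compose_assoc)
  then show "Comp tree_category \<chi> (Comp tree_category \<psi> \<phi>) = Comp tree_category (Comp tree_category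
    \<chi> \<psi>) \<phi>"
    by (simp add: * Trees_simps)
qed

section \<open>The bushes \<open>J(S)\<close> and S-tilde\<close>

lemma grow_simps:
  "Lev (grow S E R) 0 = Vtx ` Lev S 0" "Lev (grow S E R) 1 = Vtx ` Lev S 1"
  "Lev (grow S E R) 2 = Vtx ` Lev S 2 \<union> E" "Tassels (grow S E R) = E"
  "Par (grow S E R) 1 (Vtx x) = {Vtx (Up S 1 x)}" "Par (grow S E R) 2 v = {Vtx (stem S v)}"
  "(Vtx x, Vtx x') \<in> Less (grow S E R) 1 \<longleftrightarrow> (x, x') \<in> Less S 1"
  "(v, w) \<in> Less (grow S E R) 2 \<longleftrightarrow> v \<in> Vtx ` Lev S 2 \<union> E \<and> w \<in> Vtx ` Lev S 2 \<union> E \<and>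
    ((stem S v, stem S w) \<in> Less S 1 \<or> stem S v = stem S w \<and> (v, w) \<in> R)"
  by (auto simp: grow_def Let_def)

text \<open>The order on level 2 is lexicographic, by stem and then by \<open>R\<close>, so
  \<open>R\<close> has to be a strict linear order only within each fibre. Parent sets are
  singletons, hence intervals that are equal or disjoint.\<close>

lemma is_bush_grow:
  fixes S :: "'a tree" and E :: "'a vert set"
  defines "L \<equiv> Vtx ` Lev S 2 \<union> E"
  assumes S: "is_tree S" "Lev S 1 \<noteq> {}" and E: "finite E" "stem S ` E \<subseteq> Lev S 1"
    and surj: "Lev S 1 \<subseteq> stem S ` L"
    and irrefl: "\<And>v. v \<in> L \<Longrightarrow> (v, v) \<notin> R"
    and trans: "\<And>u v w. u \<in> L \<Longrightarrow> v \<in> L \<Longrightarrow> w \<in> L \<Longrightarrow> stem S u = stem S v \<Longrightarrow> stem S v = stem S w \<Longrightarrow>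
      (u, v) \<in> R \<Longrightarrow> (v, w) \<in> R \<Longrightarrow> (u, w) \<in> R"
    and total: "\<And>v w. v \<in> L \<Longrightarrow> w \<in> L \<Longrightarrow> stem S v = stem S w \<Longrightarrow> v = w \<or> (v, w) \<in> R \<or> (w, v) \<in> R"
  shows "is_bush (grow S E R)"
proof -
  let ?G = "grow S E R"
  note So = tree_ordered[OF S(1)]
  have stem: "stem S v \<in> Lev S 1" if "v \<in> L" for v
    using that E(2) tree_Up2[OF S(1)] by (auto simp: L_def)
  have Less2: "(v, w) \<in> Less ?G 2 \<longleftrightarrow> v \<in> L \<and> w \<in> L \<and>
      ((stem S v, stem S w) \<in> Less S 1 \<or> stem S v = stem S w \<and> (v, w) \<in> R)" for v w
    by (simp add: grow_simps L_def)
  have Lev2: "Lev ?G 2 = L"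
    by (simp add: grow_simps L_def)
  have LevN: "Lev ?G i = Vtx ` Lev S i" "Less ?G i = map_prod Vtx Vtx ` Less S i" if "i \<noteq> 2" for i
    using that by (simp_all add: grow_def Let_def)
  obtain r where r: "Lev S 0 = {r}"
    using tree_root[OF S(1)] by auto
  have ord: "ordered_levels ?G"
    unfolding ordered_levels_def
  proof (intro conjI allI impI)
    fix i
    show "finite (Lev ?G i)"
      using finite_Lev[OF So] E(1) by (cases "i = 2") (auto simp: LevN Lev2 L_def)
    show "Less ?G i \<subseteq> Lev ?G i \<times> Lev ?G i"
    proof (cases "i = 2")
      case True
      then show ?thesis
        using Less2 Lev2 by auto
    next
      case False
      then show ?thesis
        using Less_Lev[OF So, of _ _ i] by (auto simp: LevN)
    qed
    show "strict_linear_order_on (Lev ?G i) (Less ?G i)"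
    proof (cases "i = 2")
      case False
      have "trans (map_prod Vtx Vtx ` Less S i)" "irrefl (map_prod Vtx Vtx ` Less S i)"
        using Less_trans[OF So, of _ _ i] Less_irrefl[OF So, of _ i]
        by (auto intro!: transI simp: irrefl_def)
      moreover have "total_on (Vtx ` Lev S i) (map_prod Vtx Vtx ` Less S i)"
        using Less_linear[OF So, of _ i] by (fastforce simp: total_on_def)
      ultimately show ?thesis
        using False by (simp add: LevN strict_linear_order_on_def)
    next
      case True
      have "(u, w) \<in> Less ?G 2" if "(u, v) \<in> Less ?G 2" "(v, w) \<in> Less ?G 2" for u v w
        using that trans[of u v w] Less_trans[OF So, of "stem S u" "stem S v" 1 "stem S w"]
        unfolding Less2 by auto
      moreover have "(v, v) \<notin> Less ?G 2" for v
        using irrefl Less_irrefl[OF So] unfolding Less2 by auto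
      moreover have "v = w \<or> (v, w) \<in> Less ?G 2 \<or> (w, v) \<in> Less ?G 2" if "v \<in> L" "w \<in> L" for v w
        using total[OF that] Less_linear[OF So stem stem, OF that] that unfolding Less2 by auto
      ultimately show ?thesis
        unfolding True Lev2 strict_linear_order_on_def total_on_def irrefl_def by (meson transI)
    qed
  next
    fix i :: nat
    assume "i > 2"
    then show "Lev ?G i = {}"
      using Lev_empty[OF So] by (simp add: LevN)
  qed
  show ?thesis
  proof (rule is_bushI[OF ord, of "Vtx r"])
    show "Par ?G 2 c \<in> intervals ?G 1 - {{}}" if "c \<in> Lev ?G 2" for c
      using that stem Less_asym[OF ord] unfolding Lev2 by (auto simp: grow_simps intervals_def)
    show "\<exists>c\<in>Lev ?G 2. a \<in> Par ?G 2 c" if "a \<in> Lev ?G 1" for a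
      using that surj unfolding Lev2 by (auto simp: grow_simps)
    show "Par ?G 2 c = Par ?G 2 d \<or> set_less ?G 1 (Par ?G 2 c) (Par ?G 2 d)"
      if "(c, d) \<in> Less ?G 2" for c d
      using that unfolding Less2 by (auto simp: grow_simps set_less_def)
  qed (use r S in \<open>auto simp: grow_simps dest: tree_Up1[OF S(1)]\<close>)
qed

lemma J_obj_Lev2: "Lev (J_obj T) 2 = Vtx ` Lev T 2 \<union> Tas ` (Lev T 1 - Up T 2 ` Lev T 2)"
  and J_obj_Lev1: "Lev (J_obj T) 1 = Vtx ` Lev T 1"
  and J_obj_Lev0: "Lev (J_obj T) 0 = Vtx ` Lev T 0"
  and J_obj_Par2: "Par (J_obj T) 2 v = {Vtx (stem T v)}"
  and J_obj_Par1: "Par (J_obj T) 1 (Vtx x) = {Vtx (Up T 1 x)}"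
  and J_obj_Less1: "(Vtx x, Vtx x') \<in> Less (J_obj T) 1 \<longleftrightarrow> (x, x') \<in> Less T 1"
  by (simp_all add: J_obj_def grow_simps)

lemma J_obj_core: "core (J_obj T) = Vtx ` Lev T 2"
  by (auto simp: core_def J_obj_def grow_simps)

lemma J_obj_Less2:
  assumes "stem T v = stem T w"
  shows "(v, w) \<in> Less (J_obj T) 2 \<longleftrightarrow> v \<in> Lev (J_obj T) 2 \<and> w \<in> Lev (J_obj T) 2 \<and>
    ((stem T v, stem T w) \<in> Less T 1 \<or> (\<exists>y y'. v = Vtx y \<and> w = Vtx y' \<and> (y, y') \<in> Less T 2))"
  using assms by (auto simp: J_obj_def grow_simps)

lemma is_bush_J_obj:
  assumes "is_tree T" "Lev T 1 \<noteq> {}"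
  shows "is_bush (J_obj T)"
  unfolding J_obj_def
proof (rule is_bush_grow[OF assms])
  note To = tree_ordered[OF assms(1)]
  let ?E = "Tas ` (Lev T 1 - Up T 2 ` Lev T 2)"
  show "finite ?E"
    using finite_Lev[OF To] by simp
  show "stem T ` ?E \<subseteq> Lev T 1"
    by auto
  show "Lev T 1 \<subseteq> stem T ` (Vtx ` Lev T 2 \<union> ?E)"
    by (auto simp: image_Un image_image)
  show "(v, v) \<notin> map_prod Vtx Vtx ` Less T 2" for v
    using Less_irrefl[OF To] by auto
  show "(u, w) \<in> map_prod Vtx Vtx ` Less T 2"
    if "(u, v) \<in> map_prod Vtx Vtx ` Less T 2" "(v, w) \<in> map_prod Vtx Vtx ` Less T 2" for u v w
    using that Less_trans[OF To, of _ _ 2] by auto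
  \<comment> \<open>Tassels sit only over childless vertices, so two distinct vertices with the same
    stem are both core.\<close>
  show "v = w \<or> (v, w) \<in> map_prod Vtx Vtx ` Less T 2 \<or> (w, v) \<in> map_prod Vtx Vtx ` Less T 2"
    if "v \<in> Vtx ` Lev T 2 \<union> ?E" "w \<in> Vtx ` Lev T 2 \<union> ?E" "stem T v = stem T w" for v w
    using that Less_linear[OF To, of _ 2] by (fastforce simp: image_iff)
qed

section \<open>The prenet S-tilde and the two legs of its span\<close>

context
  fixes S T :: "'a tree" and f :: "'a level_map"
  assumes arr: "(S, f, T) \<in> Arr tree_category"
begin

lemma arr_trees: "is_tree S" "is_tree T" "Lev S 1 \<noteq> {}" "Lev T 1 \<noteq> {}" and arr_epi:
  "is_epi_map S T f"
  using arr by (auto simp: Arr_Trees Trees_simps)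

lemma tilde_Lev:
  "Lev (tilde S f T) 0 = Vtx ` Lev S 0" "Lev (tilde S f T) 1 = Vtx ` Lev S 1"
  "v \<in> Lev (tilde S f T) 2 \<longleftrightarrow> (case v of Vtx y \<Rightarrow> y \<in> Lev S 2 | Tas x \<Rightarrow> False
    | Extra x z \<Rightarrow> x \<in> Lev S 1 \<and> z \<in> tilde_extra S f T x)"
  by (auto simp: tilde_def grow_simps split: vert.splits)

lemma tilde_core: "core (tilde S f T) = Vtx ` Lev S 2"
  by (auto simp: core_def tilde_def grow_simps)

lemma tilde_Par2: "Par (tilde S f T) 2 v = {Vtx (stem S v)}"
  by (simp add: tilde_def grow_simps)

lemma tilde_Less1: "(Vtx x, Vtx x') \<in> Less (tilde S f T) 1 \<longleftrightarrow> (x, x') \<in> Less S 1"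
  by (simp add: tilde_def grow_simps)

abbreviation (input) image2 :: "'a vert \<Rightarrow> 'a vert" where
  "image2 v \<equiv> case v of Vtx y \<Rightarrow> Vtx (f 2 y) | Extra x z \<Rightarrow> z"

lemma J_map_simps:
  "x \<in> Lev S 1 \<Longrightarrow> J_map S f T 1 (Vtx x) = Vtx (f 1 x)"
  "v \<in> Lev (tilde S f T) 2 \<Longrightarrow> J_map S f T 2 v = image2 v"
  by (auto simp: J_map_def tilde_Lev(2))

lemma stem_tilde: "v \<in> Lev (tilde S f T) 2 \<Longrightarrow> stem S v \<in> Lev S 1"
  using tree_Up2[OF arr_trees(1)] by (auto simp: tilde_Lev split: vert.splits)

lemma image2_tilde:
  assumes "v \<in> Lev (tilde S f T) 2"
  shows "image2 v \<in> Lev (J_obj T) 2" "stem T (image2 v) = f 1 (stem S v)"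
proof -
  have "image2 v \<in> Lev (J_obj T) 2 \<and> stem T (image2 v) = f 1 (stem S v)"
  proof (cases v)
    case (Vtx y)
    then show ?thesis
      using assms is_epi_mapD(1)[OF arr_epi, of y 2] is_epi_mapD(4)[OF arr_epi, of y]
      by (auto simp: tilde_Lev J_obj_Lev2)
  next
    case (Extra x z)
    then show ?thesis
      using assms by (auto simp: tilde_Lev J_obj_Lev2 tilde_extra_def tree_children_def children_def
        J_obj_Par2
          split: if_splits)
  qed (use assms in \<open>simp add: tilde_Lev\<close>)
  then show "image2 v \<in> Lev (J_obj T) 2" "stem T (image2 v) = f 1 (stem S v)"
    by auto
qed

text \<open>This is the purpose of the extra tassels: with them the vertices over \<open>x\<close>
  reach every child of \<open>f 1 x\<close> in \<open>J_obj T\<close>, as condition (b)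
  demands.\<close>

lemma image2_tilde_surj:
  assumes "x \<in> Lev S 1" "z \<in> Lev (J_obj T) 2" "stem T z = f 1 x"
  shows "\<exists>v\<in>Lev (tilde S f T) 2. stem S v = x \<and> image2 v = z"
proof (cases "z \<in> Vtx ` f 2 ` tree_children S x")
  case True
  then obtain y where "y \<in> tree_children S x" "z = Vtx (f 2 y)"
    by auto
  then show ?thesis
    by (intro bexI[of _ "Vtx y"]) (auto simp: tilde_Lev tree_children_def)
next
  case False
  have "z \<in> tilde_extra S f T x"
  proof (cases "x \<in> Up S 2 ` Lev S 2")
    case True
    then obtain y where "y \<in> Lev S 2" "x = Up S 2 y"
      by auto
    \<comment> \<open>A child of \<open>x\<close> maps to a child of \<open>f 1 x\<close>, so
      \<open>J_obj T\<close> has no tassel there and \<open>z\<close> is a core vertex.\<close>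
    then have "f 1 x \<in> Up T 2 ` Lev T 2"
      using is_epi_mapD(1,4)[OF arr_epi] by (metis imageI)
    then obtain w where "z = Vtx w" "w \<in> Lev T 2"
      using assms(2,3) by (auto simp: J_obj_Lev2)
    then show ?thesis
      using True False assms(3) by (auto simp: tilde_extra_def tree_children_def)
  next
    case no: False
    then show ?thesis
      using assms by (simp add: tilde_extra_def children_def J_obj_Par2)
  qed
  then show ?thesis
    using assms(1) by (intro bexI[of _ "Extra x z"]) (auto simp: tilde_Lev)
qed

text \<open>The tassels over \<open>x\<close> are copies of vertices that no child of
  \<open>x\<close> maps to, one copy each. Hence within a fibre only core vertices can be
  identified.\<close>

lemma image2_tilde_eq:
  assumes "v \<in> Lev (tilde S f T) 2" "w \<in> Lev (tilde S f T) 2" "stem S v = stem S w"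
    "image2 v = image2 w"
    "v \<noteq> w"
  shows "\<exists>y y'. v = Vtx y \<and> w = Vtx y'"
proof -
  have *: False if "y \<in> Lev S 2" "Vtx (f 2 y) \<in> tilde_extra S f T (Up S 2 y)" for y
    using that by (auto simp: tilde_extra_def tree_children_def)
  show ?thesis
    using assms * by (cases v; cases w) (auto simp: tilde_Lev)
qed

abbreviation (input) tilde_rel :: "'a vert rel" where
  "tilde_rel \<equiv> {(Vtx y, Vtx y') | y y'. (y, y') \<in> Less S 2} \<union>
     {(Extra x z, Extra x z') | x z z'. (z, z') \<in> Less (J_obj T) 2} \<union>
     {(Vtx y, Extra x z) | x y z. (Vtx (f 2 y), z) \<in> Less (J_obj T) 2} \<union>
     {(Extra x z, Vtx y) | x y z. (z, Vtx (f 2 y)) \<in> Less (J_obj T) 2}"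

text \<open>On a fibre the four clauses amount to one lexicographic comparison: first the images in
  \<open>J_obj T\<close>, then, on a tie, the order of \<open>S\<close>. In this form the order
  axioms follow from those of \<open>J_obj T\<close> and \<open>S\<close>.\<close>

lemma tilde_rel_iff:
  assumes v: "v \<in> Lev (tilde S f T) 2" and w: "w \<in> Lev (tilde S f T) 2" and eq:
    "stem S v = stem S w"
  shows "(v, w) \<in> tilde_rel \<longleftrightarrow> (image2 v, image2 w) \<in> Less (J_obj T) 2 \<or>
    image2 v = image2 w \<and> (\<exists>y y'. v = Vtx y \<and> w = Vtx y' \<and> (y, y') \<in> Less S 2)"
proof -
  note So = tree_ordered[OF arr_trees(1)] and To = tree_ordered[OF arr_trees(2)]
  note Jo = bush_ordered[OF is_bush_J_obj[OF arr_trees(2,4)]]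
  have VV: "(y, y') \<in> Less S 2 \<longleftrightarrow> (Vtx (f 2 y), Vtx (f 2 y')) \<in> Less (J_obj T) 2 \<or>
      f 2 y = f 2 y' \<and> (y, y') \<in> Less S 2"
    if y: "y \<in> Lev S 2" "y' \<in> Lev S 2" "Up S 2 y = Up S 2 y'" for y y'
  proof -
    have eq: "Up T 2 (f 2 y) = Up T 2 (f 2 y')"
      using is_epi_mapD(4)[OF arr_epi] y by simp
    then have J: "(Vtx (f 2 y), Vtx (f 2 y')) \<in> Less (J_obj T) 2 \<longleftrightarrow> (f 2 y, f 2 y') \<in> Less T 2"
      using Less_Lev[OF To] Less_irrefl[OF To] by (auto simp: J_obj_Less2 J_obj_Lev2)
    show ?thesis
      unfolding J using is_epi_mapD(6)[OF arr_epi, of y y'] is_epi_mapD(6)[OF arr_epi, of y' y] y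
        Less_linear[OF So y(1,2)] Less_asym[OF To] Less_irrefl[OF To] by metis
  qed
  show ?thesis
  proof (cases v)
    case (Vtx y)
    then show ?thesis
      using v w eq VV[of y] image2_tilde_eq[OF v w eq] by (cases w) (auto simp: tilde_Lev)
  next
    case (Extra x z)
    then show ?thesis
      using v w eq image2_tilde_eq[OF v w eq] by (cases w) (auto simp: tilde_Lev)
  qed (use v in \<open>simp add: tilde_Lev\<close>)
qed

lemma tilde_Less2:
  assumes "v \<in> Lev (tilde S f T) 2" "w \<in> Lev (tilde S f T) 2" "stem S v = stem S w"
  shows "(v, w) \<in> Less (tilde S f T) 2 \<longleftrightarrow> (image2 v, image2 w) \<in> Less (J_obj T) 2 \<or>
    image2 v = image2 w \<and> (\<exists>y y'. v = Vtx y \<and> w = Vtx y' \<and> (y, y') \<in> Less S 2)"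
proof -
  have "(v, w) \<in> Less (tilde S f T) 2 \<longleftrightarrow> (v, w) \<in> tilde_rel"
    using assms Less_irrefl[OF tree_ordered[OF arr_trees(1)], of "stem S w" 1]
    unfolding tilde_def grow_simps(3,8) by simp
  then show ?thesis
    unfolding tilde_rel_iff[OF assms] .
qed

lemma is_bush_tilde: "is_bush (tilde S f T)"
proof -
  note So = tree_ordered[OF arr_trees(1)]
  note Jo = bush_ordered[OF is_bush_J_obj[OF arr_trees(2,4)]]
  let ?E = "{Extra x z | x z. x \<in> Lev S 1 \<and> z \<in> tilde_extra S f T x}"
  have L: "Vtx ` Lev S 2 \<union> ?E = Lev (tilde S f T) 2"
    by (simp add: tilde_def grow_simps)
  have extra: "tilde_extra S f T x \<subseteq> Lev (J_obj T) 2" for x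
    by (auto simp: tilde_extra_def tree_children_def children_def J_obj_Lev2)
  have "?E \<subseteq> (\<lambda>(x, z). Extra x z) ` (Lev S 1 \<times> Lev (J_obj T) 2)"
    using extra by force
  then have fin: "finite ?E"
    using finite_Lev[OF So] finite_Lev[OF Jo] by (meson finite_SigmaI finite_imageI finite_subset)
  show ?thesis
    unfolding tilde_def
  proof (rule is_bush_grow[OF arr_trees(1,3) fin], unfold L)
    show "stem S ` ?E \<subseteq> Lev S 1"
      by auto
    show "Lev S 1 \<subseteq> stem S ` Lev (tilde S f T) 2"
    proof
      fix x
      assume x: "x \<in> Lev S 1"
      have "Vtx (f 1 x) \<in> Lev (J_obj T) 1"
        using is_epi_mapD(1)[OF arr_epi x] by (simp add: J_obj_Lev1)
      then obtain z where "z \<in> Lev (J_obj T) 2" "stem T z = f 1 x"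
        using bush_child[OF is_bush_J_obj[OF arr_trees(2,4)], of "Vtx (f 1 x)"]
        by (auto simp: J_obj_Par2)
      then show "x \<in> stem S ` Lev (tilde S f T) 2"
        using image2_tilde_surj[OF x] by auto
    qed
    show "(v, v) \<notin> tilde_rel" if "v \<in> Lev (tilde S f T) 2" for v
      unfolding tilde_rel_iff[OF that that HOL.refl] using Less_irrefl[OF Jo] Less_irrefl[OF So] by
        auto
    show "(u, w) \<in> tilde_rel"
      if "u \<in> Lev (tilde S f T) 2" "v \<in> Lev (tilde S f T) 2" "w \<in> Lev (tilde S f T) 2"
        "stem S u = stem S v" "stem S v = stem S w" "(u, v) \<in> tilde_rel" "(v, w) \<in> tilde_rel"
          for u v w
    proof -
      have "stem S u = stem S w"
        using that by simp
      then show ?thesis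
        using that(6,7) Less_trans[OF Jo, of "image2 u" "image2 v" 2
          "image2 w"] Less_trans[OF So, of _ _ 2]
        unfolding tilde_rel_iff[OF that(1,2,4)] tilde_rel_iff[OF that(2,3,5)]
          tilde_rel_iff[OF that(1,3) \<open>stem S u = stem S w\<close>]
        by (elim disjE conjE exE) (simp, simp, metis, auto)
    qed
    show "v = w \<or> (v, w) \<in> tilde_rel \<or> (w, v) \<in> tilde_rel"
      if vw: "v \<in> Lev (tilde S f T) 2" "w \<in> Lev (tilde S f T) 2" "stem S v = stem S w" for v w
    proof (cases "image2 v = image2 w")
      case True
      show ?thesis
      proof (cases "v = w")
        case False
        then obtain y y' where y: "v = Vtx y" "w = Vtx y'"
          using image2_tilde_eq[OF vw True] by blast
        then have "(y, y') \<in> Less S 2 \<or> (y', y) \<in> Less S 2"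
          using vw False Less_linear[OF So, of y 2 y'] by (auto simp: tilde_Lev)
        then show ?thesis
          using y by auto
      qed simp
    next
      case False
      then show ?thesis
        using Less_linear[OF Jo, of "image2 v" 2
          "image2 w"] image2_tilde(1)[OF vw(1)] image2_tilde(1)[OF vw(2)]
        unfolding tilde_rel_iff[OF vw] tilde_rel_iff[OF vw(2,1) vw(3)[symmetric]] by blast
    qed
  qed
qed

lemma J_map_arr: "(tilde S f T, J_map S f T, J_obj T) \<in> Arr PreNet2"
proof (rule bush_arrI[OF is_bush_tilde])
  note Jb = is_bush_J_obj[OF arr_trees(2,4)]
  show "J_obj T \<in> Obj PreNet2"
    using bush_Obj[OF Jb] by simp
  show "J_map S f T \<in> level_maps (tilde S f T) (J_obj T)"
    unfolding level_maps_def
  proof (intro CollectI allI)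
    fix i :: nat
    consider "i = 2" | "i \<noteq> 2"
      by auto
    then show "J_map S f T i \<in> Lev (tilde S f T) i \<rightarrow>\<^sub>E Lev (J_obj T) i"
    proof cases
      case 1
      then show ?thesis
        using image2_tilde(1) by (auto simp: J_map_def)
    next
      case 2
      then have "Lev (tilde S f T) i = Vtx ` Lev S i" "Lev (J_obj T) i = Vtx ` Lev T i"
        by (simp_all add: tilde_def J_obj_def grow_def Let_def)
      then show ?thesis
        using is_epi_mapD(1)[OF arr_epi, of _ i] by (auto simp: J_map_def)
    qed
  qed
  show "J_map S f T 1 a = J_map S f T 1 b \<or>
    (J_map S f T 1 a, J_map S f T 1 b) \<in> less_circ (J_obj T) 1"
    if ab: "(a, b) \<in> Less (tilde S f T) 1" for a b
  proof -
    obtain x x' where x: "a = Vtx x" "b = Vtx x'" "x \<in> Lev S 1" "x' \<in> Lev S 1"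
      using Less_Lev[OF bush_ordered[OF is_bush_tilde] ab] by (auto simp: tilde_Lev)
    then have "(x, x') \<in> Less S 1"
      using ab by (simp add: tilde_Less1)
    moreover have "Up T 1 (f 1 x) = Up T 1 (f 1 x')"
      using x tree_Up1[OF arr_trees(2)] tree_root[OF arr_trees(2)] is_epi_mapD(1)[OF arr_epi, of _
        1] by fastforce
    ultimately show ?thesis
      using is_epi_mapD(5)[OF arr_epi, of x x'] x
      by (auto simp: J_map_simps less_circ_bush[OF Jb] J_obj_Less1 J_obj_Par1)
  qed
  show "J_map S f T 2 c = J_map S f T 2 d \<or>
    (J_map S f T 2 c, J_map S f T 2 d) \<in> less_circ (J_obj T) 2"
    if cd: "(c, d) \<in> Less (tilde S f T) 2" "Par (tilde S f T) 2 c = Par (tilde S f T) 2 d" for c d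
  proof -
    have L: "c \<in> Lev (tilde S f T) 2" "d \<in> Lev (tilde S f T) 2" and eq: "stem S c = stem S d"
      using Less_Lev[OF bush_ordered[OF is_bush_tilde] cd(1)] cd(2) by (auto simp: tilde_Par2)
    have "image2 c = image2 d \<or> (image2 c, image2 d) \<in> Less (J_obj T) 2"
      using cd(1) tilde_Less2[OF L eq] by auto
    then show ?thesis
      using image2_tilde(2)[OF L(1)] image2_tilde(2)[OF L(2)] eq
      by (auto simp: J_map_simps L less_circ_bush[OF Jb] J_obj_Par2)
  qed
  show "Par (J_obj T) 1 x \<noteq> {} \<longleftrightarrow>
    x \<in> J_map S f T 1 ` Lev (tilde S f T) 1" if x: "x \<in> Lev (J_obj T) 1" for x
  proof -
    obtain t where t: "x = Vtx t" "t \<in> Lev T 1"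
      using x by (auto simp: J_obj_Lev1)
    then have "t \<in> f 1 ` Lev S 1"
      using is_epi_mapD(3)[OF arr_epi] by simp
    then show ?thesis
      using t J_map_simps(1) by (auto simp: J_obj_Par1 tilde_Lev image_iff)
  qed
  show "J_map S f T 1 a \<in> Par (J_obj T) 2 x \<longleftrightarrow>
      (\<exists>c\<in>Lev (tilde S f T) 2. a \<in> Par (tilde S f T) 2 c \<and> J_map S f T 2 c = x)"
    if ax: "a \<in> Lev (tilde S f T) 1" "x \<in> Lev (J_obj T) 2" for a x
  proof -
    obtain t where t: "a = Vtx t" "t \<in> Lev S 1"
      using ax(1) by (auto simp: tilde_Lev)
    have "J_map S f T 1 a \<in> Par (J_obj T) 2 x \<longleftrightarrow> stem T x = f 1 t"
      using t by (auto simp: J_map_simps J_obj_Par2)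
    also have "\<dots> \<longleftrightarrow> (\<exists>c\<in>Lev (tilde S f T) 2. stem S c = t \<and> image2 c = x)"
      using image2_tilde_surj[OF t(2) ax(2)] image2_tilde(2) by metis
    also have "\<dots> \<longleftrightarrow> (\<exists>c\<in>Lev (tilde S f T) 2. a \<in> Par (tilde S f T) 2 c \<and> J_map S f T 2 c = x)"
      using t by (auto simp: tilde_Par2 J_map_simps)
    finally show ?thesis .
  qed
  show "J_map S f T 2 c \<in> core (J_obj T)" if "c \<in> core (tilde S f T)" for c
    using that is_epi_mapD(1)[OF arr_epi, of _ 2]
    by (auto simp: tilde_core J_obj_core J_map_simps tilde_Lev)
qed

text \<open>Turns the clauses for vertices with and without children into uniform ones. Monotony
  over a childless vertex holds because its whole fibre collapses to one tassel.\<close>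

lemma retractionD:
  assumes u: "is_retraction S f T u"
  shows "u \<in> level_maps (tilde S f T) (J_obj S)" "v \<in> Lev (tilde S f T) 1 \<Longrightarrow> u 1 v = v"
    "y \<in> Lev S 2 \<Longrightarrow> u 2 (Vtx y) = Vtx y"
    "v \<in> Lev (tilde S f T) 2 \<Longrightarrow> u 2 v \<in> Lev (J_obj S) 2 \<and> stem S (u 2 v) = stem S v"
    "(v, w) \<in> Less (tilde S f T) 2 \<Longrightarrow> stem S v = stem S w \<Longrightarrow>
      u 2 v = u 2 w \<or> (u 2 v, u 2 w) \<in> Less (J_obj S) 2"
proof -
  show 1: "u \<in> level_maps (tilde S f T) (J_obj S)" and "v \<in> Lev (tilde S f T) 1 \<Longrightarrow> u 1 v = v" for v
    using u unfolding is_retraction_def by blast+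
  note U = u[unfolded is_retraction_def, THEN conjunct2, THEN conjunct2]
  note U1 = U[THEN conjunct1, THEN bspec] and U2 = U[THEN conjunct2, THEN bspec, THEN bspec]
  have c1: "u 2 (Extra x z) \<in> Vtx ` tree_children S x"
    if "x \<in> Up S 2 ` Lev S 2" "z \<in> tilde_extra S f T x" for x z
    using U1[OF that(1), THEN conjunct2, THEN conjunct1, THEN bspec, OF that(2)] .
  have c2: "u 2 (Extra x z) = Tas x"
    if "x \<in> Lev S 1" "x \<notin> Up S 2 ` Lev S 2" "z \<in> tilde_extra S f T x" for x z
    using U2[OF DiffI[OF that(1,2)] that(3)] .
  have c3: "u 2 (Vtx y) = Vtx y" if "y \<in> tree_children S x" "x \<in> Up S 2 ` Lev S 2" for y x
    using U1[OF that(2), THEN conjunct1, THEN bspec, OF that(1)] .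
  have c4: "u 2 v = u 2 w \<or> (u 2 v, u 2 w) \<in> Less (J_obj S) 2"
    if "stem S v \<in> Up S 2 ` Lev S 2" "(v, w) \<in> Less (tilde S f T) 2" "stem S w = stem S v" for v w
    using U1[OF that(1), THEN conjunct2, THEN conjunct2, THEN bspec, OF that(2)] that(3) by simp
  show 3: "u 2 (Vtx y) = Vtx y" if "y \<in> Lev S 2" for y
    using c3[of y "Up S 2 y"] that by (auto simp: tree_children_def)
  show 4: "u 2 v \<in> Lev (J_obj S) 2 \<and>
    stem S (u 2 v) = stem S v" if v: "v \<in> Lev (tilde S f T) 2" for v
  proof
    show "u 2 v \<in> Lev (J_obj S) 2"
      using 1 v by (auto simp: level_maps_def)
    show "stem S (u 2 v) = stem S v"
    proof (cases v)
      case (Vtx y)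
      then show ?thesis
        using v 3 by (simp add: tilde_Lev)
    next
      case (Extra x z)
      then have "x \<in> Lev S 1" "z \<in> tilde_extra S f T x"
        using v by (simp_all add: tilde_Lev)
      then show ?thesis
        using Extra c1[of x z] c2[of x z]
        by (cases "x \<in> Up S 2 ` Lev S 2") (auto simp: tree_children_def)
    qed (use v in \<open>simp add: tilde_Lev\<close>)
  qed
  have 5: "u 2 v = Tas (stem S v)" if v: "v \<in> Lev (tilde S f T) 2" "stem S v \<notin> Up S 2 ` Lev S 2"
    for v
    using v c2 by (cases v) (auto simp: tilde_Lev)
  show "u 2 v = u 2 w \<or> (u 2 v, u 2 w) \<in> Less (J_obj S) 2"
    if vw: "(v, w) \<in> Less (tilde S f T) 2" "stem S v = stem S w" for v w
    using c4[OF _ vw(1) vw(2)[symmetric]] 5[of v] 5[of w] Less_Lev[OF bush_ordered[OF is_bush_tilde]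
      vw(1)] vw(2)
    by (cases "stem S v \<in> Up S 2 ` Lev S 2") auto
qed

text \<open>A retraction fixes level 1 and the core and preserves stems, so both conditions on a
  weak equivalence are visible; what takes work is surjectivity on tassels.\<close>

lemma retraction_we:
  assumes u: "is_retraction S f T u"
  shows "(tilde S f T, u, J_obj S) \<in> weak_equivalences"
proof -
  note D = retractionD[OF u]
  note Jb = is_bush_J_obj[OF arr_trees(1,3)]
  have inj: "inj_on (u 2) (Vtx ` Lev S 2)" and im: "u 2 ` Vtx ` Lev S 2 = Vtx ` Lev S 2"
    using D(3) by (auto simp: inj_on_def image_image)
  show ?thesis
  proof (rule bush_weI[OF is_bush_tilde Jb D(1)])
    show "Par (tilde S f T) 2 c = {a \<in> Lev (tilde S f T) 1. u 1 a \<in> Par (J_obj S) 2 (u 2 c)}"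
      if "c \<in> Lev (tilde S f T) 2" for c
      using D(2) D(4)[OF that] stem_tilde[OF that]
      by (auto simp: tilde_Par2 J_obj_Par2 tilde_Lev(2))
    show "u 1 ` Lev (tilde S f T) 1 = Lev (J_obj S) 1"
      using D(2) by (auto simp: tilde_Lev J_obj_Lev1)
    show "u 2 ` Lev (tilde S f T) 2 = Lev (J_obj S) 2"
    proof (intro equalityI subsetI)
      fix z
      assume z: "z \<in> Lev (J_obj S) 2"
      show "z \<in> u 2 ` Lev (tilde S f T) 2"
      proof (cases z)
        case (Vtx y)
        then have "y \<in> Lev S 2"
          using z by (auto simp: J_obj_Lev2)
        then have "Vtx y \<in> Lev (tilde S f T) 2" "z = u 2 (Vtx y)"
          using D(3)[of y] Vtx by (simp_all add: tilde_Lev)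
        then show ?thesis
          by (rule rev_image_eqI)
      next
        case (Tas x)
        then have x: "x \<in> Lev S 1" "x \<notin> Up S 2 ` Lev S 2"
          using z by (auto simp: J_obj_Lev2)
        then have "Vtx x \<in> Lev (tilde S f T) 1"
          by (simp add: tilde_Lev)
        \<comment> \<open>Every fibre of S-tilde is nonempty since S-tilde is pruned, and over a
          childless \<open>x\<close> all of it goes to \<open>Tas x\<close>.\<close>
        then obtain v where v: "v \<in> Lev (tilde S f T) 2" "stem S v = x"
          using bush_child[OF is_bush_tilde, of "Vtx x"] by (auto simp: tilde_Par2)
        have "z = u 2 v"
          using D(4)[OF v(1)] v(2) x Tas by (auto simp: J_obj_Lev2 image_iff)
        with v(1) show ?thesis
          by (rule rev_image_eqI)
      next
        case (Extra x w)
        then show ?thesis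
          using z by (auto simp: J_obj_Lev2)
      qed
    qed (use D(4) in auto)
    show "u 1 a = u 1 b \<or> (u 1 a, u 1 b) \<in> Less (J_obj S) 1" if ab:
      "(a, b) \<in> Less (tilde S f T) 1" for a b
      using Less_Lev[OF bush_ordered[OF is_bush_tilde] ab] D(2) ab
      by (auto simp: tilde_Lev tilde_Less1 J_obj_Less1)
    show "u 2 c = u 2 d \<or> (u 2 c, u 2 d) \<in> Less (J_obj S) 2"
      if "(c, d) \<in> Less (tilde S f T) 2" "Par (tilde S f T) 2 c = Par (tilde S f T) 2 d" for c d
      using D(5)[OF that(1)] that(2) by (simp add: tilde_Par2)
    show "bij_betw (u 2) (core (tilde S f T)) (core (J_obj S))"
      using inj im by (simp add: bij_betw_def tilde_core J_obj_core)
  qed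
qed

text \<open>Over a vertex with children, a retraction is obtained by rounding down in S-tilde to
  core siblings; over any other vertex there is no choice.\<close>

lemma retraction_exists: "\<exists>u. is_retraction S f T u"
proof -
  note So = tree_ordered[OF arr_trees(1)]
  note to = bush_ordered[OF is_bush_tilde]
  define P where "P x \<theta> \<longleftrightarrow> (\<forall>v. \<theta> v \<in> Vtx ` tree_children S x) \<and>
    (\<forall>y. y \<in> tree_children S x \<longrightarrow> \<theta> (Vtx y) = Vtx y) \<and>
    (\<forall>v w. (v, w) \<in> Less (tilde S f T) 2 \<longrightarrow> \<theta> v = \<theta> w \<or> (\<theta> v, \<theta> w) \<in> Less (tilde S f T) 2)" for x \<theta>
  have "\<forall>x\<in>Up S 2 ` Lev S 2. \<exists>\<theta>. P x \<theta>"
  proof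
    fix x
    assume x: "x \<in> Up S 2 ` Lev S 2"
    have "Vtx ` tree_children S x \<subseteq> Lev (tilde S f T) 2" "Vtx ` tree_children S x \<noteq> {}"
      using x by (auto simp: tilde_Lev tree_children_def)
    then obtain \<theta> where "\<And>v. \<theta> v \<in> Vtx ` tree_children S x"
      "\<And>v. v \<in> Vtx ` tree_children S x \<Longrightarrow> \<theta> v = v"
      "\<And>v w. (v, w) \<in> Less (tilde S f T) 2 \<Longrightarrow> \<theta> v = \<theta> w \<or> (\<theta> v, \<theta> w) \<in> Less (tilde S f T) 2"
      by (rule Less_retraction[OF to]) blast
    then show "\<exists>\<theta>. P x \<theta>"
      unfolding P_def by (intro exI[of _ \<theta>]) blast
  qed
  then obtain \<theta> where P: "\<forall>x\<in>Up S 2 ` Lev S 2. P x (\<theta> x)"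
    by (rule bchoice[THEN exE])
  have \<theta>: "\<theta> x v \<in> Vtx ` tree_children S x"
    "y \<in> tree_children S x \<Longrightarrow> \<theta> x (Vtx y) = Vtx y"
    "(v, w) \<in> Less (tilde S f T) 2 \<Longrightarrow> \<theta> x v = \<theta> x w \<or> (\<theta> x v, \<theta> x w) \<in> Less (tilde S f T) 2"
    if "x \<in> Up S 2 ` Lev S 2" for x v w y
    using bspec[OF P that] unfolding P_def by blast+
  define u where "u i = (if i = 2
    then \<lambda>v\<in>Lev (tilde S f T) 2. if stem S v \<in> Up S 2 ` Lev S 2 then \<theta> (stem S v) v else Tas (stem S
      v)
    else restrict id (Lev (tilde S f T) i))" for i :: nat
  have u2: "u 2 v = (if stem S v \<in> Up S 2 ` Lev S 2 then \<theta> (stem S v) v else Tas (stem S v))"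
    if "v \<in> Lev (tilde S f T) 2" for v
    using that by (simp add: u_def)
  have F1: "u i \<in> Lev (tilde S f T) i \<rightarrow>\<^sub>E Lev (J_obj S) i" for i
  proof (cases "i = 2")
    case True
    have "u 2 v \<in> Lev (J_obj S) 2" if "v \<in> Lev (tilde S f T) 2" for v
      using \<theta>(1)[of "stem S v" v] stem_tilde[OF that]
      by (auto simp: u2[OF that] J_obj_Lev2 tree_children_def)
    moreover have "u 2 \<in> extensional (Lev (tilde S f T) 2)"
      by (simp add: u_def)
    ultimately show ?thesis
      using True by (simp add: PiE_def)
  next
    case False
    then show ?thesis
      by (auto simp: u_def tilde_def J_obj_def grow_def Let_def)
  qed
  have F2: "u 2 v = u 2 w \<or> (u 2 v, u 2 w) \<in> Less (J_obj S) 2"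
    if vw: "(v, w) \<in> Less (tilde S f T) 2" and x: "x \<in> Up S 2 ` Lev S 2" "stem S v = x"
      "stem S w = x" for v w x
  proof -
    have L: "v \<in> Lev (tilde S f T) 2" "w \<in> Lev (tilde S f T) 2"
      using Less_Lev[OF to vw] by auto
    have *: "u 2 v = \<theta> x v" "u 2 w = \<theta> x w"
      using u2[OF L(1)] u2[OF L(2)] x by auto
    obtain y y' where y: "\<theta> x v = Vtx y" "\<theta> x w = Vtx y'" "y \<in> tree_children S x"
      "y' \<in> tree_children S x"
      using \<theta>(1)[OF x(1)] by blast
    \<comment> \<open>The rounding is monotone for the order of S-tilde; among core siblings that
      order is the one of \<open>S\<close>, hence of \<open>J_obj S\<close>.\<close>
    have "(Vtx y, Vtx y') \<in> Less (tilde S f T) 2 \<Longrightarrow> (y, y') \<in> Less S 2"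
      using y(3,4) Less_irrefl[OF So] unfolding tilde_def grow_simps(3,8)
      by (auto simp: tree_children_def)
    then show ?thesis
      using \<theta>(3)[OF x(1) vw] y by (auto simp: * J_obj_Less2 J_obj_Lev2 tree_children_def)
  qed
  have F3: "u i v = v" if "i \<in> {0, 1}" "v \<in> Lev (tilde S f T) i" for i v
    using that by (auto simp: u_def)
  have F4: "u 2 (Vtx y) = Vtx y" if "x \<in> Up S 2 ` Lev S 2" "y \<in> tree_children S x" for x y
    using that \<theta>(2)[OF that] u2[of "Vtx y"] by (auto simp: tilde_Lev tree_children_def)
  have F5: "u 2 (Extra x z) \<in> Vtx ` tree_children S x"
    if "x \<in> Up S 2 ` Lev S 2" "z \<in> tilde_extra S f T x" for x z
    using that \<theta>(1)[OF that(1)] u2[of "Extra x z"] tree_Up2[OF arr_trees(1)]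
    by (auto simp: tilde_Lev)
  have F6: "u 2 (Extra x z) = Tas x"
    if "x \<in> Lev S 1 - Up S 2 ` Lev S 2" "z \<in> tilde_extra S f T x" for x z
    using that u2[of "Extra x z"] by (auto simp: tilde_Lev)
  show ?thesis
    unfolding is_retraction_def
  proof (intro exI[of _ u] conjI ballI)
    show "u \<in> level_maps (tilde S f T) (J_obj S)"
      using F1 by (simp add: level_maps_def)
    show "case p of (v, v') \<Rightarrow> stem S v = x \<and> stem S v' = x \<longrightarrow>
        u 2 v = u 2 v' \<or> (u 2 v, u 2 v') \<in> Less (J_obj S) 2"
      if "x \<in> Up S 2 ` Lev S 2" "p \<in> Less (tilde S f T) 2" for x p
      using F2[of "fst p" "snd p" x] that by (simp add: split_beta)
  qed (use F3 F4 F5 F6 in simp_all)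
qed

end

section \<open>Completing cospans\<close>

text \<open>A fibre product must again have its vertices in the type \<open>'v\<close>, so pairs are
  coded as single vertices. This is where infinitude of the type enters.\<close>

lemma inj_pairing:
  includes cardinal_syntax
  assumes "infinite (UNIV :: 'v set)"
  obtains enc :: "'v \<times> 'v \<Rightarrow> 'v" where "inj enc"
proof -
  have "|UNIV \<times> UNIV :: ('v \<times> 'v) set| =o |UNIV :: 'v set|"
    by (rule card_of_Times_same_infinite[OF assms])
  then obtain enc :: "'v \<times> 'v \<Rightarrow> 'v" where "bij_betw enc (UNIV \<times> UNIV) UNIV"
    unfolding card_of_ordIso[symmetric] by blast
  then show ?thesis
    using that[of enc] by (simp add: bij_betw_def)
qed

text \<open>
  A fibre product of two maps of ordered sets does not itself carry an order compatible with both
  projections.  In each class of \<open>\<kappa>\<close> one therefore retains only a monotone staircase: all elements of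
  the class are paired with the pivot \<open>p\<close>, the least one also with everything below the pivot and
  the greatest one also with everything above.
\<close>

lemma staircase:
  fixes S Z :: "('v, 'x) levels_scheme"
  assumes S: "ordered_levels S" and Z: "ordered_levels Z"
    and p: "\<And>c. c \<in> Lev S i \<Longrightarrow> p (\<kappa> c) \<in> M (\<kappa> c) \<and> M (\<kappa> c) \<subseteq> Lev Z i"
  obtains N where "N \<subseteq> {(c, z). c \<in> Lev S i \<and> z \<in> M (\<kappa> c)}"
    "\<And>c. c \<in> Lev S i \<Longrightarrow> (c, p (\<kappa> c)) \<in> N"
    "\<And>c z. c \<in> Lev S i \<Longrightarrow> z \<in> M (\<kappa> c) \<Longrightarrow> \<exists>c'. \<kappa> c' = \<kappa> c \<and> (c', z) \<in> N"
    "\<And>c z c' z'. (c, z) \<in> N \<Longrightarrow> (c', z') \<in> N \<Longrightarrow> (c, c') \<in> Less S i \<Longrightarrow> \<kappa> c = \<kappa> c' \<Longrightarrow>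
      z = z' \<or> (z, z') \<in> Less Z i"
proof
  let ?lo = "\<lambda>c. \<forall>d\<in>Lev S i. \<kappa> d = \<kappa> c \<longrightarrow> (d, c) \<notin> Less S i"
  let ?hi = "\<lambda>c. \<forall>d\<in>Lev S i. \<kappa> d = \<kappa> c \<longrightarrow> (c, d) \<notin> Less S i"
  define N where "N = {(c, z). c \<in> Lev S i \<and> z \<in> M (\<kappa> c) \<and> (z = p (\<kappa> c) \<or>
    (z, p (\<kappa> c)) \<in> Less Z i \<and> ?lo c \<or> (p (\<kappa> c), z) \<in> Less Z i \<and> ?hi c)}"
  show "N \<subseteq> {(c, z). c \<in> Lev S i \<and> z \<in> M (\<kappa> c)}"
    by (auto simp: N_def)
  show "(c, p (\<kappa> c)) \<in> N" if "c \<in> Lev S i" for c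
    using that p by (auto simp: N_def)
  show "\<exists>c'. \<kappa> c' = \<kappa> c \<and> (c', z) \<in> N" if c: "c \<in> Lev S i" and z: "z \<in> M (\<kappa> c)" for c z
  proof -
    let ?K = "{d \<in> Lev S i. \<kappa> d = \<kappa> c}"
    have K: "?K \<subseteq> Lev S i" "?K \<noteq> {}"
      using c by auto
    obtain lo where lo: "lo \<in> ?K" "\<And>x. x \<in> ?K \<Longrightarrow> x = lo \<or> (lo, x) \<in> Less S i"
      using Less_min[OF S K] by blast
    obtain hi where hi: "hi \<in> ?K" "\<And>x. x \<in> ?K \<Longrightarrow> x = hi \<or> (x, hi) \<in> Less S i"
      using Less_max[OF S K] by blast
    have lo': "?lo lo"
      using lo Less_asym[OF S] Less_irrefl[OF S] by (metis (mono_tags, lifting) mem_Collect_eq)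
    have hi': "?hi hi"
      using hi Less_asym[OF S] Less_irrefl[OF S] by (metis (mono_tags, lifting) mem_Collect_eq)
    have zL: "z \<in> Lev Z i" "p (\<kappa> c) \<in> Lev Z i"
      using p[OF c] z by auto
    consider "z = p (\<kappa> c)" | "(z, p (\<kappa> c)) \<in> Less Z i" | "(p (\<kappa> c), z) \<in> Less Z i"
      using Less_linear[OF Z zL] by blast
    then show ?thesis
    proof cases
      case 1
      then show ?thesis
        using c z by (intro exI[of _ c]) (simp add: N_def)
    next
      case 2
      then show ?thesis
        using lo(1) lo' z by (intro exI[of _ lo]) (simp add: N_def)
    next
      case 3
      then show ?thesis
        using hi(1) hi' z by (intro exI[of _ hi]) (simp add: N_def)
    qed
  qed
  show "z = z' \<or> (z, z') \<in> Less Z i"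
    if "(c, z) \<in> N" "(c', z') \<in> N" "(c, c') \<in> Less S i" "\<kappa> c = \<kappa> c'" for c z c' z'
  proof -
    \<comment> \<open>As \<open>c\<close> precedes \<open>c'\<close> in its class, \<open>c\<close>
      is not greatest and \<open>c'\<close> is not least. So \<open>z\<close> is at most the pivot
      and \<open>z'\<close> at least the pivot.\<close>
    have "z = p (\<kappa> c) \<or> (z, p (\<kappa> c)) \<in> Less Z i" "z' = p (\<kappa> c) \<or> (p (\<kappa> c), z') \<in> Less Z i"
      using that by (auto simp: N_def)
    then show ?thesis
      using Less_trans[OF Z, of z "p (\<kappa> c)" i z'] by auto
  qed
qed

text \<open>Lexicographic order in two coordinates on the levels in \<open>I\<close>. The remaining
  levels have at most one vertex and the empty order; level 0 is meant.\<close>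

lemma ordered_levels_lex:
  assumes S: "ordered_levels S" and Z: "ordered_levels Z" and fin: "\<And>i. finite (Lev Q i)"
    and empty: "\<And>i. i > 2 \<Longrightarrow> Lev Q i = {}"
    and L: "\<And>i x. i \<in> I \<Longrightarrow> x \<in> Lev Q i \<Longrightarrow> a x \<in> Lev S i \<and> b x \<in> Lev Z i"
    and inj: "\<And>i x y. i \<in> I \<Longrightarrow> x \<in> Lev Q i \<Longrightarrow> y \<in> Lev Q i \<Longrightarrow> a x = a y \<Longrightarrow> b x = b y \<Longrightarrow> x = y"
    and Less: "\<And>i. Less Q i = {(x, y). i \<in> I \<and> x \<in> Lev Q i \<and> y \<in> Lev Q i \<and>
      ((a x, a y) \<in> Less S i \<or> a x = a y \<and> (b x, b y) \<in> Less Z i)}"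
    and single: "\<And>i x y. i \<notin> I \<Longrightarrow> x \<in> Lev Q i \<Longrightarrow> y \<in> Lev Q i \<Longrightarrow> x = y"
  shows "ordered_levels Q"
  unfolding ordered_levels_def
proof (intro conjI allI impI)
  fix i
  show "Less Q i \<subseteq> Lev Q i \<times> Lev Q i"
    by (auto simp: Less)
  have "trans (Less Q i)"
  proof (rule transI)
    fix x y z
    assume "(x, y) \<in> Less Q i" "(y, z) \<in> Less Q i"
    then show "(x, z) \<in> Less Q i"
      using Less_trans[OF S, of "a x" "a y" i "a z"] Less_trans[OF Z, of "b x" "b y" i "b z"]
      unfolding Less by auto
  qed
  moreover have "irrefl (Less Q i)"
    using Less_irrefl[OF S] Less_irrefl[OF Z] by (auto simp: irrefl_def Less)
  moreover have "x = y \<or> (x, y) \<in> Less Q i \<or> (y, x) \<in> Less Q i"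
    if "x \<in> Lev Q i" "y \<in> Lev Q i" for x y
  proof (cases "i \<in> I")
    case True
    then show ?thesis
      using Less_linear[OF S, of "a x" i "a y"] Less_linear[OF Z, of "b x" i
        "b y"] L[OF True] inj[OF True] that
      unfolding Less by auto
  qed (use single that in blast)
  ultimately show "strict_linear_order_on (Lev Q i) (Less Q i)"
    by (auto simp: strict_linear_order_on_def total_on_def)
qed (use fin empty in auto)

text \<open>The vertices of \<open>Q\<close> are coded pairs selected by \<open>staircase\<close>,
  on levels 1 and 2 separately, and ordered by the coordinate in \<open>P\<close> first. The
  projection to \<open>P\<close> is then monotone by construction; the selection makes the
  projection to \<open>Z\<close> monotone too.\<close>

lemma bush_cospan:
  fixes P X Z :: "'v prenet"
  assumes inf: "infinite (UNIV :: 'v set)" and P: "is_bush P"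
    and g: "(P, g, X) \<in> Arr PreNet2" and w: "(Z, w, X) \<in> weak_equivalences"
  obtains Q \<pi> k where "is_bush Q" "(Q, \<pi>, P) \<in> weak_equivalences" "(Q, k, Z) \<in> Arr PreNet2"
    "\<And>i x. x \<in> Lev Q i \<Longrightarrow> g i (\<pi> i x) = w i (k i x)"
proof -
  note W = weak_equivalencesD[OF w]
  note Po = bush_ordered[OF P] and Zo = arr_ordered(1)[OF W(1)] and Xo = arr_ordered(2)[OF W(1)]
  note gL = arr_Lev[OF g] and wL = arr_Lev[OF W(1)]
  have PP: "is_prenet P" "is_prenet X" "is_prenet Z"
    using g W(1) by (auto simp: Arr_PreNet2)
  obtain rP rX rZ where r: "Lev P 0 = {rP}" "Lev X 0 = {rX}" "Lev Z 0 = {rZ}"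
    using g W(1) by (auto simp: Arr_PreNet2 connected_prenet_def)
  obtain enc :: "'v \<times> 'v \<Rightarrow> 'v" where enc: "inj enc"
    using inj_pairing[OF inf] .
  define a b where "a e = fst (inv enc e)" and "b e = snd (inv enc e)" for e
  have ab [simp]: "a (enc (c, z)) = c" "b (enc (c, z)) = z" for c z
    by (simp_all add: a_def b_def inv_f_f[OF enc])

  have "\<exists>z. z \<in> Lev Z 1 \<and> Par Z 1 z \<noteq> {} \<and> w 1 z = g 1 c" if c: "c \<in> Lev P 1" for c
  proof -
    have "Par X 1 (g 1 c) \<noteq> {}"
      using arr_parented[OF g c] bush_Par1[OF P c] r by simp
    then show ?thesis
      using arr_parented_surj[OF W(1) gL[OF c]] by metis
  qed
  then have ne1: "\<exists>z. z \<in> {z \<in> Lev Z 1. Par Z 1 z \<noteq> {} \<and> w 1 z = g 1 c}" if "c \<in> Lev P 1" for c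
    using that by simp
  have ParP: "Par P 2 c \<subseteq> Lev P 1" if "c \<in> Lev P 2" for c
    using Par_subset[OF PP(1), of 2 c] that by simp
  have gPar: "g 1 x \<in> Par X 2 (g 2 c)" if "c \<in> Lev P 2" "x \<in> Par P 2 c" for c x
    using arr_Par[OF g, of 2 "g 2 c" x] gL[OF that(1)] that ParP[OF that(1)] by auto
  have wPar: "z' \<in> Par Z 2 z \<longleftrightarrow> z' \<in> Lev Z 1 \<and> w 1 z' \<in> Par X 2 (w 2 z)" if "z \<in> Lev Z 2" for z z'
    by (simp add: W(3)[OF that])
  have ne2: "\<exists>z. z \<in> {z \<in> Lev Z 2. w 2 z = g 2 c}" if c: "c \<in> Lev P 2" for c
  proof -
    obtain x where x: "x \<in> Par P 2 c"
      using bush_Par2[OF P c] by auto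
    then obtain z' where z': "z' \<in> Lev Z 1" "w 1 z' = g 1 x"
      using ne1[of x] ParP[OF c] by auto
    then show ?thesis
      using arr_Par[OF W(1), of 2 "g 2 c" z'] gL[OF c] gPar[OF c x] by auto
  qed

  \<comment> \<open>The classes are the fibres of \<open>g 1\<close>. Vertices of \<open>Z\<close>
    without a parent are left out, because a map from a bush reaches exactly the vertices of level 1
    that have one.\<close>
  define \<kappa>1 M1 p1 where "\<kappa>1 = g 1" and "M1 x = {z \<in> Lev Z 1. Par Z 1 z \<noteq> {} \<and> w 1 z = x}"
    and "p1 x = (SOME z. z \<in> M1 x)" for x
  have p1: "p1 (\<kappa>1 c) \<in> M1 (\<kappa>1 c) \<and> M1 (\<kappa>1 c) \<subseteq> Lev Z 1" if "c \<in> Lev P 1" for c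
    using someI_ex[OF ne1[OF that]] by (auto simp: p1_def M1_def \<kappa>1_def)
  obtain N1 where N1: "N1 \<subseteq> {(c, z). c \<in> Lev P 1 \<and> z \<in> M1 (\<kappa>1 c)}"
    "\<And>c. c \<in> Lev P 1 \<Longrightarrow> (c, p1 (\<kappa>1 c)) \<in> N1"
    "\<And>c z. c \<in> Lev P 1 \<Longrightarrow> z \<in> M1 (\<kappa>1 c) \<Longrightarrow> \<exists>c'. \<kappa>1 c' = \<kappa>1 c \<and> (c', z) \<in> N1"
    "\<And>c z c' z'. (c, z) \<in> N1 \<Longrightarrow> (c', z') \<in> N1 \<Longrightarrow> (c, c') \<in> Less P 1 \<Longrightarrow> \<kappa>1 c = \<kappa>1 c' \<Longrightarrow>
      z = z' \<or> (z, z') \<in> Less Z 1"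
    by (rule staircase[where i = 1 and p = p1 and \<kappa> = \<kappa>1 and M = M1, OF Po Zo p1]) blast+

  \<comment> \<open>On level 2 a class also fixes the parent set: every vertex of \<open>Z\<close>
    over \<open>g 2 c\<close> has to occur under each such set, and only siblings have to be mapped
    monotonically. The pivot is a core vertex if possible, so that each core vertex of
    \<open>P\<close> gets a core partner.\<close>
  define \<kappa>2 M2 p2 where "\<kappa>2 c = (Par P 2 c, g 2 c)" and "M2 x = {z \<in> Lev Z 2. w 2 z = snd x}"
    and "p2 x = (if \<exists>z. z \<in> core Z \<and> w 2 z = snd x then SOME z. z \<in> core Z \<and> w 2 z = snd x
      else SOME z. z \<in> M2 x)" for c and x :: "'v set \<times> 'v"
  have p2_core: "p2 x \<in> core Z \<and> w 2 (p2 x) = snd x" if "\<exists>z. z \<in> core Z \<and> w 2 z = snd x" for x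
    using someI_ex[OF that] that by (simp add: p2_def)
  have p2: "p2 (\<kappa>2 c) \<in> M2 (\<kappa>2 c) \<and> M2 (\<kappa>2 c) \<subseteq> Lev Z 2" if "c \<in> Lev P 2" for c
  proof (cases "\<exists>z. z \<in> core Z \<and> w 2 z = snd (\<kappa>2 c)")
    case True
    then show ?thesis
      using p2_core[OF True] by (auto simp: M2_def core_def)
  next
    case False
    have "\<exists>z. z \<in> M2 (\<kappa>2 c)"
      using ne2[OF that] by (simp add: M2_def \<kappa>2_def)
    from someI_ex[OF this] show ?thesis
      using False by (auto simp: p2_def M2_def)
  qed
  obtain N2 where N2: "N2 \<subseteq> {(c, z). c \<in> Lev P 2 \<and> z \<in> M2 (\<kappa>2 c)}"
    "\<And>c. c \<in> Lev P 2 \<Longrightarrow> (c, p2 (\<kappa>2 c)) \<in> N2"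
    "\<And>c z. c \<in> Lev P 2 \<Longrightarrow> z \<in> M2 (\<kappa>2 c) \<Longrightarrow> \<exists>c'. \<kappa>2 c' = \<kappa>2 c \<and> (c', z) \<in> N2"
    "\<And>c z c' z'. (c, z) \<in> N2 \<Longrightarrow> (c', z') \<in> N2 \<Longrightarrow> (c, c') \<in> Less P 2 \<Longrightarrow> \<kappa>2 c = \<kappa>2 c' \<Longrightarrow>
      z = z' \<or> (z, z') \<in> Less Z 2"
    by (rule staircase[where i = 2 and p = p2 and \<kappa> = \<kappa>2 and M = M2, OF Po Zo p2]) blast+

  have N1D: "c \<in> Lev P 1 \<and> z \<in> Lev Z 1 \<and> Par Z 1 z \<noteq> {} \<and> w 1 z = g 1 c" if "(c, z) \<in> N1" for c z
    using N1(1) that by (auto simp: M1_def \<kappa>1_def)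
  have N2D: "c \<in> Lev P 2 \<and> z \<in> Lev Z 2 \<and> w 2 z = g 2 c" if "(c, z) \<in> N2" for c z
    using N2(1) that by (auto simp: M2_def \<kappa>2_def)
  have N1s: "\<exists>c'. (c', z) \<in> N1 \<and> g 1 c' = g 1 c"
    if "c \<in> Lev P 1" "z \<in> Lev Z 1" "Par Z 1 z \<noteq> {}" "w 1 z = g 1 c" for c z
    using N1(3)[of c z] that by (auto simp: M1_def \<kappa>1_def)
  have N2s: "\<exists>c'. (c', z) \<in> N2 \<and> Par P 2 c' = Par P 2 c"
    if "c \<in> Lev P 2" "z \<in> Lev Z 2" "w 2 z = g 2 c" for c z
    using N2(3)[of c z] that by (auto simp: M2_def \<kappa>2_def)

  define LQ where "LQ i = (if i = 0 then {rP} else if i = 1 then enc ` N1 else if i = 2 then enc `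
    N2 else {})"
    for i :: nat
  \<comment> \<open>A pair is core only if both entries are. As \<open>w 2\<close> is injective on
    core vertices, each core vertex of \<open>P\<close> then has just one core pair above it. Parent
    sets are pulled back from \<open>P\<close>.\<close>
  define Q where "Q = \<lparr> Lev = LQ,
    Less = (\<lambda>i. {(x, y). i \<in> {1, 2} \<and> x \<in> LQ i \<and> y \<in> LQ i \<and>
      ((a x, a y) \<in> Less P i \<or> a x = a y \<and> (b x, b y) \<in> Less Z i)}),
    Par = (\<lambda>i x. if i = 1 then {rP} else {y \<in> LQ 1. a y \<in> Par P 2 (a x)}),
    Tassels = {x \<in> LQ 2. \<not> (a x \<in> core P \<and> b x \<in> core Z)} \<rparr>"
  have Q_simps: "Lev Q i = LQ i" "Par Q 1 x = {rP}" "Par Q 2 x = {y \<in> LQ 1. a y \<in> Par P 2 (a x)}"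
    "Less Q i = {(x, y). i \<in> {1, 2} \<and> x \<in> LQ i \<and> y \<in> LQ i \<and>
      ((a x, a y) \<in> Less P i \<or> a x = a y \<and> (b x, b y) \<in> Less Z i)}"
    "Tassels Q = {x \<in> LQ 2. \<not> (a x \<in> core P \<and> b x \<in> core Z)}" for i x
    by (simp_all add: Q_def)
  have LQ: "LQ 0 = {rP}" "LQ 1 = enc ` N1" "LQ 2 = enc ` N2" "i > 2 \<Longrightarrow> LQ i = {}" for i
    by (simp_all add: LQ_def)
  have core_Q: "core Q = {x \<in> LQ 2. a x \<in> core P \<and> b x \<in> core Z}"
    by (auto simp: core_def Q_simps)
  have Q1: "a x \<in> Lev P 1 \<and> b x \<in> Lev Z 1 \<and> Par Z 1 (b x) \<noteq> {} \<and> w 1 (b x) = g 1 (a x)"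
    if "x \<in> LQ 1" for x
    using that N1D by (auto simp: LQ)
  have Q2: "a x \<in> Lev P 2 \<and> b x \<in> Lev Z 2 \<and> w 2 (b x) = g 2 (a x)" if "x \<in> LQ 2" for x
    using that N2D by (auto simp: LQ)
  have "N1 \<subseteq> Lev P 1 \<times> Lev Z 1" "N2 \<subseteq> Lev P 2 \<times> Lev Z 2"
    using N1D N2D by auto
  then have fin: "finite N1" "finite N2"
    using finite_Lev[OF Po] finite_Lev[OF Zo] by (meson finite_SigmaI finite_subset)+
  have Qo: "ordered_levels Q"
  proof (rule ordered_levels_lex[OF Po Zo, of Q "{1, 2}" a b])
    show "finite (Lev Q i)" for i
      using fin by (simp add: Q_simps LQ_def)
    show "a x \<in> Lev P i \<and> b x \<in> Lev Z i" if "i \<in> {1, 2}" "x \<in> Lev Q i" for i x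
      using that Q1 Q2 by (auto simp: Q_simps)
    show "x = y" if "i \<in> {1, 2}" "x \<in> Lev Q i" "y \<in> Lev Q i" "a x = a y" "b x = b y" for i x y
      using that by (auto simp: Q_simps LQ)
    show "x = y" if "i \<notin> {1, 2}" "x \<in> Lev Q i" "y \<in> Lev Q i" for i x y
      using that by (auto simp: Q_simps LQ_def split: if_splits)
  qed (auto simp: Q_simps LQ)

  define \<pi> where "\<pi> i = restrict (if i = 0 then id else a) (LQ i)" for i :: nat
  have \<pi>: "\<pi> 0 rP = rP" "x \<in> LQ 1 \<Longrightarrow> \<pi> 1 x = a x" "x \<in> LQ 2 \<Longrightarrow> \<pi> 2 x = a x" for x
    by (simp_all add: \<pi>_def LQ)
  have lev: "i = 0 \<or> i = 1 \<or> i = 2 \<or> LQ i = {}" for i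
    by (simp add: LQ_def)
  have \<pi>L: "\<pi> \<in> level_maps Q P"
    unfolding level_maps_def
  proof (intro CollectI allI)
    fix i
    have "\<pi> i x \<in> Lev P i" if "x \<in> LQ i" for x
      using lev[of i] that Q1 Q2 r \<pi> by (auto simp: LQ(1))
    then show "\<pi> i \<in> Lev Q i \<rightarrow>\<^sub>E Lev P i"
      by (auto simp: Q_simps \<pi>_def)
  qed
  have core_bij: "bij_betw (\<pi> 2) (core Q) (core P)"
  proof (rule bij_betw_imageI)
    show "inj_on (\<pi> 2) (core Q)"
    proof (rule inj_onI)
      fix x y
      assume xy: "x \<in> core Q" "y \<in> core Q" "\<pi> 2 x = \<pi> 2 y"
      then have L: "x \<in> LQ 2" "y \<in> LQ 2" "b x \<in> core Z" "b y \<in> core Z" and eq: "a x = a y"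
        by (auto simp: core_Q \<pi>)
      then have "w 2 (b x) = w 2 (b y)"
        using Q2 by simp
      then have "b x = b y"
        using bij_betw_imp_inj_on[OF W(2)] L by (simp add: inj_on_eq_iff)
      then show "x = y"
        using eq L by (auto simp: LQ)
    qed
    show "\<pi> 2 ` core Q = core P"
    proof (intro equalityI subsetI)
      fix c
      assume c: "c \<in> core P"
      then have cL: "c \<in> Lev P 2"
        by (simp add: core_def)
      have "g 2 c \<in> w 2 ` core Z"
        using arr_core[OF g c] bij_betw_imp_surj_on[OF W(2)] by simp
      then have "\<exists>z. z \<in> core Z \<and> w 2 z = snd (\<kappa>2 c)"
        by (auto simp: \<kappa>2_def)
      then have "p2 (\<kappa>2 c) \<in> core Z"
        using p2_core by blast
      then have "enc (c, p2 (\<kappa>2 c)) \<in> core Q" "\<pi> 2 (enc (c, p2 (\<kappa>2 c))) = c"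
        using N2(2)[OF cL] c by (simp_all add: core_Q LQ \<pi>)
      then show "c \<in> \<pi> 2 ` core Q"
        by (metis imageI)
    qed (auto simp: core_Q \<pi>)
  qed
  have surj: "\<pi> 1 ` Lev Q 1 = Lev P 1" "\<pi> 2 ` Lev Q 2 = Lev P 2"
  proof -
    have "c \<in> \<pi> 1 ` LQ 1" if "c \<in> Lev P 1" for c
    proof (rule image_eqI)
      show "enc (c, p1 (\<kappa>1 c)) \<in> LQ 1"
        using N1(2)[OF that] by (simp add: LQ)
      then show "c = \<pi> 1 (enc (c, p1 (\<kappa>1 c)))"
        by (simp add: \<pi>)
    qed
    then show "\<pi> 1 ` Lev Q 1 = Lev P 1"
      using Q1 \<pi> by (auto simp: Q_simps)
    have "c \<in> \<pi> 2 ` LQ 2" if "c \<in> Lev P 2" for c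
    proof (rule image_eqI)
      show "enc (c, p2 (\<kappa>2 c)) \<in> LQ 2"
        using N2(2)[OF that] by (simp add: LQ)
      then show "c = \<pi> 2 (enc (c, p2 (\<kappa>2 c)))"
        by (simp add: \<pi>)
    qed
    then show "\<pi> 2 ` Lev Q 2 = Lev P 2"
      using Q2 \<pi> by (auto simp: Q_simps)
  qed
  have Par\<pi>: "Par Q 2 c = {x \<in> Lev Q 1. \<pi> 1 x \<in> Par P 2 (\<pi> 2 c)}" if "c \<in> Lev Q 2" for c
    using that \<pi> by (auto simp: Q_simps)
  have \<pi>1: "\<pi> 1 x = \<pi> 1 y \<or> (\<pi> 1 x, \<pi> 1 y) \<in> Less P 1" if "(x, y) \<in> Less Q 1" for x y
    using that \<pi> by (auto simp: Q_simps)
  have \<pi>2: "\<pi> 2 x = \<pi> 2 y \<or> (\<pi> 2 x, \<pi> 2 y) \<in> Less P 2" if "(x, y) \<in> Less Q 2" for x y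
    using that \<pi> by (auto simp: Q_simps)
  have Qb: "is_bush Q" and Q\<pi>: "(Q, \<pi>, P) \<in> weak_equivalences"
    by (rule bush_pullback[OF P Qo _ _ _ Par\<pi> \<pi>L surj \<pi>1 \<pi>2 core_bij]; auto simp: Q_simps LQ r)+

  define k where "k i = restrict (if i = 0 then (\<lambda>_. rZ) else b) (LQ i)" for i :: nat
  have k: "k 0 rP = rZ" "x \<in> LQ 1 \<Longrightarrow> k 1 x = b x" "x \<in> LQ 2 \<Longrightarrow> k 2 x = b x" for x
    by (simp_all add: k_def LQ)
  \<comment> \<open>Siblings in \<open>Z\<close> are comparable, and \<open>w\<close> preserves
    their order weakly. So if their images are strictly ordered in \<open>X\<close>, the siblings
    are ordered the same way; if the images coincide, the staircase or the second coordinate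
    provides the order.\<close>
  have ord: "z = z' \<or> (z, z') \<in> less_circ Z i"
    if i: "i \<in> {1, 2}" and L: "z \<in> Lev Z i" "z' \<in> Lev Z i"
      and par: "Par Z i z \<inter> Par Z i z' \<noteq> {}"
      and less: "w i z = w i z' \<and> (z = z' \<or> (z, z') \<in> Less Z i) \<or>
        (w i z, w i z') \<in> less_circ X i" for z z' i
  proof -
    have "z = z' \<or> (z, z') \<in> Less Z i"
      using less
    proof
      assume *: "(w i z, w i z') \<in> less_circ X i"
      have "(z', z) \<notin> less_circ Z i"
        using arr_less_circ[OF W(1), of z' z i] less_circ_antisym[OF Xo _ *] by auto
      moreover have "(z', z) \<in> Less Z i \<Longrightarrow> (z', z) \<in> less_circ Z i"
        using i par by (intro less_circ_siblings) auto
      ultimately show ?thesis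
        using Less_linear[OF Zo L] by auto
    qed simp
    then show ?thesis
      using less_circ_siblings[of z z' Z i] i par by auto
  qed
  have "(Q, k, Z) \<in> Arr PreNet2"
  proof (rule bush_arrI[OF Qb])
    show "Z \<in> Obj PreNet2"
      using W(1) by (simp add: Arr_PreNet2)
    show "k \<in> level_maps Q Z"
      unfolding level_maps_def
    proof (intro CollectI allI)
      fix i
      have "k i x \<in> Lev Z i" if "x \<in> LQ i" for x
        using lev[of i] that Q1 Q2 r k by (auto simp: LQ(1))
      then show "k i \<in> Lev Q i \<rightarrow>\<^sub>E Lev Z i"
        by (auto simp: Q_simps k_def)
    qed
    show "k 1 x = k 1 y \<or> (k 1 x, k 1 y) \<in> less_circ Z 1" if xy: "(x, y) \<in> Less Q 1" for x y
    proof -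
      have L: "x \<in> LQ 1" "y \<in> LQ 1"
        and less: "(a x, a y) \<in> Less P 1 \<or> a x = a y \<and> (b x, b y) \<in> Less Z 1"
        using xy by (auto simp: Q_simps)
      have N: "(a x, b x) \<in> N1" "(a y, b y) \<in> N1"
        using L by (auto simp: LQ)
      have "Par Z 1 (b x) = Lev Z 0" "Par Z 1 (b y) = Lev Z 0"
        using arr_root[OF W(1)] Q1[OF L(1)] Q1[OF L(2)] by auto
      then have par: "Par Z 1 (b x) \<inter> Par Z 1 (b y) \<noteq> {}"
        using r by simp
      have "w 1 (b x) = w 1 (b y) \<and> (b x = b y \<or> (b x, b y) \<in> Less Z 1) \<or>
          (w 1 (b x), w 1 (b y)) \<in> less_circ X 1"
        using less
      proof
        assume "(a x, a y) \<in> Less P 1"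
        then have "(a x, a y) \<in> less_circ P 1"
          using Q1 L bush_Par1[OF P] by (simp add: less_circ_bush[OF P])
        then have "g 1 (a x) = g 1 (a y) \<or> (g 1 (a x), g 1 (a y)) \<in> less_circ X 1"
          by (rule arr_less_circ[OF g])
        then show ?thesis
          using N1(4)[OF N \<open>(a x, a y) \<in> Less P 1\<close>] Q1[OF L(1)] Q1[OF L(2)] by (auto simp: \<kappa>1_def)
      qed (use Q1 L in auto)
      then show ?thesis
        using ord[of 1 "b x" "b y"] par Q1[OF L(1)] Q1[OF L(2)] L by (simp add: k)
    qed
    show "k 2 x = k 2 y \<or> (k 2 x, k 2 y) \<in> less_circ Z 2"
      if xy: "(x, y) \<in> Less Q 2" "Par Q 2 x = Par Q 2 y" for x y
    proof -
      have L: "x \<in> LQ 2" "y \<in> LQ 2"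
        and less: "(a x, a y) \<in> Less P 2 \<or> a x = a y \<and> (b x, b y) \<in> Less Z 2"
        using xy by (auto simp: Q_simps)
      have N: "(a x, b x) \<in> N2" "(a y, b y) \<in> N2"
        using L by (auto simp: LQ)
      obtain e where "e \<in> Par Q 2 x"
        using bush_Par2[OF Qb] L by (auto simp: Q_simps(1))
      then have e: "e \<in> LQ 1" "a e \<in> Par P 2 (a x)" "a e \<in> Par P 2 (a y)"
        using xy(2) by (auto simp: Q_simps)
      then have eq: "Par P 2 (a x) = Par P 2 (a y)"
        using bush_Par2_eq[OF P] Q2[OF L(1)] Q2[OF L(2)] by blast
      have "b e \<in> Par Z 2 (b x)" "b e \<in> Par Z 2 (b y)"
        using e Q1[OF e(1)] Q2[OF L(1)] Q2[OF L(2)] gPar wPar by auto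
      then have par: "Par Z 2 (b x) \<inter> Par Z 2 (b y) \<noteq> {}"
        by auto
      have "w 2 (b x) = w 2 (b y) \<and> (b x = b y \<or> (b x, b y) \<in> Less Z 2) \<or>
          (w 2 (b x), w 2 (b y)) \<in> less_circ X 2"
        using less
      proof
        assume "(a x, a y) \<in> Less P 2"
        then have "(a x, a y) \<in> less_circ P 2"
          using eq by (simp add: less_circ_bush[OF P])
        then have "g 2 (a x) = g 2 (a y) \<or> (g 2 (a x), g 2 (a y)) \<in> less_circ X 2"
          by (rule arr_less_circ[OF g])
        then show ?thesis
          using N2(4)[OF N \<open>(a x, a y) \<in> Less P 2\<close>] Q2[OF L(1)] Q2[OF L(2)] eq
          by (auto simp: \<kappa>2_def)
      qed (use Q2 L in auto)
      then show ?thesis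
        using ord[of 2 "b x" "b y"] par Q2[OF L(1)] Q2[OF L(2)] L by (simp add: k)
    qed
    show "Par Z 1 z \<noteq> {} \<longleftrightarrow> z \<in> k 1 ` Lev Q 1" if z: "z \<in> Lev Z 1" for z
    proof
      assume ne: "Par Z 1 z \<noteq> {}"
      then obtain c where c: "c \<in> Lev P 1" "g 1 c = w 1 z"
        using arr_parented_surj[OF g wL[OF z] arr_parented[OF W(1) z ne]] by metis
      then obtain c' where "(c', z) \<in> N1"
        using N1s[of c z] z ne by auto
      then have "enc (c', z) \<in> Lev Q 1" "k 1 (enc (c', z)) = z"
        by (simp_all add: Q_simps LQ k)
      then show "z \<in> k 1 ` Lev Q 1"
        by (metis imageI)
    qed (use Q1 k in \<open>auto simp: Q_simps\<close>)
    \<comment> \<open>Pass from \<open>Z\<close> to \<open>X\<close> along the weak equivalence,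
      then to \<open>P\<close> by condition (b) for \<open>g\<close>. The child found there need not
      be paired with \<open>z\<close>, but the staircase pairs \<open>z\<close> with another child
      having the same parents.\<close>
    show "k 1 x \<in> Par Z 2 z \<longleftrightarrow> (\<exists>c\<in>Lev Q 2. x \<in> Par Q 2 c \<and> k 2 c = z)"
      if x: "x \<in> Lev Q 1" and z: "z \<in> Lev Z 2" for x z
    proof -
      have xL: "x \<in> LQ 1"
        using x by (simp add: Q_simps)
      have "k 1 x \<in> Par Z 2 z \<longleftrightarrow> g 1 (a x) \<in> Par X 2 (w 2 z)"
        using wPar[OF z] Q1[OF xL] k(2)[OF xL] by auto
      also have "\<dots> \<longleftrightarrow> (\<exists>c\<in>Lev P 2. a x \<in> Par P 2 c \<and> g 2 c = w 2 z)"
        using arr_Par[OF g, of 2 "w 2 z" "a x"] wL[OF z] Q1[OF xL] by simp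
      also have "\<dots> \<longleftrightarrow> (\<exists>c\<in>LQ 2. a x \<in> Par P 2 (a c) \<and> b c = z)"
      proof
        assume "\<exists>c\<in>Lev P 2. a x \<in> Par P 2 c \<and> g 2 c = w 2 z"
        then obtain c where c: "c \<in> Lev P 2" "a x \<in> Par P 2 c" "g 2 c = w 2 z"
          by auto
        then obtain c' where "(c', z) \<in> N2" "Par P 2 c' = Par P 2 c"
          using N2s[of c z] z by auto
        then show "\<exists>c\<in>LQ 2. a x \<in> Par P 2 (a c) \<and> b c = z"
          using c(2) by (intro bexI[of _ "enc (c', z)"]) (simp_all add: LQ)
      next
        assume "\<exists>c\<in>LQ 2. a x \<in> Par P 2 (a c) \<and> b c = z"
        then show "\<exists>c\<in>Lev P 2. a x \<in> Par P 2 c \<and> g 2 c = w 2 z"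
          using Q2 by metis
      qed
      also have "\<dots> \<longleftrightarrow> (\<exists>c\<in>Lev Q 2. x \<in> Par Q 2 c \<and> k 2 c = z)"
        using xL k(3) by (auto simp: Q_simps)
      finally show ?thesis .
    qed
    show "k 2 c \<in> core Z" if "c \<in> core Q" for c
      using that by (simp add: core_Q k)
  qed
  moreover have "g i (\<pi> i x) = w i (k i x)" if x: "x \<in> Lev Q i" for i x
  proof -
    consider "i = 0" | "i = 1" | "i = 2"
      using lev[of i] x by (auto simp: Q_simps)
    then show ?thesis
    proof cases
      case 1
      then show ?thesis
        using x gL[of rP 0] wL[of rZ 0] r \<pi> k by (simp add: Q_simps LQ)
    next
      case 2
      then show ?thesis
        using x Q1 \<pi> k by (simp add: Q_simps)
    next
      case 3
      then show ?thesis
        using x Q2 \<pi> k by (simp add: Q_simps)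
    qed
  qed
  ultimately show ?thesis
    using that Qb Q\<pi> by blast
qed

section \<open>Weak equivalences which agree on core vertices\<close>

abbreviation net_equiv :: "'v prenet \<Rightarrow> 'v prenet \<Rightarrow> 'v prenet_arrow step list \<Rightarrow> 'v prenet_arrow step
  list \<Rightarrow> bool" where
  "net_equiv \<equiv> zz_equiv PreNet2 weak_equivalences"

lemma bush_commuting:
  assumes P: "is_bush P" and f: "(P, f, X) \<in> Arr PreNet2" "(X, g, Y) \<in> Arr PreNet2"
    and f': "(P, f', X') \<in> Arr PreNet2" "(X', g', Y) \<in> Arr PreNet2"
    and eq: "\<And>i x. x \<in> Lev P i \<Longrightarrow> g i (f i x) = g' i (f' i x)"
  shows "net_equiv P Y [Fwd (P, f, X), Fwd (X, g, Y)] [Fwd (P, f', X'), Fwd (X', g', Y)]"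
proof -
  have "(\<lambda>i. compose (Lev P i) (g i) (f i)) = (\<lambda>i. compose (Lev P i) (g' i) (f' i))"
    using eq by (auto simp: compose_def fun_eq_iff)
  then show ?thesis
    using PreNet2.zz_equiv_comp[OF f] PreNet2.zz_equiv_comp[OF f'] bush_comp_arr[OF P f]
      bush_comp_arr[OF P f']
    by simp (meson zz_equiv.sym zz_equiv.trans)
qed

section \<open>Weak equivalences between bushes\<close>

context
  fixes P Q :: "'v prenet" and f :: "'v level_map"
  assumes P: "is_bush P" and Q: "is_bush Q" and f: "(P, f, Q) \<in> weak_equivalences"
begin

text \<open>The definition of weak equivalence speaks only of core vertices and parents.
  Surjectivity comes from (b): on level 1 because all vertices of a bush have a parent, on level 2
  by lifting a parent of the given vertex first.\<close>

lemma bush_we_surj: "f 1 ` Lev P 1 = Lev Q 1" "f 2 ` Lev P 2 = Lev Q 2"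
proof -
  note D = weak_equivalencesD[OF f]
  have ne: "Lev Q 0 \<noteq> {}"
    using bush_Obj[OF Q] by (auto simp: connected_prenet_def)
  have 1: "\<exists>a. a \<in> Lev P 1 \<and> f 1 a = y" if "y \<in> Lev Q 1" for y
    using arr_parented_surj[OF D(1) that] bush_Par1[OF Q that] ne by metis
  then show "f 1 ` Lev P 1 = Lev Q 1"
    using arr_Lev[OF D(1)] by force
  have "\<exists>c. c \<in> Lev P 2 \<and> f 2 c = z" if z: "z \<in> Lev Q 2" for z
  proof -
    obtain y where y: "y \<in> Par Q 2 z"
      using bush_Par2[OF Q z] by auto
    then have "y \<in> Lev Q 1"
      using Par_subset[OF bush_Obj(1)[OF Q], of 2 z] z by auto
    then obtain a where "a \<in> Lev P 1" "f 1 a = y"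
      using 1 by blast
    then show ?thesis
      using arr_Par[OF D(1), of 2 z a] y z by auto
  qed
  then show "f 2 ` Lev P 2 = Lev Q 2"
    using arr_Lev[OF D(1)] by force
qed

lemma bush_we_Par_eq:
  assumes "x \<in> Lev P 2" "y \<in> Lev P 2"
  shows "Par P 2 x = Par P 2 y \<longleftrightarrow> Par Q 2 (f 2 x) = Par Q 2 (f 2 y)"
proof
  note D = weak_equivalencesD[OF f]
  show "Par P 2 x = Par P 2 y" if "Par Q 2 (f 2 x) = Par Q 2 (f 2 y)"
    using D(3)[OF assms(1)] D(3)[OF assms(2)] that by simp
  assume eq: "Par P 2 x = Par P 2 y"
  obtain a where "a \<in> Par P 2 x"
    using bush_Par2[OF P assms(1)] by auto
  then have "f 1 a \<in> Par Q 2 (f 2 x)" "f 1 a \<in> Par Q 2 (f 2 y)"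
    using D(3)[OF assms(1)] D(3)[OF assms(2)] eq by auto
  then show "Par Q 2 (f 2 x) = Par Q 2 (f 2 y)"
    using bush_Par2_eq[OF Q] arr_Lev[OF D(1)] assms by blast
qed

lemma bush_we_mono:
  assumes "(x, y) \<in> Less P 2" "Par P 2 x = Par P 2 y"
  shows "f 2 x = f 2 y \<or> (f 2 x, f 2 y) \<in> Less Q 2"
proof -
  have "(x, y) \<in> less_circ P 2"
    using assms by (simp add: less_circ_bush[OF P])
  then show ?thesis
    using arr_less_circ[OF weak_equivalencesD(1)[OF f]] less_circ_subset[OF bush_ordered[OF Q]] by
      blast
qed

lemma bush_we_mono1:
  assumes "(x, y) \<in> Less P 1"
  shows "f 1 x = f 1 y \<or> (f 1 x, f 1 y) \<in> Less Q 1"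
proof -
  have "(x, y) \<in> less_circ P 1"
    using assms bush_Par1[OF P] Less_Lev[OF bush_ordered[OF P] assms]
    by (simp add: less_circ_bush[OF P])
  then show ?thesis
    using arr_less_circ[OF weak_equivalencesD(1)[OF f]] less_circ_subset[OF bush_ordered[OF Q]] by
      blast
qed

end

text \<open>Put differently, a tassel shares its parent set with no other vertex. Hence a tassel of
  \<open>P\<close> that two maps send to different siblings in \<open>Q\<close> must go to core
  vertices both times.\<close>

definition is_lean :: "'v prenet \<Rightarrow> bool" where
  "is_lean Q \<longleftrightarrow> (\<forall>x\<in>Lev Q 2. \<forall>y\<in>Lev Q 2. Par Q 2 x = Par Q 2 y \<longrightarrow> x \<noteq> y \<longrightarrow> x \<in> core Q)"

definition same_core :: "'v prenet \<Rightarrow> 'v level_map \<Rightarrow> 'v level_map \<Rightarrow> bool" where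
  "same_core P s r \<longleftrightarrow> (\<forall>i. i \<noteq> 2 \<longrightarrow> s i = r i) \<and> (\<forall>x\<in>core P. s 2 x = r 2 x)"

context
  fixes P Q :: "'v prenet" and s r :: "'v level_map"
  assumes inf: "infinite (UNIV :: 'v set)"
    and P: "is_bush P" and Q: "is_bush Q" and lean: "is_lean Q"
    and s: "(P, s, Q) \<in> weak_equivalences" and r: "(P, r, Q) \<in> weak_equivalences"
    and same: "same_core P s r"
begin

lemma same_core_Par:
  assumes "x \<in> Lev P 2"
  shows "Par Q 2 (s 2 x) = Par Q 2 (r 2 x)"
proof -
  note S = weak_equivalencesD[OF s] and R = weak_equivalencesD[OF r]
  obtain a where a: "a \<in> Par P 2 x"
    using bush_Par2[OF P assms] by auto
  have "s 1 = r 1"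
    using same by (simp add: same_core_def)
  then have "s 1 a \<in> Par Q 2 (s 2 x)" "s 1 a \<in> Par Q 2 (r 2 x)"
    using a S(3)[OF assms] R(3)[OF assms] by auto
  then show ?thesis
    using bush_Par2_eq[OF Q] arr_Lev[OF S(1) assms] arr_Lev[OF R(1) assms] by blast
qed

text \<open>The two values at \<tau> are distinct with equal parent sets, so leanness makes both
  core. Their core lifts \<open>c\<close> and \<open>d\<close> are siblings of \<tau> on which
  \<open>s\<close> and \<open>r\<close> agree; they will enclose \<tau> from both sides.\<close>

lemma differ_core:
  assumes "\<tau> \<in> Lev P 2" "s 2 \<tau> \<noteq> r 2 \<tau>"
  obtains c d where "c \<in> core P" "s 2 c = s 2 \<tau>" "r 2 c = s 2 \<tau>" "Par P 2 c = Par P 2 \<tau>"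
    "d \<in> core P" "s 2 d = r 2 \<tau>" "r 2 d = r 2 \<tau>" "Par P 2 d = Par P 2 \<tau>"
proof -
  note S = weak_equivalencesD[OF s] and R = weak_equivalencesD[OF r]
  have "s 2 \<tau> \<in> core Q" "r 2 \<tau> \<in> core Q"
    using lean same_core_Par[OF assms(1)] arr_Lev[OF S(1) assms(1)] arr_Lev[OF R(1) assms(1)]
      assms(2)
    unfolding is_lean_def by metis+
  then obtain c d where c: "c \<in> core P" "s 2 c = s 2 \<tau>" and d: "d \<in> core P" "r 2 d = r 2 \<tau>"
    using S(2) R(2) unfolding bij_betw_def by (metis imageE)
  moreover have "r 2 c = s 2 \<tau>" "s 2 d = r 2 \<tau>"
    using c d same by (simp_all add: same_core_def)
  moreover have "Par P 2 c = Par P 2 \<tau>" "Par P 2 d = Par P 2 \<tau>"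
    using bush_we_Par_eq[OF P Q s, of c \<tau>] bush_we_Par_eq[OF P Q r, of d \<tau>] c d assms(1)
    by (auto simp: core_def)
  ultimately show ?thesis
    using that by blast
qed

text \<open>
  To move a single tassel \<open>\<tau>\<close> to the next core vertex, duplicate it: the three maps from the
  result \<open>P'\<close> to \<open>P\<close> which merge the two copies, respectively shift the first copy down or the second
  copy up, become equal after composition with \<open>s\<close> or \<open>r\<close>.
\<close>

lemma net_equiv_move:
  assumes \<tau>: "\<tau> \<in> Lev P 2" "(s 2 \<tau>, r 2 \<tau>) \<in> Less Q 2"
    and eq: "\<And>x. x \<in> Lev P 2 \<Longrightarrow> x \<noteq> \<tau> \<Longrightarrow> s 2 x = r 2 x"
  shows "net_equiv P Q [Fwd (P, s, Q)] [Fwd (P, r, Q)]"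
proof -
  note S = weak_equivalencesD[OF s] and R = weak_equivalencesD[OF r]
  note Po = bush_ordered[OF P] and Qo = bush_ordered[OF Q]
  have ne: "s 2 \<tau> \<noteq> r 2 \<tau>"
    using \<tau>(2) Less_irrefl[OF Qo] by auto
  obtain c d where c: "c \<in> core P" "s 2 c = s 2 \<tau>" "r 2 c = s 2 \<tau>" "Par P 2 c = Par P 2 \<tau>"
    and d: "d \<in> core P" "s 2 d = r 2 \<tau>" "r 2 d = r 2 \<tau>" "Par P 2 d = Par P 2 \<tau>"
    using differ_core[OF \<tau>(1) ne] .
  have cd: "c \<in> Lev P 2" "d \<in> Lev P 2" "c \<noteq> \<tau>" "d \<noteq> \<tau>"
    using c d ne by (auto simp: core_def)
  \<comment> \<open>Monotony of \<open>r\<close> decides this, since \<open>r 2 c\<close> is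
    \<open>s 2 \<tau>\<close>, strictly below \<open>r 2 \<tau>\<close>. For \<open>d\<close> the
    map \<open>s\<close> is used in the same way.\<close>
  have c\<tau>: "(c, \<tau>) \<in> Less P 2"
    using bush_we_mono[OF P Q r, of \<tau> c] Less_linear[OF Po cd(1) \<tau>(1)] cd(3) c(3,4) \<tau>(2)
      Less_asym[OF Qo] ne
    by auto
  have \<tau>d: "(\<tau>, d) \<in> Less P 2"
    using bush_we_mono[OF P Q s, of d \<tau>] Less_linear[OF Po cd(2) \<tau>(1)] cd(4) d(2,4) \<tau>(2)
      Less_asym[OF Qo] ne
    by auto
  \<comment> \<open>\<open>lo\<close> and \<open>hi\<close> will be the nearest siblings of \<tau>
    below and above. As \<open>lo\<close> lies between \<open>c\<close> and \<tau>, \<open>s\<close>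
    takes the same value on it as on \<tau>; as \<open>hi\<close> lies between \<tau> and
    \<open>d\<close>, so does \<open>r\<close>.\<close>
  let ?lo = "{x \<in> Lev P 2. Par P 2 x = Par P 2 \<tau> \<and> (x, \<tau>) \<in> Less P 2}"
  let ?hi = "{x \<in> Lev P 2. Par P 2 x = Par P 2 \<tau> \<and> (\<tau>, x) \<in> Less P 2}"
  obtain lo where lo: "lo \<in> ?lo" "\<And>x. x \<in> ?lo \<Longrightarrow> x = lo \<or> (x, lo) \<in> Less P 2"
    by (rule Less_max[OF Po, of ?lo]) (use c\<tau> c cd in auto)
  obtain hi where hi: "hi \<in> ?hi" "\<And>x. x \<in> ?hi \<Longrightarrow> x = hi \<or> (hi, x) \<in> Less P 2"
    by (rule Less_min[OF Po, of ?hi]) (use \<tau>d d cd in auto)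
  have ne2: "lo \<noteq> \<tau>" "hi \<noteq> \<tau>"
    using lo hi Less_irrefl[OF Po] by auto
  have slo: "s 2 lo = s 2 \<tau>"
    using bush_we_mono[OF P Q s, of lo \<tau>] bush_we_mono[OF P Q s, of c lo] lo(1) lo(2)[of c] c c\<tau> cd
      Less_asym[OF Qo] by auto
  have rhi: "r 2 hi = r 2 \<tau>"
    using bush_we_mono[OF P Q r, of \<tau> hi] bush_we_mono[OF P Q r, of hi d] hi(1) hi(2)[of d] d \<tau>d cd
      Less_asym[OF Qo] by auto
  have rlo: "r 2 lo = s 2 \<tau>" and shi: "s 2 hi = r 2 \<tau>"
    using eq[of lo] eq[of hi] slo rhi lo(1) hi(1) ne2 by auto

  obtain \<tau>' where \<tau>': "\<tau>' \<notin> Lev P 2"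
    using ex_new_if_finite[OF inf finite_Lev[OF Po]] by blast
  define \<alpha> where "\<alpha> x = (if x = \<tau>' then \<tau> else x)" for x
  define L where "L i = (if i = 2 then insert \<tau>' (Lev P 2) else Lev P i)" for i :: nat
  \<comment> \<open>The copy \<open>\<tau>'\<close> is a tassel with the parents of \<tau>, placed
    immediately after it; \<alpha> merges the two.\<close>
  define P' where "P' = \<lparr>Lev = L,
    Less = (\<lambda>i. if i = 2 then {(x, y). x \<in> L 2 \<and> y \<in> L 2 \<and> ((\<alpha> x, \<alpha> y) \<in> Less P 2 \<or> x = \<tau> \<and> y = \<tau>')}
      else Less P i),
    Par = (\<lambda>i x. if i = 2 then Par P 2 (\<alpha> x) else Par P i x), Tassels = insert \<tau>' (Tassels P)\<rparr>"
  have P'_simps: "Lev P' i = L i" "i \<noteq> 2 \<Longrightarrow> Less P' i = Less P i"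
    "Less P' 2 = {(x, y). x \<in> L 2 \<and> y \<in> L 2 \<and> ((\<alpha> x, \<alpha> y) \<in> Less P 2 \<or> x = \<tau> \<and> y = \<tau>')}"
    "Par P' 1 x = Par P 1 x" "Par P' 2 x = Par P 2 (\<alpha> x)" "Tassels P' = insert \<tau>' (Tassels P)"
      for i x
    by (simp_all add: P'_def)
  have L: "L 2 = insert \<tau>' (Lev P 2)" "i \<noteq> 2 \<Longrightarrow> L i = Lev P i" for i
    by (simp_all add: L_def)
  have \<alpha>: "\<alpha> \<tau>' = \<tau>" "x \<in> Lev P 2 \<Longrightarrow> \<alpha> x = x" "x \<in> L 2 \<Longrightarrow> \<alpha> x \<in> Lev P 2" for x
    using \<tau>' \<tau>(1) by (auto simp: \<alpha>_def L)
  have TP: "Tassels P \<subseteq> Lev P 2"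
    using bush_Obj[OF P] by (simp add: is_prenet_def)
  have core': "core P' = core P"
    using \<tau>' by (auto simp: core_def P'_simps L)
  have P'o: "ordered_levels P'"
    unfolding ordered_levels_def
  proof (intro conjI allI impI)
    fix i
    show "finite (Lev P' i)" "Less P' i \<subseteq> Lev P' i \<times> Lev P' i"
      using finite_Lev[OF Po] Less_Lev[OF Po] by (cases "i = 2"; auto simp: P'_simps L)+
    show "strict_linear_order_on (Lev P' i) (Less P' i)"
    proof (cases "i = 2")
      case False
      then show ?thesis
        using Po by (simp add: ordered_levels_def P'_simps L)
    next
      case True
      have "(x, z) \<in> Less P' 2" if "(x, y) \<in> Less P' 2" "(y, z) \<in> Less P' 2" for x y z
        using that Less_trans[OF Po, of "\<alpha> x" "\<alpha> y" 2 "\<alpha> z"] \<tau>' \<tau>(1) unfolding P'_simps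
        by (auto simp: \<alpha>_def L split: if_splits)
      moreover have "(x, x) \<notin> Less P' 2" for x
        using Less_irrefl[OF Po] \<tau>' \<tau>(1) by (auto simp: P'_simps)
      moreover have "x = y \<or> (x, y) \<in> Less P' 2 \<or> (y, x) \<in> Less P' 2" if "x \<in> L 2" "y \<in> L 2" for x y
        using Less_linear[OF Po \<alpha>(3) \<alpha>(3), OF that] that \<tau>' unfolding P'_simps
        by (auto simp: \<alpha>_def L)
      ultimately show ?thesis
        unfolding True P'_simps(1) strict_linear_order_on_def total_on_def irrefl_def
        by (meson transI)
    qed
  next
    fix i :: nat
    assume "i > 2"
    then show "Lev P' i = {}"
      using Lev_empty[OF Po] by (simp add: P'_simps L)
  qed

  define lift where "lift \<delta> i = restrict (if i = 2 then \<delta> else id) (L i)"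
    for \<delta> :: "'v \<Rightarrow> 'v" and i :: nat
  have lift: "x \<in> L 2 \<Longrightarrow> lift \<delta> 2 x = \<delta> x" "i \<noteq> 2 \<Longrightarrow> x \<in> L i \<Longrightarrow> lift \<delta> i x = x" for \<delta> i x
    by (simp_all add: lift_def)
  have liftL: "lift \<delta> \<in> level_maps P' P" if "\<And>x. x \<in> L 2 \<Longrightarrow> \<delta> x \<in> Lev P 2" for \<delta>
    using that by (auto simp: level_maps_def lift_def P'_simps L split: if_splits)
  have lift_core: "bij_betw (lift \<delta> 2) (core P') (core P)" if "\<And>x. x \<in> core P \<Longrightarrow> \<delta> x = x" for \<delta>
  proof -
    have "lift \<delta> 2 x = id x" if "x \<in> core P" for x
      using that \<open>\<And>x. x \<in> core P \<Longrightarrow> \<delta> x = x\<close> by (simp add: lift core_def L)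
    then show ?thesis
      unfolding core' using bij_betw_cong[of "core P" "lift \<delta> 2" id "core P"] by simp
  qed
  have lift1: "lift \<delta> 1 ` Lev P' 1 = Lev P 1" for \<delta>
    using lift(2)[of 1 _ \<delta>] by (simp add: P'_simps L)
  have "Lev P' 0 = Lev P 0" "Tassels P' \<subseteq> Lev P' 2" "\<And>a. a \<in> Lev P' 1 \<Longrightarrow> Par P' 1 a = Lev P' 0"
    using TP bush_Par1[OF P] by (auto simp: P'_simps L)
  moreover have "Par P' 2 x = {a \<in> Lev P' 1. lift \<alpha> 1 a \<in> Par P 2 (lift \<alpha> 2 x)}"
    if "x \<in> Lev P' 2" for x
    using that lift Par_subset[OF bush_Obj(1)[OF P], of 2 "\<alpha> x"] \<alpha>(3)[of x]
    by (auto simp: P'_simps(1,5) L(2))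
  moreover have "lift \<alpha> \<in> level_maps P' P"
    using liftL \<alpha>(3) by blast
  moreover note lift1[of \<alpha>]
  moreover have "lift \<alpha> 2 ` Lev P' 2 = Lev P 2"
    using lift(1)[of _ \<alpha>] \<alpha> by (force simp: P'_simps L)
  moreover have "lift \<alpha> 1 a = lift \<alpha> 1 b \<or> (lift \<alpha> 1 a, lift \<alpha> 1 b) \<in> Less P 1"
    if "(a, b) \<in> Less P' 1" for a b
    using that Less_Lev[OF Po, of a b 1] by (simp add: P'_simps lift L)
  moreover have "lift \<alpha> 2 a = lift \<alpha> 2 b \<or> (lift \<alpha> 2 a, lift \<alpha> 2 b) \<in> Less P 2"
    if "(a, b) \<in> Less P' 2" for a b
    using that \<alpha>(1) \<alpha>(2)[OF \<tau>(1)] by (auto simp: P'_simps lift)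
  moreover have "bij_betw (lift \<alpha> 2) (core P') (core P)"
    by (rule lift_core) (simp add: \<alpha> core_def)
  ultimately have \<alpha>w: "is_bush P'" "(P', lift \<alpha>, P) \<in> weak_equivalences"
    by - (rule bush_pullback[OF P P'o]; assumption)+
  have we: "(P', lift \<delta>, P) \<in> weak_equivalences"
    if \<delta>L: "\<And>x. x \<in> L 2 \<Longrightarrow> \<delta> x \<in> Lev P 2 \<and> Par P 2 (\<delta> x) = Par P 2 (\<alpha> x)"
      and surj: "Lev P 2 \<subseteq> \<delta> ` L 2" and core: "\<And>x. x \<in> core P \<Longrightarrow> \<delta> x = x"
      and mono: "\<And>x y. x \<in> L 2 \<Longrightarrow> y \<in> L 2 \<Longrightarrow> (\<alpha> x, \<alpha> y) \<in> Less P 2 \<or> x = \<tau> \<and> y = \<tau>' \<Longrightarrow>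
        Par P 2 (\<alpha> x) = Par P 2 (\<alpha> y) \<Longrightarrow> \<delta> x = \<delta> y \<or> (\<delta> x, \<delta> y) \<in> Less P 2" for \<delta>
  proof (rule bush_weI[OF \<alpha>w(1) P])
    show "lift \<delta> 1 ` Lev P' 1 = Lev P 1"
      by (rule lift1)
    show "lift \<delta> \<in> level_maps P' P"
      using liftL \<delta>L by blast
    show "Par P' 2 x = {a \<in> Lev P' 1. lift \<delta> 1 a \<in> Par P 2 (lift \<delta> 2 x)}" if "x \<in> Lev P' 2" for x
      using that lift Par_subset[OF bush_Obj(1)[OF P], of 2 "\<alpha> x"] \<alpha>(3)[of x] \<delta>L[of x]
      by (auto simp: P'_simps(1,5) L(2))
    show "lift \<delta> 2 ` Lev P' 2 = Lev P 2"
      using surj \<delta>L by (auto simp: P'_simps lift)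
    show "lift \<delta> 1 a = lift \<delta> 1 b \<or> (lift \<delta> 1 a, lift \<delta> 1 b) \<in> Less P 1"
      if "(a, b) \<in> Less P' 1" for a b
      using that Less_Lev[OF Po, of a b 1] by (simp add: P'_simps lift L)
    show "lift \<delta> 2 a = lift \<delta> 2 b \<or> (lift \<delta> 2 a, lift \<delta> 2 b) \<in> Less P 2"
      if "(a, b) \<in> Less P' 2" "Par P' 2 a = Par P' 2 b" for a b
      using that mono[of a b] by (auto simp: P'_simps lift)
    show "bij_betw (lift \<delta> 2) (core P') (core P)"
      by (rule lift_core[OF core])
  qed
  have \<tau>_core: "\<tau> \<notin> core P"
    using same ne by (auto simp: same_core_def)

  \<comment> \<open>Both copies move one place down: \<tau> to \<open>lo\<close> and
    \<open>\<tau>'\<close> to \<tau>. The second copy keeps the map onto, and \<open>lo\<close>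
    being adjacent to \<tau> keeps it monotone.\<close>
  define \<beta> where "\<beta> x = (if x = \<tau> then lo else \<alpha> x)" for x
  have \<beta>w: "(P', lift \<beta>, P) \<in> weak_equivalences"
  proof (rule we)
    show "\<beta> x \<in> Lev P 2 \<and> Par P 2 (\<beta> x) = Par P 2 (\<alpha> x)" if "x \<in> L 2" for x
      using \<alpha>(3)[OF that] \<alpha>(2)[OF \<tau>(1)] lo(1) by (auto simp: \<beta>_def)
    show "Lev P 2 \<subseteq> \<beta> ` L 2"
    proof
      fix x
      assume "x \<in> Lev P 2"
      then show "x \<in> \<beta> ` L 2"
        using \<tau>' \<tau>(1) by (intro image_eqI[of _ _
          "if x = \<tau> then \<tau>' else x"]) (auto simp: \<beta>_def \<alpha>_def L)
    qed
    show "\<beta> x = x" if "x \<in> core P" for x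
      using that \<tau>_core \<alpha>(2)[of x] by (auto simp: \<beta>_def core_def)
    show "\<beta> x = \<beta> y \<or> (\<beta> x, \<beta> y) \<in> Less P 2"
      if xy: "x \<in> L 2" "y \<in> L 2" "(\<alpha> x, \<alpha> y) \<in> Less P 2 \<or> x = \<tau> \<and> y = \<tau>'"
        "Par P 2 (\<alpha> x) = Par P 2 (\<alpha> y)" for x y
    proof (cases "x = \<tau>")
      case True
      then have "y = \<tau>' \<or> (\<tau>, y) \<in> Less P 2" "y \<noteq> \<tau>"
        using xy \<alpha>(2)[OF \<tau>(1)] \<tau>' \<tau>(1) Less_irrefl[OF Po] by (auto simp: \<alpha>_def split: if_splits)
      then show ?thesis
        using True lo(1) Less_trans[OF Po, of lo \<tau> 2 y] by (auto simp: \<beta>_def \<alpha>_def)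
    next
      case False
      then have "(\<alpha> x, \<alpha> y) \<in> Less P 2"
        using xy by auto
      then show ?thesis
        using False lo(2)[of "\<alpha> x"] xy(4) \<alpha>(3)[OF xy(1)] \<alpha>(2)[OF \<tau>(1)] by (auto simp: \<beta>_def)
    qed
  qed
  \<comment> \<open>Here the first copy stays and the second moves up to \<open>hi\<close>.\<close>
  define \<gamma> where "\<gamma> x = (if x = \<tau>' then hi else x)" for x
  have \<gamma>w: "(P', lift \<gamma>, P) \<in> weak_equivalences"
  proof (rule we)
    show "\<gamma> x \<in> Lev P 2 \<and> Par P 2 (\<gamma> x) = Par P 2 (\<alpha> x)" if "x \<in> L 2" for x
      using that hi(1) by (auto simp: \<gamma>_def \<alpha>_def L)
    show "Lev P 2 \<subseteq> \<gamma> ` L 2"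
    proof
      fix x
      assume "x \<in> Lev P 2"
      then show "x \<in> \<gamma> ` L 2"
        using \<tau>' by (intro image_eqI[of _ _ x]) (auto simp: \<gamma>_def L)
    qed
    show "\<gamma> x = x" if "x \<in> core P" for x
      using that \<tau>' by (auto simp: \<gamma>_def core_def)
    show "\<gamma> x = \<gamma> y \<or> (\<gamma> x, \<gamma> y) \<in> Less P 2"
      if xy: "x \<in> L 2" "y \<in> L 2" "(\<alpha> x, \<alpha> y) \<in> Less P 2 \<or> x = \<tau> \<and> y = \<tau>'"
        "Par P 2 (\<alpha> x) = Par P 2 (\<alpha> y)" for x y
    proof (cases "y = \<tau>'")
      case True
      then have "x = \<tau> \<or> (x, \<tau>) \<in> Less P 2" "x \<noteq> \<tau>'"
        using xy \<tau>' \<tau>(1) Less_irrefl[OF Po] by (auto simp: \<alpha>_def split: if_splits)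
      then show ?thesis
        using True hi(1) Less_trans[OF Po, of x \<tau> 2 hi] by (auto simp: \<gamma>_def)
    next
      case False
      then have *: "(\<alpha> x, y) \<in> Less P 2" "y \<in> Lev P 2"
        using xy by (auto simp: \<alpha>_def L)
      show ?thesis
        using False * hi(2)[of y] xy(4) by (auto simp: \<gamma>_def \<alpha>_def split: if_splits)
    qed
  qed

  note arrows = weak_equivalencesD(1)[OF \<alpha>w(2)] weak_equivalencesD(1)[OF \<beta>w]
    weak_equivalencesD(1)[OF \<gamma>w]
  have lev: "s i (lift \<delta> i x) = r i (lift \<delta>' i x)" "s i (lift \<delta> i x) = s i (lift \<delta>' i x)"
    "r i (lift \<delta> i x) = r i (lift \<delta>' i x)" if "i \<noteq> 2" "x \<in> L i" for i x \<delta> \<delta>'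
    using that same by (simp_all add: lift same_core_def)
  \<comment> \<open>Cancelling \<open>s\<close> in the first identity identifies \<alpha> with
    \<beta> in the localization, and cancelling \<open>r\<close> in the second identifies \<alpha>
    with \<gamma>. Then \<open>s\<close> after \<alpha> is \<open>s\<close> after \<gamma>, by the
    third identity \<open>r\<close> after \<beta>, hence \<open>r\<close> after \<alpha>; finally
    \<alpha> is cancelled.\<close>
  have "s 2 (\<alpha> x) = s 2 (\<beta> x)" "r 2 (\<alpha> x) = r 2 (\<gamma> x)" "s 2 (\<gamma> x) = r 2 (\<beta> x)" if "x \<in> L 2" for x
    using that \<tau>' \<tau>(1) slo rhi rlo shi eq[of x] by (auto simp: \<alpha>_def \<beta>_def \<gamma>_def L)
  then have *: "s i (lift \<alpha> i x) = s i (lift \<beta> i x)" "r i (lift \<alpha> i x) = r i (lift \<gamma> i x)"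
    "s i (lift \<gamma> i x) = r i (lift \<beta> i x)" if "x \<in> Lev P' i" for i x
    using that lev lift(1) by (cases "i = 2"; simp add: P'_simps(1))+
  let ?a = "(P', lift \<alpha>, P)" and ?b = "(P', lift \<beta>, P)" and ?c = "(P', lift \<gamma>, P)"
  have zz: "zigzag PreNet2 weak_equivalences P' [Fwd ?a] P"
    "zigzag PreNet2 weak_equivalences P' [Fwd ?b] P"
    "zigzag PreNet2 weak_equivalences P' [Fwd ?c] P"
      "zigzag PreNet2 weak_equivalences P [Fwd (P, s, Q)] Q"
    "zigzag PreNet2 weak_equivalences P [Fwd (P, r, Q)] Q"
    using PreNet2.zigzag_Fwd[OF arrows(1)] PreNet2.zigzag_Fwd[OF arrows(2)] PreNet2.zigzag_Fwd[OF
      arrows(3)]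
      PreNet2.zigzag_Fwd[OF S(1)] PreNet2.zigzag_Fwd[OF R(1)] unfolding PreNet2_simps .
  have "net_equiv P' Q [Fwd ?a, Fwd (P, s, Q)] [Fwd ?b, Fwd (P, s, Q)]"
    by (rule bush_commuting[OF \<alpha>w(1) arrows(1) S(1) arrows(2) S(1) *(1)])
  then have ab: "net_equiv P' P [Fwd ?a] [Fwd ?b]"
    using PreNet2.zz_equiv_cancel_right[OF _ s, of P' "[Fwd ?a]" "[Fwd ?b]"] zz by simp
  have "net_equiv P' Q [Fwd ?a, Fwd (P, r, Q)] [Fwd ?c, Fwd (P, r, Q)]"
    by (rule bush_commuting[OF \<alpha>w(1) arrows(1) R(1) arrows(3) R(1) *(2)])
  then have ac: "net_equiv P' P [Fwd ?a] [Fwd ?c]"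
    using PreNet2.zz_equiv_cancel_right[OF _ r, of P' "[Fwd ?a]" "[Fwd ?c]"] zz by simp
  have "net_equiv P' Q [Fwd ?a, Fwd (P, s, Q)] [Fwd ?c, Fwd (P, s, Q)]"
    using PreNet2.zz_equiv_append_right[OF ac zz(4)] by simp
  moreover have "net_equiv P' Q [Fwd ?c, Fwd (P, s, Q)] [Fwd ?b, Fwd (P, r, Q)]"
    by (rule bush_commuting[OF \<alpha>w(1) arrows(3) S(1) arrows(2) R(1) *(3)])
  moreover have "net_equiv P' Q [Fwd ?b, Fwd (P, r, Q)] [Fwd ?a, Fwd (P, r, Q)]"
    using PreNet2.zz_equiv_append_right[OF zz_equiv.sym[OF ab] zz(5)] by simp
  ultimately have "net_equiv P' Q [Fwd ?a, Fwd (P, s, Q)] [Fwd ?a, Fwd (P, r, Q)]"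
    by (meson zz_equiv.trans)
  then show ?thesis
    using PreNet2.zz_equiv_cancel_left[OF _ \<alpha>w(2), of Q "[Fwd (P, s, Q)]"
      "[Fwd (P, r, Q)]"] zz by simp
qed

end

context
  fixes P Q :: "'v prenet"
  assumes inf: "infinite (UNIV :: 'v set)"
    and P: "is_bush P" and Q: "is_bush Q" and lean: "is_lean Q"
begin

text \<open>Raising the value at \<tau> alone keeps the map monotone: vertices below \<tau> have
  values at most the old one, and above \<tau> the map already agrees with \<open>r\<close>, which
  is monotone.\<close>

lemma net_equiv_move_max:
  assumes s: "(P, s, Q) \<in> weak_equivalences" and r: "(P, r, Q) \<in> weak_equivalences"
    and same: "same_core P s r" and \<tau>: "\<tau> \<in> Lev P 2" "(s 2 \<tau>, r 2 \<tau>) \<in> Less Q 2"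
    and max: "\<And>x. (\<tau>, x) \<in> Less P 2 \<Longrightarrow> s 2 x = r 2 x"
  defines "s' \<equiv> s(2 := (s 2)(\<tau> := r 2 \<tau>))"
  shows "(P, s', Q) \<in> weak_equivalences" "same_core P s' r"
    "net_equiv P Q [Fwd (P, s, Q)] [Fwd (P, s', Q)]"
proof -
  note S = weak_equivalencesD[OF s] and R = weak_equivalencesD[OF r]
  note Po = bush_ordered[OF P] and Qo = bush_ordered[OF Q]
  have ne: "s 2 \<tau> \<noteq> r 2 \<tau>"
    using \<tau>(2) Less_irrefl[OF Qo] by auto
  have \<tau>_core: "\<tau> \<notin> core P"
    using same ne by (auto simp: same_core_def)
  have s1: "s' 1 = s 1" "s 1 = r 1" "s' 2 \<tau> = r 2 \<tau>" "x \<noteq> \<tau> \<Longrightarrow> s' 2 x = s 2 x" for x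
    using same by (simp_all add: s'_def same_core_def)
  obtain c where c: "c \<in> core P" "s 2 c = s 2 \<tau>"
    using differ_core[OF inf P Q lean s r same \<tau>(1) ne] .
  show s': "(P, s', Q) \<in> weak_equivalences"
  proof (rule bush_weI[OF P Q])
    have "s \<in> level_maps P Q" "r \<in> level_maps P Q"
      using S(1) R(1) by (simp_all add: Arr_PreNet2)
    then show "s' \<in> level_maps P Q"
      using \<tau>(1) by (fastforce simp: level_maps_def s'_def PiE_def Pi_def extensional_def)
    show "Par P 2 x = {a \<in> Lev P 1. s' 1 a \<in> Par Q 2 (s' 2 x)}" if "x \<in> Lev P 2" for x
      using S(3)[OF that] R(3)[OF that] s1 by (cases "x = \<tau>") auto
    show "s' 1 ` Lev P 1 = Lev Q 1"
      using bush_we_surj(1)[OF P Q s] s1 by simp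
    show "s' 2 ` Lev P 2 = Lev Q 2"
    proof (intro equalityI subsetI)
      fix z
      assume "z \<in> Lev Q 2"
      then obtain x where x: "x \<in> Lev P 2" "s 2 x = z"
        using bush_we_surj(2)[OF P Q s] by (metis imageE)
      \<comment> \<open>The old value at \<tau> is not lost, because the core vertex
        \<open>c\<close> still attains it.\<close>
      show "z \<in> s' 2 ` Lev P 2"
      proof (rule image_eqI)
        show "z = s' 2 (if x = \<tau> then c else x)"
          using x c s1(4)[of c] s1(4)[of x] \<tau>_core by (cases "c = \<tau>"; cases "x = \<tau>") auto
        show "(if x = \<tau> then c else x) \<in> Lev P 2"
          using x(1) c(1) by (simp add: core_def)
      qed
    next
      fix z
      assume "z \<in> s' 2 ` Lev P 2"
      then show "z \<in> Lev Q 2"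
        using arr_Lev[OF S(1)] arr_Lev[OF R(1)] by (auto simp: s'_def)
    qed
    show "s' 1 a = s' 1 b \<or> (s' 1 a, s' 1 b) \<in> Less Q 1" if "(a, b) \<in> Less P 1" for a b
      using bush_we_mono1[OF P Q s that] s1 by simp
    show "s' 2 x = s' 2 y \<or> (s' 2 x, s' 2 y) \<in> Less Q 2"
      if xy: "(x, y) \<in> Less P 2" "Par P 2 x = Par P 2 y" for x y
    proof -
      have "x \<noteq> y"
        using xy Less_irrefl[OF Po] by auto
      then consider "x = \<tau>" "y \<noteq> \<tau>" | "x \<noteq> \<tau>" "y = \<tau>" | "x \<noteq> \<tau>" "y \<noteq> \<tau>"
        by auto
      then show ?thesis
      proof cases
        case 1
        then show ?thesis
          using bush_we_mono[OF P Q r xy] max xy(1) s1 by auto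
      next
        case 2
        then show ?thesis
          using bush_we_mono[OF P Q s xy] Less_trans[OF Qo, of "s 2 x" "s 2 \<tau>" 2
            "r 2 \<tau>"] \<tau>(2) s1 by auto
      next
        case 3
        then show ?thesis
          using bush_we_mono[OF P Q s xy] s1 by auto
      qed
    qed
    have "s' 2 x = s 2 x" if "x \<in> core P" for x
      using that \<tau>_core s1(4) by metis
    then show "bij_betw (s' 2) (core P) (core Q)"
      using S(2) bij_betw_cong[of "core P" "s' 2" "s 2" "core Q"] by blast
  qed
  show "same_core P s' r"
    using same by (auto simp: same_core_def s'_def)
  show "net_equiv P Q [Fwd (P, s, Q)] [Fwd (P, s', Q)]"
  proof (rule net_equiv_move[OF inf P Q lean s s' _ \<tau>(1)])
    show "same_core P s s'"
      using \<tau>_core by (auto simp: same_core_def s'_def)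
    show "(s 2 \<tau>, s' 2 \<tau>) \<in> Less Q 2"
      using \<tau>(2) s1 by simp
    show "s 2 x = s' 2 x" if "x \<noteq> \<tau>" for x
      using s1 that by simp
  qed
qed

text \<open>Induction on the number of disagreements. At the greatest one, the map with the smaller
  value is raised, be it \<open>s\<close> or \<open>r\<close>; thus only upward moves are
  required.\<close>

lemma net_equiv_same_core:
  assumes "(P, s, Q) \<in> weak_equivalences" "(P, r, Q) \<in> weak_equivalences" "same_core P s r"
  shows "net_equiv P Q [Fwd (P, s, Q)] [Fwd (P, r, Q)]"
  using assms
proof (induction "card {x \<in> Lev P 2. s 2 x \<noteq> r 2 x}" arbitrary: s r rule: less_induct)
  case less
  note s = less.prems(1) and r = less.prems(2) and same = less.prems(3)
  note S = weak_equivalencesD[OF s] and R = weak_equivalencesD[OF r]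
  note Po = bush_ordered[OF P] and Qo = bush_ordered[OF Q]
  let ?D = "{x \<in> Lev P 2. s 2 x \<noteq> r 2 x}"
  have fin: "finite ?D"
    using finite_Lev[OF Po] by simp
  show ?case
  proof (cases "?D = {}")
    case True
    have "s 2 \<in> Lev P 2 \<rightarrow>\<^sub>E Lev Q 2" "r 2 \<in> Lev P 2 \<rightarrow>\<^sub>E Lev Q 2"
      using S(1) R(1) by (simp_all add: Arr_PreNet2 level_maps_def)
    then have "s 2 x = r 2 x" for x
      using True PiE_arb[of "s 2" "Lev P 2" _ x] PiE_arb[of "r 2" "Lev P 2" _ x]
      by (cases "x \<in> Lev P 2") auto
    then have "s i = r i" for i
      using same by (cases "i = 2") (auto simp: same_core_def)
    then have "s = r"
      by auto
    then show ?thesis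
      using PreNet2.zigzag_Fwd[OF S(1)] by (auto intro: zz_equiv.refl)
  next
    case False
    obtain \<tau> where \<tau>: "\<tau> \<in> ?D" "\<And>x. x \<in> ?D \<Longrightarrow> x = \<tau> \<or> (x, \<tau>) \<in> Less P 2"
      by (rule Less_max[OF Po, of ?D 2]) (use False in auto)
    have max: "s 2 x = r 2 x" if "(\<tau>, x) \<in> Less P 2" for x
      using \<tau>(2)[of x] that Less_Lev[OF Po that] Less_asym[OF Po] Less_irrefl[OF Po] by blast
    have \<tau>L: "\<tau> \<in> Lev P 2"
      using \<tau>(1) by simp
    have "s 2 \<tau> \<in> Lev Q 2" "r 2 \<tau> \<in> Lev Q 2"
      using arr_Lev[OF S(1)] arr_Lev[OF R(1)] \<tau>L by auto
    then consider "(s 2 \<tau>, r 2 \<tau>) \<in> Less Q 2" | "(r 2 \<tau>, s 2 \<tau>) \<in> Less Q 2"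
      using Less_linear[OF Qo] \<tau>(1) by blast
    then show ?thesis
    proof cases
      case 1
      let ?s = "s(2 := (s 2)(\<tau> := r 2 \<tau>))"
      have "{x \<in> Lev P 2. ?s 2 x \<noteq> r 2 x} \<subset> ?D"
        using \<tau>(1) by auto
      then have "card {x \<in> Lev P 2. ?s 2 x \<noteq> r 2 x} < card ?D"
        by (rule psubset_card_mono[OF fin])
      then have "net_equiv P Q [Fwd (P, ?s, Q)] [Fwd (P, r, Q)]"
        by (rule less.hyps[where s = ?s and r = r]) (rule net_equiv_move_max[OF s r same \<tau>L 1 max]
          r; assumption)+
      then show ?thesis
        using net_equiv_move_max(3)[OF s r same \<tau>L 1 max] by (blast intro: zz_equiv.trans)
    next
      case 2
      let ?r = "r(2 := (r 2)(\<tau> := s 2 \<tau>))"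
      have same': "same_core P r s"
        using same by (simp add: same_core_def)
      note move = net_equiv_move_max[OF r s same' \<tau>L 2 max[symmetric]]
      have "{x \<in> Lev P 2. s 2 x \<noteq> ?r 2 x} \<subset> ?D"
        using \<tau>(1) by auto
      then have "card {x \<in> Lev P 2. s 2 x \<noteq> ?r 2 x} < card ?D"
        by (rule psubset_card_mono[OF fin])
      moreover have "same_core P s ?r"
        using move(2) by (simp add: same_core_def)
      ultimately have "net_equiv P Q [Fwd (P, s, Q)] [Fwd (P, ?r, Q)]"
        by (intro less.hyps[where s = s and r = ?r] s move(1))
      then show ?thesis
        using move(3) by (blast intro: zz_equiv.trans zz_equiv.sym)
    qed
  qed
qed

end

lemma is_lean_J_obj: "is_lean (J_obj S)"
  unfolding is_lean_def
proof (intro ballI impI)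
  fix x y
  assume "x \<in> Lev (J_obj S) 2" "y \<in> Lev (J_obj S) 2" "Par (J_obj S) 2 x = Par (J_obj S) 2 y" "x \<noteq> y"
  then show "x \<in> core (J_obj S)"
    by (auto simp: J_obj_Lev2 J_obj_Par2 J_obj_core)
qed

lemma infinite_vert: "infinite (UNIV :: 'a vert set)"
proof
  assume fin: "finite (UNIV :: 'a vert set)"
  have "inj (Extra undefined :: 'a vert \<Rightarrow> 'a vert)"
    by (auto intro: injI)
  then have "surj (Extra undefined :: 'a vert \<Rightarrow> 'a vert)"
    by (rule finite_UNIV_inj_surj[OF fin])
  then obtain v :: "'a vert" where "Extra undefined v = Tas undefined"
    by (metis surjD)
  then show False
    by simp
qed

section \<open>Spans from \<open>J(S)\<close> to \<open>J(T)\<close>\<close>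

text \<open>\<open>u\<close> matches level 1 of \<open>P\<close>, up to merging, and its core with
  those of \<open>S\<close>, so \<open>h\<close> descends to a tree map \<open>f\<close>. A vertex
  of \<open>P\<close> whose image under \<open>h\<close> is also the image of a core sibling goes to
  a core vertex of S-tilde; any other one goes to the tassel copying its image.\<close>

lemma bush_span:
  assumes S: "S \<in> Obj tree_category" and T: "T \<in> Obj tree_category" and P: "is_bush P"
    and u: "(P, u, J_obj S) \<in> weak_equivalences" and h: "(P, h, J_obj T) \<in> Arr PreNet2"
  obtains f v where "(S, f, T) \<in> Arr tree_category" "(P, v, tilde S f T) \<in> weak_equivalences"
    "\<And>i x. x \<in> Lev P i \<Longrightarrow> J_map S f T i (v i x) = h i x"
    "\<And>i. i \<noteq> 2 \<Longrightarrow> v i = u i" "\<And>c. c \<in> core P \<Longrightarrow> v 2 c = u 2 c"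
proof -
  have trees: "is_tree S" "Lev S 1 \<noteq> {}" "is_tree T" "Lev T 1 \<noteq> {}"
    using S T by (auto simp: Trees_simps)
  note So = tree_ordered[OF trees(1)] and To = tree_ordered[OF trees(3)]
  note JS = is_bush_J_obj[OF trees(1,2)] and JT = is_bush_J_obj[OF trees(3,4)]
  note JSo = bush_ordered[OF JS] and JTo = bush_ordered[OF JT] and Po = bush_ordered[OF P]
  note U = weak_equivalencesD[OF u]
  note uL = arr_Lev[OF U(1)] and hL = arr_Lev[OF h]
  note usurj = bush_we_surj[OF P JS u]
  have ParP: "a \<in> Par P 2 c \<longleftrightarrow> a \<in> Lev P 1 \<and> u 1 a = Vtx (stem S (u 2 c))" if "c \<in> Lev P 2" for a c
    by (simp add: U(3)[OF that] J_obj_Par2)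
  have Par_eq: "Par P 2 c = Par P 2 d \<longleftrightarrow> stem S (u 2 c) = stem S (u 2 d)"
    if "c \<in> Lev P 2" "d \<in> Lev P 2" for c d
    using bush_we_Par_eq[OF P JS u that] by (simp add: J_obj_Par2)
  have hPar: "(\<exists>c\<in>Lev P 2. a \<in> Par P 2 c \<and> h 2 c = z) \<longleftrightarrow> h 1 a = Vtx (stem T z)"
    if "a \<in> Lev P 1" "z \<in> Lev (J_obj T) 2" for a z
    using arr_Par[OF h, of 2 z a] that by (simp add: J_obj_Par2)
  have ua: "\<exists>a\<in>Lev P 1. u 1 a = Vtx x" if "x \<in> Lev S 1" for x
  proof -
    have "Vtx x \<in> u 1 ` Lev P 1"
      using that usurj(1) by (simp add: J_obj_Lev1)
    then show ?thesis
      by (metis imageE)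
  qed
  have uc: "\<exists>c\<in>core P. u 2 c = Vtx y" if "y \<in> Lev S 2" for y
  proof -
    have "Vtx y \<in> u 2 ` core P"
      using that bij_betw_imp_surj_on[OF U(2)] by (simp add: J_obj_core)
    then show ?thesis
      by (metis imageE)
  qed
  have corePL: "c \<in> Lev P 2" if "c \<in> core P" for c
    using that by (simp add: core_def)

  \<comment> \<open>The choice is harmless: vertices of \<open>P\<close> over the same
    \<open>x\<close> have the same children, hence by (b) for \<open>h\<close> the same image, since
    a vertex of \<open>J_obj T\<close> is determined by any of its children.\<close>
  define f1 where "f1 x = (SOME t. \<exists>a\<in>Lev P 1. u 1 a = Vtx x \<and> h 1 a = Vtx t)" for x
  have f1: "h 1 a = Vtx (f1 x)" if a: "a \<in> Lev P 1" "u 1 a = Vtx x" for a x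
  proof -
    have "\<exists>t. h 1 a = Vtx t"
      using hL[OF a(1)] by (auto simp: J_obj_Lev1)
    then have "\<exists>t. \<exists>a\<in>Lev P 1. u 1 a = Vtx x \<and> h 1 a = Vtx t"
      using a by blast
    from someI_ex[OF this] obtain b where b: "b \<in> Lev P 1" "u 1 b = Vtx x" "h 1 b = Vtx (f1 x)"
      by (auto simp: f1_def)
    obtain c where c: "c \<in> Lev P 2" "a \<in> Par P 2 c"
      using bush_child[OF P a(1)] by auto
    then have "b \<in> Par P 2 c"
      using ParP a b by simp
    then show ?thesis
      using hPar[OF a(1) hL[OF c(1)]] hPar[OF b(1) hL[OF c(1)]] c b(3) by auto
  qed
  \<comment> \<open>Here \<open>u\<close> is bijective on core vertices, so this is \<open>h\<close>
    after the inverse of \<open>u\<close>.\<close>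
  define f2 where "f2 y = (SOME t. \<exists>c\<in>core P. u 2 c = Vtx y \<and> h 2 c = Vtx t)" for y
  have f2: "h 2 c = Vtx (f2 y) \<and> f2 y \<in> Lev T 2" if c: "c \<in> core P" "u 2 c = Vtx y" for c y
  proof -
    have t: "\<exists>t. h 2 c = Vtx t \<and> t \<in> Lev T 2"
      using arr_core[OF h c(1)] by (auto simp: J_obj_core)
    then have "\<exists>t. \<exists>c\<in>core P. u 2 c = Vtx y \<and> h 2 c = Vtx t"
      using c by blast
    from someI_ex[OF this] obtain d where d: "d \<in> core P" "u 2 d = Vtx y" "h 2 d = Vtx (f2 y)"
      by (auto simp: f2_def)
    then have "d = c"
      using inj_onD[OF bij_betw_imp_inj_on[OF U(2)], of d c] c by simp
    then show ?thesis
      using d t by auto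
  qed
  have stem_h: "stem T (h 2 c) = f1 (stem S (u 2 c))" if c: "c \<in> Lev P 2" for c
  proof -
    obtain a where a: "a \<in> Par P 2 c"
      using bush_Par2[OF P c] by auto
    then have a': "a \<in> Lev P 1" "u 1 a = Vtx (stem S (u 2 c))"
      using ParP[OF c] by auto
    have "h 1 a = Vtx (stem T (h 2 c))"
      using hPar[OF a'(1) hL[OF c]] a c by blast
    then show ?thesis
      using f1[OF a'] by simp
  qed
  have stem_u: "stem S (u 2 c) \<in> Lev S 1" if "c \<in> Lev P 2" for c
    using Par_subset[OF bush_Obj(1)[OF JS], of 2 "u 2 c"] uL[OF that]
    by (auto simp: J_obj_Par2 J_obj_Lev1)

  obtain rT where rT: "Lev T 0 = {rT}"
    using tree_root[OF trees(3)] by auto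
  define f where "f i = restrict (if i = 0 then \<lambda>_. rT else if i = 1 then f1 else f2) (Lev S i)"
    for i :: nat
  have f: "x \<in> Lev S 1 \<Longrightarrow> f 1 x = f1 x" "y \<in> Lev S 2 \<Longrightarrow> f 2 y = f2 y" for x y
    by (simp_all add: f_def)
  have f1L: "f1 x \<in> Lev T 1" if "x \<in> Lev S 1" for x
  proof -
    obtain a where a: "a \<in> Lev P 1" "u 1 a = Vtx x"
      using ua[OF \<open>x \<in> Lev S 1\<close>] by blast
    then show ?thesis
      using f1[OF a] hL[OF a(1)] by (auto simp: J_obj_Lev1)
  qed
  have f2L: "f2 y \<in> Lev T 2" if "y \<in> Lev S 2" for y
    using uc[OF that] f2 by blast
  have epi: "is_epi_map S T f"
  proof (rule is_epi_mapI)
    have "f i x \<in> Lev T i" if "x \<in> Lev S i" for i x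
    proof -
      have "i = 0 \<or> i = 1 \<or> i = 2"
        using that Lev_empty[OF So, of i] by (cases "i > 2") (simp_all, linarith)
      then show ?thesis
        using that f1L f2L rT by (auto simp: f_def)
    qed
    then show "f \<in> level_maps S T"
      by (auto simp: level_maps_def f_def)
    show "f 1 ` Lev S 1 = Lev T 1"
    proof (intro equalityI subsetI)
      fix t
      assume t: "t \<in> Lev T 1"
      have "Vtx t \<in> Lev (J_obj T) 1" "Par (J_obj T) 1 (Vtx t) \<noteq> {}"
        using t by (simp_all add: J_obj_Lev1 J_obj_Par1)
      then obtain a where a: "a \<in> Lev P 1" "h 1 a = Vtx t"
        using arr_parented_surj[OF h] by metis
      obtain x where x: "u 1 a = Vtx x" "x \<in> Lev S 1"
        using uL[OF a(1)] by (auto simp: J_obj_Lev1)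
      then have "t = f 1 x"
        using f1[OF a(1) x(1)] a(2) f(1) by simp
      then show "t \<in> f 1 ` Lev S 1"
        using x(2) by (rule image_eqI)
    qed (use f f1L in auto)
    show "Up T 2 (f 2 y) = f 1 (Up S 2 y)" if y: "y \<in> Lev S 2" for y
    proof -
      obtain c where c: "c \<in> core P" "u 2 c = Vtx y"
        using uc[OF y] by auto
      then show ?thesis
        using stem_h[OF corePL[OF c(1)]] f2[OF c] f y tree_Up2[OF trees(1) y] by simp
    qed
    show "f 1 x = f 1 x' \<or> (f 1 x, f 1 x') \<in> Less T 1" if xx: "(x, x') \<in> Less S 1" for x x'
    proof -
      have L: "x \<in> Lev S 1" "x' \<in> Lev S 1" "x \<noteq> x'"
        using Less_Lev[OF So xx] Less_irrefl[OF So] xx by auto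
      obtain a a' where a: "a \<in> Lev P 1" "u 1 a = Vtx x" "a' \<in> Lev P 1" "u 1 a' = Vtx x'"
        using ua L by metis
      \<comment> \<open>\<open>u\<close> only preserves order weakly, so the order of the chosen
        lifts is found by excluding the opposite one.\<close>
      have "(a', a) \<notin> Less P 1"
        using bush_we_mono1[OF P JS u, of a' a] a L(3) Less_asym[OF So xx]
        by (auto simp: J_obj_Less1)
      then have "(a, a') \<in> Less P 1"
        using Less_linear[OF Po a(1,3)] a(2,4) L(3) by auto
      then have "(a, a') \<in> less_circ P 1"
        using bush_Par1[OF P] a by (simp add: less_circ_bush[OF P])
      then have "h 1 a = h 1 a' \<or> (h 1 a, h 1 a') \<in> Less (J_obj T) 1"
        using arr_less_circ[OF h] less_circ_subset[OF JTo] by blast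
      then show ?thesis
        using f1[OF a(1,2)] f1[OF a(3,4)] f L by (simp add: J_obj_Less1)
    qed
    show "f 2 y = f 2 y' \<or> (f 2 y, f 2 y') \<in> Less T 2"
      if yy: "(y, y') \<in> Less S 2" "Up S 2 y = Up S 2 y'" for y y'
    proof -
      have L: "y \<in> Lev S 2" "y' \<in> Lev S 2" "y \<noteq> y'"
        using Less_Lev[OF So yy(1)] Less_irrefl[OF So] yy(1) by auto
      obtain c c' where c: "c \<in> core P" "u 2 c = Vtx y" "c' \<in> core P" "u 2 c' = Vtx y'"
        using uc L by metis
      note cL = corePL[OF c(1)] corePL[OF c(3)]
      have eq: "Par P 2 c = Par P 2 c'"
        using Par_eq[OF cL] c yy(2) by simp
      have "(Vtx y', Vtx y) \<notin> Less (J_obj S) 2"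
        using yy(2) Less_asym[OF So yy(1)] Less_irrefl[OF So] by (auto simp: J_obj_Less2)
      then have "(c', c) \<notin> Less P 2"
        using bush_we_mono[OF P JS u, of c' c] c L(3) eq by auto
      then have "(c, c') \<in> Less P 2"
        using Less_linear[OF Po cL] c(2,4) L(3) by auto
      then have "(c, c') \<in> less_circ P 2"
        using eq by (simp add: less_circ_bush[OF P])
      then have "h 2 c = h 2 c' \<or> (h 2 c, h 2 c') \<in> Less (J_obj T) 2"
        using arr_less_circ[OF h] less_circ_subset[OF JTo] by blast
      moreover have "Up T 2 (f2 y) = Up T 2 (f2 y')"
        using stem_h[OF cL(1)] stem_h[OF cL(2)] f2[OF c(1,2)] f2[OF c(3,4)] c yy(2) by simp
      ultimately show ?thesis
        using f2[OF c(1,2)] f2[OF c(3,4)] f L Less_irrefl[OF To] by (auto simp: J_obj_Less2)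
    qed
  qed
  then have arr: "(S, f, T) \<in> Arr tree_category"
    using S T by (simp add: Arr_Trees)
  let ?St = "tilde S f T"
  note tb = is_bush_tilde[OF arr] and tL = tilde_Lev[OF arr]

  \<comment> \<open>S-tilde contains no copy of a vertex that a core sibling already reaches, so a
    tassel with nonempty \<open>K\<close> must be sent to the core. Vertices with equal key are sent
    there by one and the same monotone retraction onto \<open>K\<close>.\<close>
  define K where "K k = {c \<in> core P. Par P 2 c = fst k \<and> h 2 c = snd k}" for k
  define key where "key c = (Par P 2 c, h 2 c)" for c
  define G where "G k \<theta> \<longleftrightarrow> (K k \<noteq> {} \<longrightarrow> (\<forall>c. \<theta> c \<in> K k) \<and> (\<forall>c. c \<in> K k \<longrightarrow> \<theta> c = c) \<and>
      (\<forall>c d. (c, d) \<in> Less P 2 \<longrightarrow> \<theta> c = \<theta> d \<or> (\<theta> c, \<theta> d) \<in> Less P 2))" for k \<theta>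
  have "\<exists>\<theta>. G k \<theta>" for k
  proof (cases "K k = {}")
    case False
    have "K k \<subseteq> Lev P 2"
      using corePL by (auto simp: K_def)
    then obtain \<theta> where "\<And>c. \<theta> c \<in> K k" "\<And>c. c \<in> K k \<Longrightarrow> \<theta> c = c"
      "\<And>c d. (c, d) \<in> Less P 2 \<Longrightarrow> \<theta> c = \<theta> d \<or> (\<theta> c, \<theta> d) \<in> Less P 2"
      by (rule Less_retraction[OF Po _ False]) blast
    then show ?thesis
      unfolding G_def by (intro exI[of _ \<theta>]) blast
  qed (simp add: G_def)
  then have "\<exists>\<theta>. \<forall>k. G k (\<theta> k)"
    by (intro choice allI)
  then obtain \<theta> where "\<And>k. G k (\<theta> k)"
    by blast
  then have \<theta>: "(\<forall>c. \<theta> k c \<in> K k) \<and> (\<forall>c. c \<in> K k \<longrightarrow> \<theta> k c = c) \<and>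
      (\<forall>c d. (c, d) \<in> Less P 2 \<longrightarrow> \<theta> k c = \<theta> k d \<or> (\<theta> k c, \<theta> k d) \<in> Less P 2)" if "K k \<noteq> {}" for k
    using that unfolding G_def by blast
  define v where "v i = (if i = 2 then restrict (\<lambda>c. if K (key c) = {} then Extra (stem S (u 2 c))
    (h 2 c)
    else u 2 (\<theta> (key c) c)) (Lev P 2) else u i)" for i :: nat
  have v_other: "v i = u i" if "i \<noteq> 2" for i
    using that by (simp add: v_def)
  have v_Extra: "v 2 c = Extra (stem S (u 2 c)) (h 2 c)" if "c \<in> Lev P 2" "K (key c) = {}" for c
    using that by (simp add: v_def)
  have v_Vtx: "\<exists>y. v 2 c = Vtx y \<and> v 2 c = u 2 (\<theta> (key c) c) \<and> y \<in> Lev S 2 \<and>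
    Up S 2 y = stem S (u 2 c) \<and>
      h 2 c = Vtx (f 2 y)" if c: "c \<in> Lev P 2" "K (key c) \<noteq> {}" for c
  proof -
    let ?d = "\<theta> (key c) c"
    have d: "?d \<in> core P" "Par P 2 ?d = Par P 2 c" "h 2 ?d = h 2 c"
      using \<theta>[OF c(2)] by (auto simp: K_def key_def)
    obtain y where y: "u 2 ?d = Vtx y" "y \<in> Lev S 2"
      using arr_core[OF U(1) d(1)] by (auto simp: J_obj_core)
    have "stem S (u 2 ?d) = stem S (u 2 c)"
      using Par_eq[OF corePL[OF d(1)] c(1)] d(2) by simp
    then show ?thesis
      using y c d(3) f2[OF d(1) y(1)] f(2) by (simp add: v_def)
  qed
  have v_core: "v 2 c = u 2 c" if c: "c \<in> core P" for c
  proof -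
    have "c \<in> K (key c)"
      using c by (simp add: K_def key_def)
    then show ?thesis
      using \<theta>[of "key c"] corePL[OF c] by (auto simp: v_def)
  qed
  have im: "(case v 2 c of Vtx y \<Rightarrow> Vtx (f 2 y) | Extra x z \<Rightarrow> z) = h 2 c" and v_stem:
    "stem S (v 2 c) = stem S (u 2 c)"
    if c: "c \<in> Lev P 2" for c
    using v_Extra[OF c] v_Vtx[OF c] by (cases "K (key c) = {}"; auto)+
  have vL: "v 2 c \<in> Lev ?St 2" if c: "c \<in> Lev P 2" for c
  proof (cases "K (key c) = {}")
    case False
    then show ?thesis
      using v_Vtx[OF c] by (auto simp: tL)
  next
    case True
    let ?x = "stem S (u 2 c)"
    have x: "?x \<in> Lev S 1"
      using stem_u[OF c] .
    have z: "h 2 c \<in> Lev (J_obj T) 2" "stem T (h 2 c) = f 1 ?x"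
      using hL[OF c] stem_h[OF c] f(1)[OF x] by auto
    have "h 2 c \<in> tilde_extra S f T ?x"
    proof (cases "?x \<in> Up S 2 ` Lev S 2")
      case no: False
      then show ?thesis
        using z by (simp add: tilde_extra_def children_def J_obj_Par2)
    next
      case yes: True
      then obtain y where y: "y \<in> Lev S 2" "?x = Up S 2 y"
        by auto
      then have "f 1 ?x \<in> Up T 2 ` Lev T 2"
        using is_epi_mapD(1,4)[OF epi] by (metis imageI)
      then obtain w where w: "h 2 c = Vtx w" "w \<in> Lev T 2" "Up T 2 w = f 1 ?x"
        using z by (auto simp: J_obj_Lev2)
      \<comment> \<open>Otherwise the core vertex of \<open>P\<close> over \<open>y'\<close> would
        be a sibling of \<open>c\<close> with the same image, so \<open>K\<close> would not be
        empty.\<close>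
      have "w \<noteq> f 2 y'" if y': "y' \<in> tree_children S ?x" for y'
      proof
        assume eq: "w = f 2 y'"
        have y'L: "y' \<in> Lev S 2" "Up S 2 y' = ?x"
          using y' by (auto simp: tree_children_def)
        obtain d where d: "d \<in> core P" "u 2 d = Vtx y'"
          using uc[OF y'L(1)] by auto
        then have "d \<in> K (key c)"
          using f2[OF d] f(2)[OF y'L(1)] eq w(1) Par_eq[OF corePL[OF d(1)] c] y'L(2)
          by (simp add: K_def key_def)
        then show False
          using True by auto
      qed
      then show ?thesis
        using yes w by (auto simp: tilde_extra_def tree_children_def)
    qed
    then show ?thesis
      using x v_Extra[OF c True] by (simp add: tL)
  qed
  have LevN: "Lev ?St i = Lev (J_obj S) i" "Less ?St i = Less (J_obj S) i" if "i \<noteq> 2" for i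
    using that by (simp_all add: tilde_def J_obj_def grow_def Let_def)
  have v: "(P, v, ?St) \<in> weak_equivalences"
  proof (rule bush_weI[OF P tb])
    show "v \<in> level_maps P ?St"
      unfolding level_maps_def
    proof (intro CollectI allI)
      fix i
      have "u i \<in> Lev P i \<rightarrow>\<^sub>E Lev (J_obj S) i"
        using U(1) by (simp add: Arr_PreNet2 level_maps_def)
      moreover have "v 2 \<in> extensional (Lev P 2)"
        by (simp add: v_def)
      ultimately show "v i \<in> Lev P i \<rightarrow>\<^sub>E Lev ?St i"
        using vL v_other[of i] LevN(1)[of i] by (cases "i = 2") (auto simp: PiE_def)
    qed
    show "Par P 2 c = {a \<in> Lev P 1. v 1 a \<in> Par ?St 2 (v 2 c)}" if "c \<in> Lev P 2" for c
      using U(3)[OF that] v_stem[OF that] v_other[of 1] by (simp add: tilde_Par2[OF arr] J_obj_Par2)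
    show "v 1 ` Lev P 1 = Lev ?St 1"
      using usurj(1) v_other[of 1] LevN(1)[of 1] by simp
    show "v 2 ` Lev P 2 = Lev ?St 2"
    proof (intro equalityI subsetI)
      fix e
      assume e: "e \<in> Lev ?St 2"
      show "e \<in> v 2 ` Lev P 2"
      proof (cases e)
        case (Vtx y)
        then obtain c where c: "c \<in> core P" "u 2 c = e"
          using e uc[of y] by (auto simp: tL)
        then have "e = v 2 c"
          using v_core by simp
        then show ?thesis
          using corePL[OF c(1)] by (rule image_eqI)
      next
        case (Extra x z)
        have x: "x \<in> Lev S 1"
          using e Extra by (simp add: tL)
        obtain a where a: "a \<in> Lev P 1" "u 1 a = Vtx x"
          using ua[OF x] by auto
        have z: "z \<in> Lev (J_obj T) 2" "stem T z = f 1 x"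
          using image2_tilde[OF arr e] Extra by auto
        then obtain c where c: "c \<in> Lev P 2" "a \<in> Par P 2 c" "h 2 c = z"
          using hPar[OF a(1) z(1)] f1[OF a] f(1)[OF x] by auto
        have xc: "stem S (u 2 c) = x"
          using ParP[OF c(1)] c(2) a(2) by simp
        \<comment> \<open>If not, \<open>c\<close> would go to a core vertex with the stem and image
          of the tassel \<open>e\<close>, but within a fibre images separate tassels from core
          vertices.\<close>
        have "K (key c) = {}"
        proof (rule ccontr)
          assume "K (key c) \<noteq> {}"
          then obtain y where y: "v 2 c = Vtx y"
            using v_Vtx[OF c(1)] by auto
          then show False
            using image2_tilde_eq[OF arr vL[OF c(1)] e] im[OF c(1)] v_stem[OF c(1)] xc c(3) Extra by
              auto
        qed
        then have "e = v 2 c"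
          using v_Extra[OF c(1)] xc c(3) Extra by simp
        then show ?thesis
          using c(1) by (rule image_eqI)
      qed (use e in \<open>simp add: tL\<close>)
    qed (use vL in auto)
    show "v 1 a = v 1 b \<or> (v 1 a, v 1 b) \<in> Less ?St 1" if "(a, b) \<in> Less P 1" for a b
      using bush_we_mono1[OF P JS u that] v_other[of 1] LevN(2)[of 1] by simp
    show "v 2 c = v 2 d \<or> (v 2 c, v 2 d) \<in> Less ?St 2"
      if cd: "(c, d) \<in> Less P 2" "Par P 2 c = Par P 2 d" for c d
    proof -
      have L: "c \<in> Lev P 2" "d \<in> Lev P 2"
        using Less_Lev[OF Po cd(1)] by auto
      have st: "stem S (u 2 c) = stem S (u 2 d)"
        using Par_eq[OF L] cd(2) by simp
      then have st': "stem S (v 2 c) = stem S (v 2 d)"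
        using v_stem L by simp
      note less = tilde_Less2[OF arr vL[OF L(1)] vL[OF L(2)] st', unfolded im[OF L(1)] im[OF L(2)]]
      have "(c, d) \<in> less_circ P 2"
        using cd by (simp add: less_circ_bush[OF P])
      then have "h 2 c = h 2 d \<or> (h 2 c, h 2 d) \<in> Less (J_obj T) 2"
        using arr_less_circ[OF h] less_circ_subset[OF JTo] by blast
      then show ?thesis
      proof
        assume "(h 2 c, h 2 d) \<in> Less (J_obj T) 2"
        then show ?thesis
          using less by simp
      next
        \<comment> \<open>For equal images the order in S-tilde is that of \<open>S\<close>. The
          keys agree too, so a single retraction handles both vertices and its monotony
          applies.\<close>
        assume eq: "h 2 c = h 2 d"
        then have k: "key c = key d"
          using cd(2) by (simp add: key_def)
        show ?thesis
        proof (cases "K (key c) = {}")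
          case True
          then show ?thesis
            using v_Extra L k eq st by simp
        next
          case False
          let ?c = "\<theta> (key c) c" and ?d = "\<theta> (key c) d"
          have \<theta>cd: "?c \<in> K (key c)" "?d \<in> K (key c)" "?c = ?d \<or> (?c, ?d) \<in> Less P 2"
            using \<theta>[OF False] cd(1) by auto
          then have "u 2 ?c = u 2 ?d \<or> (u 2 ?c, u 2 ?d) \<in> Less (J_obj S) 2"
            using bush_we_mono[OF P JS u, of ?c ?d] by (auto simp: K_def)
          moreover obtain y where y: "v 2 c = Vtx y" "u 2 ?c = Vtx y" "Up S 2 y = stem S (u 2 c)"
            using v_Vtx[OF L(1) False] by auto
          moreover obtain y' where y': "v 2 d = Vtx y'" "u 2 ?d = Vtx y'"
            "Up S 2 y' = stem S (u 2 d)"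
            using v_Vtx[OF L(2)] False k by auto
          ultimately have "y = y' \<or> (y, y') \<in> Less S 2"
            using st Less_irrefl[OF So] by (auto simp: J_obj_Less2)
          then show ?thesis
            using less eq y(1) y'(1) by auto
        qed
      qed
    qed
    show "bij_betw (v 2) (core P) (core ?St)"
      using U(2) bij_betw_cong[of "core P" "v 2" "u 2" "core (J_obj S)"] v_core
      by (simp add: tilde_core[OF arr] J_obj_core)
  qed
  have "J_map S f T i (v i x) = h i x" if x: "x \<in> Lev P i" for i x
  proof -
    have "i \<le> 2"
      using x Lev_empty[OF Po, of i] by (cases "i > 2") auto
    then consider "i = 0" | "i = 1" | "i = 2"
      by linarith
    then show ?thesis
    proof cases
      case 1
      have "J_map S f T 0 (v 0 x) \<in> Lev (J_obj T) 0" "h 0 x \<in> Lev (J_obj T) 0"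
        using arr_Lev[OF J_map_arr[OF arr]] arr_Lev[OF weak_equivalencesD(1)[OF v]] hL x 1 by auto
      then show ?thesis
        using 1 rT by (simp add: J_obj_Lev0)
    next
      case 2
      obtain t where "u 1 x = Vtx t" "t \<in> Lev S 1"
        using uL[of x 1] x 2 by (auto simp: J_obj_Lev1)
      then show ?thesis
        using f1[of x t] x 2 v_other[of 1] f(1) by (simp add: J_map_simps(1)[OF arr])
    next
      case 3
      then show ?thesis
        using im[of x] vL[of x] x by (simp add: J_map_simps(2)[OF arr])
    qed
  qed
  then show ?thesis
    using that arr v v_other v_core by blast
qed

abbreviation span_steps ::
  "'a tree \<Rightarrow> 'a level_map \<Rightarrow> 'a tree \<Rightarrow> 'a vert level_map \<Rightarrow> 'a vert prenet_arrow step list" where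
  "span_steps S f T u \<equiv> [Bwd (tilde S f T, u, J_obj S), Fwd (tilde S f T, J_map S f T, J_obj T)]"

lemma zigzag_span:
  assumes arr: "(S, f, T) \<in> Arr tree_category" and u: "is_retraction S f T u"
  shows "zigzag PreNet2 weak_equivalences (J_obj S) (span_steps S f T u) (J_obj T)"
  using retraction_we[OF arr u] J_map_arr[OF arr] bush_Obj[OF is_bush_J_obj[of T]] arr_trees[OF arr]
    by simp

text \<open>\<open>same_core\<close> asks for equal functions off level 2: level 0 has one vertex,
  and off the carriers extensionality decides.\<close>

lemma same_core_comp:
  assumes "(P, s, Q) \<in> Arr PreNet2" "(P, r, Q) \<in> Arr PreNet2"
    and "\<And>x. x \<in> Lev P 1 \<Longrightarrow> s 1 x = r 1 x" "\<And>x. x \<in> core P \<Longrightarrow> s 2 x = r 2 x"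
  shows "same_core P s r"
  unfolding same_core_def
proof (intro conjI allI impI ballI)
  fix i :: nat
  assume i: "i \<noteq> 2"
  have "s i x = r i x" if "x \<in> Lev P i" for x
  proof -
    have "i = 0 \<or> i = 1"
      using that i Lev_empty[OF arr_ordered(1)[OF assms(1)], of i]
      by (cases "i > 2") (simp_all, linarith)
    then show ?thesis
      using arr_Lev[OF assms(1) that] arr_Lev[OF assms(2) that] assms(1,3) that
      by (auto simp: Arr_PreNet2 connected_prenet_def)
  qed
  moreover have "s i \<in> extensional (Lev P i)" "r i \<in> extensional (Lev P i)"
    using assms(1,2) by (simp_all add: Arr_PreNet2 level_maps_def PiE_def)
  ultimately show "s i = r i"
    by (intro extensionalityI)
qed (use assms(4) in simp)

text \<open>Independence of \<open>J_arr\<close> from the choice of the left leg: any two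
  retractions agree on level 1 and on the core.\<close>

lemma net_equiv_retractions:
  assumes arr: "(S, f, T) \<in> Arr tree_category" and u: "is_retraction S f T u" and v:
    "is_retraction S f T v"
  shows "net_equiv (J_obj S) (J_obj T) (span_steps S f T u) (span_steps S f T v)"
proof -
  note tb = is_bush_tilde[OF arr] and JS = is_bush_J_obj[OF arr_trees(1,3)[OF arr]]
  note uw = retraction_we[OF arr u] and vw = retraction_we[OF arr v]
  note D = weak_equivalencesD(1)[OF uw] weak_equivalencesD(1)[OF vw]
  have "same_core (tilde S f T) u v"
    using retractionD(2,3)[OF arr u] retractionD(2,3)[OF arr v]
    by (intro same_core_comp[OF D]) (auto simp: tilde_core[OF arr])
  then have "net_equiv (tilde S f T) (J_obj S) [Fwd (tilde S f T, u, J_obj S)] [Fwd (tilde S f T, v,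
    J_obj S)]"
    by (rule net_equiv_same_core[OF infinite_vert tb JS is_lean_J_obj uw vw])
  then have "net_equiv (J_obj S) (tilde S f T) [Bwd (tilde S f T, u, J_obj S)] [Bwd (tilde S f T, v,
    J_obj S)]"
    using PreNet2.zz_equiv_Bwd[OF uw vw] by simp
  then show ?thesis
    using PreNet2.zz_equiv_append_right[of _ _ _ _
      "[Fwd (tilde S f T, J_map S f T, J_obj T)]" "J_obj T"]
      PreNet2.zigzag_Fwd[OF J_map_arr[OF arr]] by fastforce
qed

lemma bush_id_we:
  assumes "is_bush P"
  shows "(P, \<lambda>i. restrict id (Lev P i), P) \<in> weak_equivalences"
proof (rule bush_weI[OF assms assms])
  show "(\<lambda>i. restrict id (Lev P i)) \<in> level_maps P P"
    by (simp add: level_maps_def)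
  show "bij_betw (restrict id (Lev P 2)) (core P) (core P)"
    by (auto simp: bij_betw_def inj_on_def core_def)
  show "Par P 2 c = {a \<in> Lev P 1. restrict id (Lev P 1) a \<in> Par P 2 (restrict id (Lev P 2) c)}"
    if "c \<in> Lev P 2" for c
    using Par_subset[OF bush_Obj(1)[OF assms], of 2 c] that by auto
qed (use Less_Lev[OF bush_ordered[OF assms]] in auto)

text \<open>The given leg \<open>u\<close> and the composite of \<open>v\<close> with a retraction
  agree on level 1 and on the core, so they are equal in the localization. After this replacement
  \<open>v\<close> occurs backward and forward in the middle of the zigzag and cancels.\<close>

lemma net_equiv_span:
  assumes S: "S \<in> Obj tree_category" and T: "T \<in> Obj tree_category" and P: "is_bush P"
    and u: "(P, u, J_obj S) \<in> weak_equivalences" and h: "(P, h, J_obj T) \<in> Arr PreNet2"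
  shows "\<exists>f w. (S, f, T) \<in> Arr tree_category \<and> is_retraction S f T w \<and>
    net_equiv (J_obj S) (J_obj T) [Bwd (P, u, J_obj S), Fwd (P, h, J_obj T)] (span_steps S f T w)"
proof -
  obtain f v where arr: "(S, f, T) \<in> Arr tree_category" and v:
    "(P, v, tilde S f T) \<in> weak_equivalences"
    and J: "\<And>i x. x \<in> Lev P i \<Longrightarrow> J_map S f T i (v i x) = h i x"
    and vu: "\<And>i. i \<noteq> 2 \<Longrightarrow> v i = u i" "\<And>c. c \<in> core P \<Longrightarrow> v 2 c = u 2 c"
    by (rule bush_span[OF S T P u h]) blast
  obtain w where w: "is_retraction S f T w"
    using retraction_exists[OF arr] by auto
  note ww = retraction_we[OF arr w] and Ja = J_map_arr[OF arr]
  note U = weak_equivalencesD[OF u] and V = weak_equivalencesD[OF v] and JS = is_bush_J_obj[OF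
    arr_trees(1,3)[OF arr]]
  let ?s = "\<lambda>i. compose (Lev P i) (w i) (v i)"
  let ?St = "tilde S f T"
  have s: "(P, ?s, J_obj S) \<in> weak_equivalences"
    by (rule bush_comp_we[OF P v ww])
  have "same_core P u ?s"
  proof (rule same_core_comp[OF U(1) weak_equivalencesD(1)[OF s]])
    show "u 1 x = compose (Lev P 1) (w 1) (v 1) x" if "x \<in> Lev P 1" for x
      using that retractionD(2)[OF arr w] arr_Lev[OF V(1) that] vu(1)[of 1]
      by (simp add: compose_eq)
    show "u 2 x = compose (Lev P 2) (w 2) (v 2) x" if x: "x \<in> core P" for x
    proof -
      obtain y where "u 2 x = Vtx y" "y \<in> Lev S 2"
        using arr_core[OF U(1) x] by (auto simp: J_obj_core)
      then show ?thesis
        using retractionD(3)[OF arr w] vu(2)[OF x] x by (simp add: compose_eq core_def)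
    qed
  qed
  then have "net_equiv P (J_obj S) [Fwd (P, u, J_obj S)] [Fwd (P, ?s, J_obj S)]"
    by (rule net_equiv_same_core[OF infinite_vert P JS is_lean_J_obj u s])
  then have "net_equiv (J_obj S) P [Bwd (P, u, J_obj S)] [Bwd (P, ?s, J_obj S)]"
    using PreNet2.zz_equiv_Bwd[OF u s] by simp
  moreover have "net_equiv (J_obj S) P [Bwd (P, ?s, J_obj S)] [Bwd (?St, w, J_obj S), Bwd (P, v,
    ?St)]"
    using PreNet2.zz_equiv_Bwd_comp[OF v ww] s by simp
  ultimately have 1: "net_equiv (J_obj S) P [Bwd (P, u, J_obj S)] [Bwd (?St, w, J_obj S), Bwd (P, v,
    ?St)]"
    by (rule zz_equiv.trans)
  have "h i \<in> extensional (Lev P i)" for i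
    using h by (simp add: Arr_PreNet2 level_maps_def PiE_def)
  then have "(\<lambda>i. compose (Lev P i) (J_map S f T i) (v i)) = h"
    using J by (intro ext) (auto simp: compose_def extensional_def)
  then have 2: "net_equiv P (J_obj T) [Fwd (P, v, ?St), Fwd (?St, J_map S f T, J_obj T)] [Fwd (P, h,
    J_obj T)]"
    using PreNet2.zz_equiv_comp[OF V(1) Ja] h by simp
  have "net_equiv (J_obj S) (J_obj T) ([Bwd (P, u, J_obj S)] @ [Fwd (P, h, J_obj T)])
      ([Bwd (?St, w, J_obj S), Bwd (P, v, ?St)] @ [Fwd (P, v, ?St), Fwd (?St, J_map S f T, J_obj
        T)])"
    by (rule PreNet2.zz_equiv_append[OF 1 zz_equiv.sym[OF 2]])
  moreover have "net_equiv ?St (J_obj T) ([Bwd (P, v, ?St), Fwd (P, v, ?St)] @ [Fwd (?St, J_map S f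
    T, J_obj T)])
      ([] @ [Fwd (?St, J_map S f T, J_obj T)])"
    by (rule PreNet2.zz_equiv_append_right) (use PreNet2.zz_equiv_Bwd_Fwd[OF v]
      PreNet2.zigzag_Fwd[OF Ja] in simp_all)
  then have "net_equiv (J_obj S) (J_obj T) ([Bwd (?St, w, J_obj S)] @ ([Bwd (P, v, ?St), Fwd (P, v,
    ?St)] @ [Fwd (?St, J_map S f T, J_obj T)]))
      ([Bwd (?St, w, J_obj S)] @ ([] @ [Fwd (?St, J_map S f T, J_obj T)]))"
    by (rule PreNet2.zz_equiv_append_left) (use PreNet2.zigzag_Bwd[OF ww] in simp)
  ultimately have "net_equiv (J_obj S) (J_obj T) [Bwd (P, u, J_obj S), Fwd (P, h, J_obj T)]
    (span_steps S f T w)"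
    by simp (rule zz_equiv.trans)
  then show ?thesis
    using arr w by blast
qed

text \<open>Induction on the steps still to be absorbed, for all spans at once: a forward step is
  composed with \<open>h\<close>, a backward step is exchanged by \<open>bush_cospan\<close>. The
  target stays a variable, tied to \<open>J_obj T\<close> by an equation, to permit rule
  induction.\<close>

lemma net_full_bush:
  assumes "zigzag PreNet2 weak_equivalences X zs Y" "Y = J_obj T" "S \<in> Obj tree_category"
    "T \<in> Obj tree_category"
    and "is_bush P" "(P, u, J_obj S) \<in> weak_equivalences" "(P, h, X) \<in> Arr PreNet2"
  shows "\<exists>f w. (S, f, T) \<in> Arr tree_category \<and> is_retraction S f T w \<and>
    net_equiv (J_obj S) Y ([Bwd (P, u, J_obj S), Fwd (P, h, X)] @ zs) (span_steps S f T w)"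
  using assms
proof (induction arbitrary: P u h rule: zigzag.induct)
  case (nil X)
  then show ?case
    using net_equiv_span[of S T P u h] by simp
next
  case (fwd g zs Y)
  obtain X k X' where g: "g = (X, k, X')"
    by (cases g)
  note u = fwd.prems(5) and h = fwd.prems(6)[unfolded g PreNet2_simps]
  have k: "(X, k, X') \<in> Arr PreNet2"
    using fwd.hyps(1) g by simp
  let ?h = "\<lambda>i. compose (Lev P i) (k i) (h i)"
  have h': "(P, ?h, X') \<in> Arr PreNet2"
    by (rule bush_comp_arr[OF fwd.prems(4) h k])
  have zs: "zigzag PreNet2 weak_equivalences X' zs Y"
    using fwd.hyps(2) g by simp
  have "net_equiv P X' [Fwd (P, h, X), Fwd (X, k, X')] [Fwd (P, ?h, X')]"
    using PreNet2.zz_equiv_comp[OF h k] h' by simp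
  then have "net_equiv P Y ([Fwd (P, h, X), Fwd (X, k, X')] @ zs) ([Fwd (P, ?h, X')] @ zs)"
    by (rule PreNet2.zz_equiv_append_right[OF _ zs])
  then have "net_equiv (J_obj S) Y ([Bwd (P, u, J_obj S)] @ ([Fwd (P, h, X), Fwd (X, k, X')] @ zs))
      ([Bwd (P, u, J_obj S)] @ ([Fwd (P, ?h, X')] @ zs))"
    by (rule PreNet2.zz_equiv_append_left) (use PreNet2.zigzag_Bwd[OF u] in simp)
  moreover obtain f w where "(S, f, T) \<in> Arr tree_category" "is_retraction S f T w"
    "net_equiv (J_obj S) Y ([Bwd (P, u, J_obj S), Fwd (P, ?h, X')] @ zs) (span_steps S f T w)"
    using fwd.IH[of P u ?h] fwd.prems h' g by auto
  ultimately show ?case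
    unfolding g PreNet2_simps by (intro exI[of _ f] exI[of _ w] conjI) (auto intro: zz_equiv.trans)
next
  case (bwd g zs Y)
  obtain Z k X where g: "g = (Z, k, X)"
    by (cases g)
  note P = bwd.prems(4) and u = bwd.prems(5) and h = bwd.prems(6)[unfolded g PreNet2_simps]
  have k: "(Z, k, X) \<in> weak_equivalences"
    using bwd.hyps(1) g by simp
  have zs: "zigzag PreNet2 weak_equivalences Z zs Y"
    using bwd.hyps(2) g by simp
  obtain Q \<pi> l where Q: "is_bush Q" and \<pi>: "(Q, \<pi>, P) \<in> weak_equivalences" and l:
    "(Q, l, Z) \<in> Arr PreNet2"
    and comm: "\<And>i x. x \<in> Lev Q i \<Longrightarrow> h i (\<pi> i x) = k i (l i x)"
    by (rule bush_cospan[OF infinite_vert P h k]) blast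
  note K = weak_equivalencesD(1)[OF k] and \<Pi> = weak_equivalencesD(1)[OF \<pi>]
  let ?u = "\<lambda>i. compose (Lev Q i) (u i) (\<pi> i)"
  have u': "(Q, ?u, J_obj S) \<in> weak_equivalences"
    by (rule bush_comp_we[OF Q \<pi> u])
  let ?Bu = "Bwd (P, u, J_obj S)" and ?B\<pi> = "Bwd (Q, \<pi>, P)" and ?F\<pi> = "Fwd (Q, \<pi>, P)"
    and ?Fh = "Fwd (P, h, X)" and ?Bk = "Bwd (Z, k, X)" and ?Fk = "Fwd (Z, k, X)" and ?Fl =
      "Fwd (Q, l, Z)"
  have objs: "P \<in> Obj PreNet2" "Q \<in> Obj PreNet2" "X \<in> Obj PreNet2" "Z \<in> Obj PreNet2"
    "J_obj S \<in> Obj PreNet2"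
    using K \<Pi> weak_equivalencesD(1)[OF u] by (simp_all add: Arr_PreNet2)
  note zz_intros = u u' \<pi> k K \<Pi> h l weak_equivalencesD(1)[OF u] objs[simplified]
  have 1: "net_equiv (J_obj S) Q [Bwd (Q, ?u, J_obj S)] [?Bu, ?B\<pi>]"
    using PreNet2.zz_equiv_Bwd_comp[OF \<pi> u] u' by simp
  have "net_equiv Q X [?F\<pi>, ?Fh] [?Fl, ?Fk]"
    by (rule bush_commuting[OF Q \<Pi> h l K comm])
  from PreNet2.zz_equiv_append_right[OF this, of "[?Bk]" Z]
  have "net_equiv Q Z [?F\<pi>, ?Fh, ?Bk] [?Fl, ?Fk, ?Bk]"
    using zz_intros by simp
  moreover have "net_equiv Z Z [?Fk, ?Bk] []"
    using PreNet2.zz_equiv_Fwd_Bwd[OF k] by simp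
  from PreNet2.zz_equiv_append_left[OF this, of Q "[?Fl]"]
  have "net_equiv Q Z [?Fl, ?Fk, ?Bk] [?Fl]"
    using zz_intros by simp
  ultimately have 2: "net_equiv Q Z [?F\<pi>, ?Fh, ?Bk] [?Fl]"
    by (rule zz_equiv.trans)
  have 3: "net_equiv (J_obj S) Z [Bwd (Q, ?u, J_obj S), ?Fl] [?Bu, ?B\<pi>, ?F\<pi>, ?Fh, ?Bk]"
    using PreNet2.zz_equiv_append[OF 1 zz_equiv.sym[OF 2]] by simp
  have "net_equiv P P [?B\<pi>, ?F\<pi>] []"
    using PreNet2.zz_equiv_Bwd_Fwd[OF \<pi>] by simp
  from PreNet2.zz_equiv_append_right[OF this, of "[?Fh, ?Bk]" Z]
  have "net_equiv P Z [?B\<pi>, ?F\<pi>, ?Fh, ?Bk] [?Fh, ?Bk]"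
    using zz_intros by simp
  from PreNet2.zz_equiv_append_left[OF this, of "J_obj S" "[?Bu]"]
  have "net_equiv (J_obj S) Z [?Bu, ?B\<pi>, ?F\<pi>, ?Fh, ?Bk] [?Bu, ?Fh, ?Bk]"
    using zz_intros by simp
  then have "net_equiv (J_obj S) Z [?Bu, ?Fh, ?Bk] [Bwd (Q, ?u, J_obj S), ?Fl]"
    using 3 by (blast intro: zz_equiv.trans zz_equiv.sym)
  from PreNet2.zz_equiv_append_right[OF this zs]
  have "net_equiv (J_obj S) Y ([?Bu, ?Fh, ?Bk] @ zs) ([Bwd (Q, ?u, J_obj S), ?Fl] @ zs)" .
  moreover obtain f w where "(S, f, T) \<in> Arr tree_category" "is_retraction S f T w"
    "net_equiv (J_obj S) Y ([Bwd (Q, ?u, J_obj S), ?Fl] @ zs) (span_steps S f T w)"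
    using bwd.IH[of Q ?u l] bwd.prems Q u' l g by auto
  ultimately show ?case
    unfolding g PreNet2_simps by (intro exI[of _ f] exI[of _ w] conjI) (auto intro: zz_equiv.trans)
qed

text \<open>The absorption starts from the identity span, available because \<open>J_obj S\<close>
  is a bush.\<close>

lemma net_full:
  assumes S: "S \<in> Obj tree_category" and T: "T \<in> Obj tree_category"
    and zs: "zigzag PreNet2 weak_equivalences (J_obj S) zs (J_obj T)"
  obtains f w where "(S, f, T) \<in> Arr tree_category" "is_retraction S f T w"
    "net_equiv (J_obj S) (J_obj T) zs (span_steps S f T w)"
proof -
  have JS: "is_bush (J_obj S)"
    using S by (intro is_bush_J_obj) (auto simp: Trees_simps)
  note i = bush_id_we[OF JS]
  let ?i = "(J_obj S, \<lambda>i. restrict id (Lev (J_obj S) i), J_obj S)"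
  obtain f w where "(S, f, T) \<in> Arr tree_category" "is_retraction S f T w"
    "net_equiv (J_obj S) (J_obj T) ([Bwd ?i, Fwd ?i] @ zs) (span_steps S f T w)"
    using net_full_bush[OF zs HOL.refl S T JS i weak_equivalencesD(1)[OF i]] by blast
  moreover have "net_equiv (J_obj S) (J_obj T) ([Bwd ?i, Fwd ?i] @ zs) ([] @ zs)"
    by (rule PreNet2.zz_equiv_append_right[OF _ zs]) (use PreNet2.zz_equiv_Bwd_Fwd[OF i] in simp)
  ultimately show ?thesis
    using that by (simp, meson zz_equiv.sym zz_equiv.trans)
qed

section \<open>Invariants of morphisms\<close>

definition core_graph :: "'v prenet_arrow \<Rightarrow> 'v rel" where
  "core_graph = (\<lambda>(S, f, T). {(x, f 2 x) | x. x \<in> core S})"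

text \<open>
  Level 1 is invariant only up to identifying vertices with the same children, and disregarding
  vertices without a parent.
\<close>

definition same_children :: "'v prenet \<Rightarrow> 'v rel" where
  "same_children S = {(a, b). a \<in> Lev S 1 \<and> b \<in> Lev S 1 \<and> Par S 1 a \<noteq> {} \<and> Par S 1 b \<noteq> {} \<and>
    (\<forall>x\<in>Lev S 2. a \<in> Par S 2 x \<longleftrightarrow> b \<in> Par S 2 x)}"

text \<open>Saturated on the right by \<open>same_children T\<close>; saturation on the left then
  follows from \<open>same_children_arr\<close>.\<close>

definition stem_graph :: "'v prenet_arrow \<Rightarrow> 'v rel" where
  "stem_graph = (\<lambda>(S, f, T). {(a, b). a \<in> Lev S 1 \<and> Par S 1 a \<noteq> {} \<and> (f 1 a, b) \<in> same_children T})"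

lemma core_graph_iff: "(x, y) \<in> core_graph (S, f, T) \<longleftrightarrow> x \<in> core S \<and> y = f 2 x"
  by (auto simp: core_graph_def)

interpretation core: zz_invariant PreNet2 "weak_equivalences :: 'v prenet_arrow set" core_graph
  "\<lambda>S. Id_on (core S)"
proof unfold_locales
  fix f :: "'v prenet_arrow"
  assume f: "f \<in> Arr PreNet2"
  obtain S k T where k: "f = (S, k, T)"
    by (cases f)
  note c = arr_core[OF f[unfolded k]]
  show "Id_on (core (Dom PreNet2 f)) O core_graph f = core_graph f"
    by (auto simp: k core_graph_iff relcomp_unfold Id_on_iff)
  show "core_graph f O Id_on (core (Cod PreNet2 f)) = core_graph f"
    using c by (auto simp: k core_graph_iff relcomp_unfold Id_on_iff)
  fix g :: "'v prenet_arrow"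
  assume "g \<in> Arr PreNet2" and fg: "Cod PreNet2 f = Dom PreNet2 g"
  obtain l U where l: "g = (T, l, U)"
    using fg by (cases g) (simp add: k)
  have "x \<in> Lev S 2" if "x \<in> core S" for x
    using that by (simp add: core_def)
  then have "(x, z) \<in> core_graph (Comp PreNet2 g f) \<longleftrightarrow> (x, z) \<in> core_graph f O core_graph g" for x z
    using c[of x] by (auto simp: k l core_graph_iff compose_eq relcomp_unfold)
  then show "core_graph (Comp PreNet2 g f) = core_graph f O core_graph g"
    by auto
next
  show "core_graph w O (core_graph w)\<inverse> = Id_on (core (Dom PreNet2 w)) \<and>
      (core_graph w)\<inverse> O core_graph w = Id_on (core (Cod PreNet2 w))"
    if "w \<in> weak_equivalences" for w :: "'v prenet_arrow"
  proof (cases w)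
    case (fields S f T)
    have "inj_on (f 2) (core S)" "f 2 ` core S = core T"
      using weak_equivalencesD(2)[OF that[unfolded fields]] by (simp_all add: bij_betw_def)
    then show ?thesis
      unfolding fields PreNet2_simps
      by (auto simp: core_graph_iff relcomp_unfold Id_on_iff dest: inj_onD)
  qed
qed (auto simp: core_graph_iff core_def)

text \<open>By condition (b) the children of \<open>f 1 a\<close> are the images of the children of
  \<open>a\<close>, so they depend on those children alone.\<close>

lemma same_children_arr:
  assumes f: "(S, f, T) \<in> Arr PreNet2" and ab: "(a, b) \<in> same_children S"
  shows "(f 1 a, f 1 b) \<in> same_children T"
proof -
  have "f 1 a \<in> Par T 2 x \<longleftrightarrow> f 1 b \<in> Par T 2 x" if "x \<in> Lev T 2" for x
    using arr_Par[OF f, of 2 x a] arr_Par[OF f, of 2 x b] that ab by (auto simp: same_children_def)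
  then show ?thesis
    using ab arr_Lev[OF f, of _ 1] arr_parented[OF f] by (auto simp: same_children_def)
qed

lemma same_children_equiv:
  "(a, b) \<in> same_children S \<Longrightarrow> (b, a) \<in> same_children S"
  "(a, b) \<in> same_children S \<Longrightarrow> (b, c) \<in> same_children S \<Longrightarrow> (a, c) \<in> same_children S"
  "(a, b) \<in> same_children S \<Longrightarrow> (a, a) \<in> same_children S"
  "(a, b) \<in> same_children S \<Longrightarrow> (b, b) \<in> same_children S"
  "(a, a) \<in> same_children S \<longleftrightarrow> a \<in> Lev S 1 \<and> Par S 1 a \<noteq> {}"
  by (auto simp: same_children_def)

lemma stem_graph_iff:
  "(a, b) \<in> stem_graph (S, f, T) \<longleftrightarrow> (a, a) \<in> same_children S \<and> (f 1 a, b) \<in> same_children T"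
  by (auto simp: stem_graph_def same_children_equiv(5))

text \<open>Parent sets in \<open>S\<close> are preimages of those in \<open>T\<close>, so having
  the same children is reflected: this is injectivity. Surjectivity onto vertices with a parent is
  \<open>arr_parented_surj\<close>.\<close>

lemma stem_graph_we:
  assumes w: "(S, w, T) \<in> weak_equivalences"
  shows "stem_graph (S, w, T) O (stem_graph (S, w, T))\<inverse> = same_children S"
    and "(stem_graph (S, w, T))\<inverse> O stem_graph (S, w, T) = same_children T"
proof -
  note W = weak_equivalencesD[OF w] and E = same_children_equiv
  have refl: "(w 1 a, w 1 a') \<in> same_children T \<Longrightarrow> (a, a') \<in> same_children S"
    if "(a, a) \<in> same_children S" "(a', a') \<in> same_children S" for a a'
    using that W(3) arr_Lev[OF W(1)] by (auto simp: same_children_def)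
  show "stem_graph (S, w, T) O (stem_graph (S, w, T))\<inverse> = same_children S"
  proof (intro equalityI subrelI)
    fix a a'
    assume "(a, a') \<in> stem_graph (S, w, T) O (stem_graph (S, w, T))\<inverse>"
    then obtain b where b: "(a, a) \<in> same_children S" "(w 1 a, b) \<in> same_children T"
      "(a', a') \<in> same_children S" "(w 1 a', b) \<in> same_children T"
      by (auto simp: stem_graph_iff)
    show "(a, a') \<in> same_children S"
      by (rule refl[OF b(1,3) E(2)[OF b(2) E(1)[OF b(4)]]])
  next
    fix a a'
    assume aa: "(a, a') \<in> same_children S"
    have "(a, w 1 a') \<in> stem_graph (S, w, T)" "(a', w 1 a') \<in> stem_graph (S, w, T)"
      using E(3,4)[OF aa] same_children_arr[OF W(1) aa] same_children_arr[OF W(1) E(4)[OF aa]]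
      by (simp_all add: stem_graph_iff)
    then show "(a, a') \<in> stem_graph (S, w, T) O (stem_graph (S, w, T))\<inverse>"
      by blast
  qed
  show "(stem_graph (S, w, T))\<inverse> O stem_graph (S, w, T) = same_children T"
  proof (intro equalityI subrelI)
    fix b b'
    assume "(b, b') \<in> (stem_graph (S, w, T))\<inverse> O stem_graph (S, w, T)"
    then obtain a where "(w 1 a, b) \<in> same_children T" "(w 1 a, b') \<in> same_children T"
      by (auto simp: stem_graph_iff)
    then show "(b, b') \<in> same_children T"
      by (meson E(1,2))
  next
    fix b b'
    assume bb: "(b, b') \<in> same_children T"
    then obtain a where "a \<in> Lev S 1" "Par S 1 a \<noteq> {}" "w 1 a = b"
      using arr_parented_surj[OF W(1), of b] by (auto simp: same_children_def)
    then have "(a, b) \<in> stem_graph (S, w, T)" "(a, b') \<in> stem_graph (S, w, T)"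
      using bb E(3)[OF bb] by (simp_all add: stem_graph_iff E(5))
    then show "(b, b') \<in> (stem_graph (S, w, T))\<inverse> O stem_graph (S, w, T)"
      by blast
  qed
qed

interpretation stem: zz_invariant PreNet2
  "weak_equivalences :: 'v prenet_arrow set" stem_graph same_children
proof unfold_locales
  note E = same_children_equiv
  fix f :: "'v prenet_arrow"
  assume f: "f \<in> Arr PreNet2"
  obtain S k T where k: "f = (S, k, T)"
    by (cases f)
  note arr = same_children_arr[OF f[unfolded k]]
  show "same_children (Dom PreNet2 f) O stem_graph f = stem_graph f"
    unfolding k PreNet2_simps
  proof (intro equalityI subrelI)
    fix a c
    assume "(a, c) \<in> same_children S O stem_graph (S, k, T)"
    then obtain b where b: "(a, b) \<in> same_children S" "(k 1 b, c) \<in> same_children T"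
      by (auto simp: stem_graph_iff)
    show "(a, c) \<in> stem_graph (S, k, T)"
      using E(3)[OF b(1)] E(2)[OF arr[OF b(1)] b(2)] by (simp add: stem_graph_iff)
  qed (auto simp: stem_graph_iff)
  show "stem_graph f O same_children (Cod PreNet2 f) = stem_graph f"
    unfolding k PreNet2_simps
  proof (intro equalityI subrelI)
    fix a c
    assume "(a, c) \<in> stem_graph (S, k, T) O same_children T"
    then obtain b where b: "(a, a) \<in> same_children S" "(k 1 a, b) \<in> same_children T"
      "(b, c) \<in> same_children T"
      by (auto simp: stem_graph_iff)
    show "(a, c) \<in> stem_graph (S, k, T)"
      using b(1) E(2)[OF b(2,3)] by (simp add: stem_graph_iff)
  next
    fix a c
    assume ac: "(a, c) \<in> stem_graph (S, k, T)"
    then have "(c, c) \<in> same_children T"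
      using E(4)[of "k 1 a" c T] by (simp add: stem_graph_iff)
    with ac show "(a, c) \<in> stem_graph (S, k, T) O same_children T"
      by blast
  qed
  fix g :: "'v prenet_arrow"
  assume g: "g \<in> Arr PreNet2" and fg: "Cod PreNet2 f = Dom PreNet2 g"
  obtain l U where l: "g = (T, l, U)"
    using fg by (cases g) (simp add: k)
  note arr' = same_children_arr[OF g[unfolded l]]
  have 1: "(a, c) \<in> stem_graph (Comp PreNet2 g f) \<longleftrightarrow>
      (a, a) \<in> same_children S \<and> (l 1 (k 1 a), c) \<in> same_children U" for a c
    by (auto simp: k l stem_graph_iff compose_eq E(5))
  have 2: "(a, c) \<in> stem_graph f O stem_graph g \<longleftrightarrow>
      (a, a) \<in> same_children S \<and> (l 1 (k 1 a), c) \<in> same_children U" for a c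
  proof
    assume "(a, c) \<in> stem_graph f O stem_graph g"
    then obtain b where b: "(a, a) \<in> same_children S" "(k 1 a, b) \<in> same_children T"
      "(l 1 b, c) \<in> same_children U"
      by (auto simp: stem_graph_iff k l)
    then show "(a, a) \<in> same_children S \<and> (l 1 (k 1 a), c) \<in> same_children U"
      using E(2)[OF arr'[OF b(2)] b(3)] by simp
  next
    assume "(a, a) \<in> same_children S \<and> (l 1 (k 1 a), c) \<in> same_children U"
    then have "(a, k 1 a) \<in> stem_graph f" "(k 1 a, c) \<in> stem_graph g"
      using arr[of a a] by (auto simp: stem_graph_iff k l)
    then show "(a, c) \<in> stem_graph f O stem_graph g"
      by blast
  qed
  show "stem_graph (Comp PreNet2 g f) = stem_graph f O stem_graph g"
    by (intro equalityI subrelI) (simp_all only: 1 2)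
next
  note E = same_children_equiv
  fix X :: "'v prenet"
  show "(same_children X)\<inverse> = same_children X"
    by (auto simp: same_children_def)
  show "same_children X O same_children X = same_children X"
    by (auto simp: same_children_def relcomp_unfold)
  show "stem_graph (Ide PreNet2 X) = same_children X"
  proof (intro equalityI subrelI)
    fix a b
    assume "(a, b) \<in> stem_graph (Ide PreNet2 X)"
    then have "(a, a) \<in> same_children X" "(restrict id (Lev X 1) a, b) \<in> same_children X"
      by (simp_all add: stem_graph_iff)
    then show "(a, b) \<in> same_children X"
      by (simp add: E(5))
  next
    fix a b
    assume ab: "(a, b) \<in> same_children X"
    then show "(a, b) \<in> stem_graph (Ide PreNet2 X)"
      using E(3)[OF ab] by (simp add: stem_graph_iff E(5))
  qed
next
  show "stem_graph w O (stem_graph w)\<inverse> = same_children (Dom PreNet2 w) \<and>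
      (stem_graph w)\<inverse> O stem_graph w = same_children (Cod PreNet2 w)"
    if "w \<in> weak_equivalences" for w :: "'v prenet_arrow"
    using that by (cases w) (simp add: stem_graph_we)
qed auto


section \<open>Values of the two invariants on the spans of tree maps\<close>

context
  fixes S T :: "'a tree" and f :: "'a level_map" and u :: "'a vert level_map"
  assumes arr: "(S, f, T) \<in> Arr tree_category" and u: "is_retraction S f T u"
begin

lemma core_value_span:
  "zz_value core_graph (Id_on (core (J_obj T))) (span_steps S f T u) = {(Vtx y, Vtx (f 2 y)) | y. y
    \<in> Lev S 2}"
proof -
  have "core_graph (tilde S f T, u, J_obj S) = {(Vtx y, Vtx y) | y. y \<in> Lev S 2}"
    using retractionD(3)[OF arr u] by (auto simp: core_graph_def tilde_core[OF arr])
  moreover have "core_graph (tilde S f T, J_map S f T, J_obj T) = {(Vtx y, Vtx (f 2 y)) | y. y \<in> Lev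
    S 2}"
    by (auto simp: core_graph_def tilde_core[OF arr] J_map_simps(2)[OF arr] tilde_Lev[OF arr])
  moreover have "f 2 y \<in> Lev T 2" if "y \<in> Lev S 2" for y
    by (rule is_epi_mapD(1)[OF arr_epi[OF arr] that])
  ultimately show ?thesis
    by (auto simp: J_obj_core relcomp_unfold Id_on_iff)
qed

text \<open>Every vertex of level 1 has a child, and that child has no other parent. So for
  \<open>J_obj U\<close> the identification on level 1 is equality and the invariant loses
  nothing.\<close>

lemma same_children_J_obj:
  assumes "is_tree U" "Lev U 1 \<noteq> {}"
  shows "same_children (J_obj U) = Id_on (Vtx ` Lev U 1)"
proof (intro equalityI subrelI)
  fix a b
  assume ab: "(a, b) \<in> same_children (J_obj U)"
  then obtain c where c: "c \<in> Lev (J_obj U) 2" "a \<in> Par (J_obj U) 2 c"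
    using bush_child[OF is_bush_J_obj[OF assms], of a] by (auto simp: same_children_def)
  then have "b \<in> Par (J_obj U) 2 c"
    using ab by (simp add: same_children_def)
  then show "(a, b) \<in> Id_on (Vtx ` Lev U 1)"
    using ab c by (auto simp: J_obj_Par2 same_children_def J_obj_Lev1)
qed (auto simp: same_children_def J_obj_Lev1 J_obj_Par1)

lemma stem_value_span:
  "zz_value stem_graph (same_children (J_obj T)) (span_steps S f T u) = {(Vtx x, Vtx (f 1 x)) | x. x
    \<in> Lev S 1}"
proof -
  have "Lev (tilde S f T) 0 \<noteq> {}"
    using tree_root[OF arr_trees(1)[OF arr]] by (auto simp: tilde_Lev[OF arr])
  then have t: "(a, a) \<in> same_children (tilde S f T) \<longleftrightarrow> a \<in> Vtx ` Lev S 1" for a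
    using bush_Par1[OF is_bush_tilde[OF arr]]
    by (auto simp: same_children_equiv(5) tilde_Lev(2)[OF arr])
  have u1: "u 1 (Vtx x) = Vtx x" if "x \<in> Lev S 1" for x
    using retractionD(2)[OF arr u, of "Vtx x"] that by (simp add: tilde_Lev(2)[OF arr])
  have fL: "f 1 x \<in> Lev T 1" if "x \<in> Lev S 1" for x
    by (rule is_epi_mapD(1)[OF arr_epi[OF arr] that])
  have "(a, b) \<in> stem_graph (tilde S f T, u, J_obj S) \<longleftrightarrow>
    a \<in> Vtx ` Lev S 1 \<and> (u 1 a, b) \<in> Id_on (Vtx ` Lev S 1)" for a b
    by (simp only: stem_graph_iff t same_children_J_obj[OF arr_trees(1,3)[OF arr]])
  then have 1: "stem_graph (tilde S f T, u, J_obj S) = {(Vtx x, Vtx x) | x. x \<in> Lev S 1}"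
    using u1 by (intro equalityI subrelI) (auto simp: Id_on_iff)
  have "(a, b) \<in> stem_graph (tilde S f T, J_map S f T, J_obj T) \<longleftrightarrow>
      a \<in> Vtx ` Lev S 1 \<and> (J_map S f T 1 a, b) \<in> Id_on (Vtx ` Lev T 1)" for a b
    by (simp only: stem_graph_iff t same_children_J_obj[OF arr_trees(2,4)[OF arr]])
  then have 2: "stem_graph (tilde S f T, J_map S f T, J_obj T) = {(Vtx x, Vtx (f 1 x)) | x. x \<in> Lev
    S 1}"
    using J_map_simps(1)[OF arr] fL by (intro equalityI subrelI) (auto simp: Id_on_iff)
  have "zz_value stem_graph (same_children (J_obj T)) (span_steps S f T u) =
      {(Vtx x, Vtx x) | x. x \<in> Lev S 1}\<inverse> O {(Vtx x, Vtx (f 1 x)) | x. x \<in> Lev S 1} O Id_on (Vtx `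
        Lev T 1)"
    by (simp only: zz_value.simps step.case 1 2 same_children_J_obj[OF arr_trees(2,4)[OF arr]])
  also have "\<dots> = {(Vtx x, Vtx (f 1 x)) | x. x \<in> Lev S 1}"
    using fL by (auto simp: relcomp_unfold Id_on_iff)
  finally show ?thesis .
qed

end

lemma Trees_arr_eqI:
  assumes f: "(S, f, T) \<in> Arr tree_category" and g: "(S, g, T) \<in> Arr tree_category"
    and 2: "{(Vtx y, Vtx (f 2 y)) | y. y \<in> Lev S 2} = {(Vtx y, Vtx (g 2 y)) | y. y \<in> Lev S 2}"
    and 1: "{(Vtx x, Vtx (f 1 x)) | x. x \<in> Lev S 1} = {(Vtx x, Vtx (g 1 x)) | x. x \<in> Lev S 1}"
  shows "f = g"
proof
  fix i
  note F = is_epi_mapD(1,2)[OF arr_epi[OF f]] and G = is_epi_mapD(1,2)[OF arr_epi[OF g]]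
  note trees = arr_trees[OF f]
  have e1: "f 1 x = g 1 x" if "x \<in> Lev S 1" for x
  proof -
    have "(Vtx x, Vtx (f 1 x)) \<in> {(Vtx x, Vtx (g 1 x)) | x. x \<in> Lev S 1}"
      unfolding 1[symmetric] using that by blast
    then show ?thesis
      by simp
  qed
  have e2: "f 2 y = g 2 y" if "y \<in> Lev S 2" for y
  proof -
    have "(Vtx y, Vtx (f 2 y)) \<in> {(Vtx y, Vtx (g 2 y)) | y. y \<in> Lev S 2}"
      unfolding 2[symmetric] using that by blast
    then show ?thesis
      by simp
  qed
  have "f i x = g i x" if "x \<in> Lev S i" for x
  proof -
    have "i = 0 \<or> i = 1 \<or> i = 2"
      using that Lev_empty[OF tree_ordered[OF trees(1)], of i]
      by (cases "i > 2") (simp_all, linarith)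
    then show ?thesis
      using e1 e2 that F(1)[OF that] G(1)[OF that] tree_root[OF trees(2)] by auto
  qed
  moreover have "f i \<in> extensional (Lev S i)" "g i \<in> extensional (Lev S i)"
    using F(2) G(2) by (simp_all add: level_maps_def PiE_def)
  ultimately show "f i = g i"
    by (intro extensionalityI)
qed

lemma Trees_arr_eq_values:
  assumes f: "(S, f, T) \<in> Arr tree_category" and g:
    "(S, g, T) \<in> Arr tree_category" and u: "is_retraction S f T u"
    and "zz_value core_graph (Id_on (core (J_obj T))) (span_steps S f T u) = {(Vtx y, Vtx (g 2 y)) |
      y. y \<in> Lev S 2}"
    and "zz_value stem_graph (same_children (J_obj T)) (span_steps S f T u) = {(Vtx x, Vtx (g 1 x))
      | x. x \<in> Lev S 1}"
  shows "f = g"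
  using assms(4,5) unfolding core_value_span[OF f u] stem_value_span[OF f u]
  by (rule Trees_arr_eqI[OF f g])

section \<open>The functor J on arrows\<close>

lemma J_span_eq: "J_span S f T u = zz_class PreNet2 weak_equivalences (J_obj S) (span_steps S f T u)
  (J_obj T)"
  by (simp add: J_span_def)

lemma J_arr_eq:
  assumes "(S, f, T) \<in> Arr tree_category" "is_retraction S f T u"
  shows "J_arr (S, f, T) = J_span S f T u"
proof -
  have r: "is_retraction S f T (SOME u. is_retraction S f T u)"
    by (rule someI_ex[OF retraction_exists[OF assms(1)]])
  have "J_arr (S, f, T) = J_span S f T (SOME u. is_retraction S f T u)"
    by (simp only: J_arr_def prod.case)
  also have "\<dots> = J_span S f T u"
    unfolding J_span_eq
    by (rule PreNet2.zz_class_eq_iff[THEN iffD2]) (rule zigzag_span[OF assms(1) r]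
      net_equiv_retractions[OF assms(1) r assms(2)])+
  finally show ?thesis .
qed

lemma J_arr_hom:
  assumes f: "(S, f, T) \<in> Arr tree_category"
  shows "J_arr (S, f, T) \<in> hom_set Net2 (J_obj S) (J_obj T)"
proof -
  obtain u where u: "is_retraction S f T u"
    using retraction_exists[OF f] by auto
  show ?thesis
    unfolding J_arr_eq[OF f u] J_span_eq Net2_def PreNet2.hom_set_localization
    by (intro CollectI exI conjI) (rule HOL.refl, rule zigzag_span[OF f u])
qed

text \<open>Besides realizing the class of \<open>zs\<close>, this keeps the values of both
  invariants. They identify the resulting \<open>f\<close> when \<open>zs\<close> is the empty
  zigzag or a concatenation of two spans, without comparing the S-tilde of a composite with those of
  its factors.\<close>

lemma J_arr_full:
  assumes "S \<in> Obj tree_category" "T \<in> Obj tree_category"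
    "zigzag PreNet2 weak_equivalences (J_obj S) zs (J_obj T)"
  obtains f u where "(S, f, T) \<in> Arr tree_category" "is_retraction S f T u"
    "J_arr (S, f, T) = zz_class PreNet2 weak_equivalences (J_obj S) zs (J_obj T)"
    "zz_value core_graph (Id_on (core (J_obj T))) (span_steps S f T u) = zz_value core_graph (Id_on
      (core (J_obj T))) zs"
    "zz_value stem_graph (same_children (J_obj T)) (span_steps S f T u) = zz_value stem_graph
      (same_children (J_obj T)) zs"
proof -
  obtain f u where f: "(S, f, T) \<in> Arr tree_category" "is_retraction S f T u"
    and eq: "net_equiv (J_obj S) (J_obj T) zs (span_steps S f T u)"
    by (rule net_full[OF assms]) blast
  have "J_arr (S, f, T) = zz_class PreNet2 weak_equivalences (J_obj S) zs (J_obj T)"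
    unfolding J_arr_eq[OF f] J_span_eq
    by (rule PreNet2.zz_class_eq_iff[THEN iffD2, OF zigzag_span[OF f] zz_equiv.sym[OF eq]])
  then show ?thesis
    using that[OF f] core.zz_value_equiv[OF eq] stem.zz_value_equiv[OF eq] by metis
qed

lemma J_arr_inj:
  assumes f: "(S, f, T) \<in> Arr tree_category" and g: "(S, g, T) \<in> Arr tree_category" and eq:
    "J_arr (S, f, T) = J_arr (S, g, T)"
  shows "f = g"
proof -
  obtain u v where u: "is_retraction S f T u" and v: "is_retraction S g T v"
    using retraction_exists[OF f] retraction_exists[OF g] by auto
  have eq: "net_equiv (J_obj S) (J_obj T) (span_steps S f T u) (span_steps S g T v)"
    using eq PreNet2.zz_class_eq_iff[OF zigzag_span[OF f u]]
    by (simp add: J_arr_eq[OF f u] J_arr_eq[OF g v] J_span_eq)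
  show ?thesis
    by (rule Trees_arr_eq_values[OF f g u])
      (simp_all only: core.zz_value_equiv[OF eq] stem.zz_value_equiv[OF eq] core_value_span[OF g v]
        stem_value_span[OF g v])
qed

lemma J_obj_Obj: "S \<in> Obj tree_category \<Longrightarrow> J_obj S \<in> Obj PreNet2"
  using bush_Obj[OF is_bush_J_obj[of S]] by (simp add: Trees_simps)

lemma J_arr_Ide:
  assumes S: "S \<in> Obj tree_category"
  shows "J_arr (Ide tree_category S) = Ide Net2 (J_obj S)"
proof -
  have zz: "zigzag PreNet2 weak_equivalences (J_obj S) [] (J_obj S)"
    using J_obj_Obj[OF S] by simp
  obtain f u where f: "(S, f, S) \<in> Arr tree_category" and u: "is_retraction S f S u"
    and J: "J_arr (S, f, S) = zz_class PreNet2 weak_equivalences (J_obj S) [] (J_obj S)"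
    and vals: "zz_value core_graph (Id_on (core (J_obj S))) (span_steps S f S u) = zz_value
      core_graph (Id_on (core (J_obj S))) []"
      "zz_value stem_graph (same_children (J_obj S)) (span_steps S f S u) = zz_value stem_graph
        (same_children (J_obj S)) []"
    by (rule J_arr_full[OF S S zz]) blast
  let ?i = "\<lambda>i. restrict id (Lev S i)"
  have i: "(S, ?i, S) \<in> Arr tree_category"
    using is_category_Trees S unfolding is_category_def by (auto simp: hom_set_def Trees_simps(4))
  have "f = ?i"
    by (rule Trees_arr_eq_values[OF f i u]; unfold vals)
      (auto simp: J_obj_core same_children_J_obj[OF f u arr_trees(1,3)[OF f]])
  then show ?thesis
    using J by (simp add: Trees_simps(4) Net2_def localization_def)
qed

lemma J_arr_Comp:
  assumes f: "(S, f, T) \<in> Arr tree_category" and g: "(T, g, U) \<in> Arr tree_category"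
  shows "J_arr (Comp tree_category (T, g, U) (S, f, T)) = Comp Net2 (J_arr (T, g, U)) (J_arr (S, f,
    T))"
proof -
  have objs: "S \<in> Obj tree_category" "U \<in> Obj tree_category"
    using f g by (simp_all add: Arr_Trees)
  obtain u v where u: "is_retraction S f T u" and v: "is_retraction T g U v"
    using retraction_exists[OF f] retraction_exists[OF g] by auto
  note zf = zigzag_span[OF f u] and zg = zigzag_span[OF g v]
  let ?zs = "span_steps S f T u @ span_steps T g U v"
  obtain k w where k: "(S, k, U) \<in> Arr tree_category" and w: "is_retraction S k U w"
    and J: "J_arr (S, k, U) = zz_class PreNet2 weak_equivalences (J_obj S) ?zs (J_obj U)"
    and vals: "zz_value core_graph (Id_on (core (J_obj U))) (span_steps S k U w) = zz_value
      core_graph (Id_on (core (J_obj U))) ?zs"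
      "zz_value stem_graph (same_children (J_obj U)) (span_steps S k U w) = zz_value stem_graph
        (same_children (J_obj U)) ?zs"
    by (rule J_arr_full[OF objs PreNet2.zigzag_append[OF zf zg]]) blast
  let ?gf = "\<lambda>i. compose (Lev S i) (g i) (f i)"
  have gf: "(S, ?gf, U) \<in> Arr tree_category"
    using is_epi_map_comp[OF arr_trees(1)[OF f] arr_epi[OF f] arr_epi[OF g]] objs
    by (simp add: Arr_Trees)
  have fL: "x \<in> Lev S i \<Longrightarrow> f i x \<in> Lev T i" for x i
    by (rule is_epi_mapD(1)[OF arr_epi[OF f]])
  have "k = ?gf"
  proof (rule Trees_arr_eq_values[OF k gf w]; unfold vals)
    show "zz_value core_graph (Id_on (core (J_obj U))) ?zs = {(Vtx y, Vtx (compose (Lev S 2) (g 2)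
      (f 2) y)) | y. y \<in> Lev S 2}"
      unfolding core.zz_value_append[OF zf zg] core_value_span[OF f u] core_value_span[OF g v]
      using fL[of _ 2] by (auto simp: compose_eq relcomp_unfold)
    show "zz_value stem_graph (same_children (J_obj U)) ?zs = {(Vtx x, Vtx (compose (Lev S 1) (g 1)
      (f 1) x)) | x. x \<in> Lev S 1}"
      unfolding stem.zz_value_append[OF zf zg] stem_value_span[OF f u] stem_value_span[OF g v]
      using fL[of _ 1] by (auto simp: compose_eq relcomp_unfold)
  qed
  then show ?thesis
    using J PreNet2.Comp_localization[OF zf zg]
    by (simp add: Trees_simps(5) Net2_def J_arr_eq[OF f u] J_arr_eq[OF g v] J_span_eq)
qed

lemma fully_faithful_J: "fully_faithful_functor tree_category Net2 J_obj J_arr"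
  unfolding fully_faithful_functor_def is_functor_def
proof (intro conjI ballI)
  show "is_category tree_category"
    by (rule is_category_Trees)
  show "is_category Net2"
    unfolding Net2_def by (rule PreNet2.is_category_localization)
  show "J_obj S \<in> Obj Net2" if "S \<in> Obj tree_category" for S :: "'a tree"
    using J_obj_Obj[OF that] by (simp add: Net2_def localization_def)
  show "J_arr (Ide tree_category S) = Ide Net2 (J_obj S)"
    if "S \<in> Obj tree_category" for S :: "'a tree"
    using that by (rule J_arr_Ide)
  show "J_arr \<phi> \<in> hom_set Net2 (J_obj S) (J_obj T)"
    if "\<phi> \<in> hom_set tree_category S T" for S T :: "'a tree" and \<phi>
    using that J_arr_hom unfolding hom_set_Trees by blast
  show "J_arr (Comp tree_category \<psi> \<phi>) = Comp Net2 (J_arr \<psi>) (J_arr \<phi>)"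
    if "\<phi> \<in> hom_set tree_category S T" "\<psi> \<in> hom_set tree_category T U"
      for S T U :: "'a tree" and \<phi> \<psi>
    using that J_arr_Comp unfolding hom_set_Trees by blast
  show "bij_betw J_arr (hom_set tree_category S T) (hom_set Net2 (J_obj S) (J_obj T))"
    if ST: "S \<in> Obj tree_category" "T \<in> Obj tree_category" for S T :: "'a tree"
  proof (rule bij_betw_imageI)
    show "inj_on J_arr (hom_set tree_category S T)"
    proof (rule inj_onI)
      fix \<phi> \<psi>
      assume "\<phi> \<in> hom_set tree_category S T" "\<psi> \<in> hom_set tree_category S T" "J_arr \<phi> = J_arr \<psi>"
      then show "\<phi> = \<psi>"
        using J_arr_inj by (auto simp: hom_set_Trees)
    qed
    show "J_arr ` hom_set tree_category S T = hom_set Net2 (J_obj S) (J_obj T)"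
    proof (intro equalityI subsetI)
      fix \<psi>
      assume "\<psi> \<in> J_arr ` hom_set tree_category S T"
      then show "\<psi> \<in> hom_set Net2 (J_obj S) (J_obj T)"
        using J_arr_hom by (auto simp: hom_set_Trees)
    next
      fix \<psi>
      assume "\<psi> \<in> hom_set Net2 (J_obj S) (J_obj T)"
      then obtain zs where zs: "zigzag PreNet2 weak_equivalences (J_obj S) zs (J_obj T)"
        "\<psi> = zz_class PreNet2 weak_equivalences (J_obj S) zs (J_obj T)"
        unfolding Net2_def PreNet2.hom_set_localization by auto
      obtain f where f: "(S, f, T) \<in> Arr tree_category" "\<psi> = J_arr (S, f, T)"
        by (rule J_arr_full[OF ST zs(1)]) (use zs(2) in simp)
      have "(S, f, T) \<in> hom_set tree_category S T"
        unfolding hom_set_Trees using f(1) by blast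
      with f(2) show "\<psi> \<in> J_arr ` hom_set tree_category S T"
        by (rule image_eqI)
    qed
  qed
qed

theorem theorem4p15:
  fixes Trees :: "('a tree, 'a tree_arrow) category"
  defines "Trees \<equiv> full_subcategory Tree2_Epi1 (\<lambda>T. Lev T 1 \<noteq> {})"
  shows "(\<forall>(S, f, T) \<in> Arr Trees.
            (\<exists>u. is_retraction S f T u) \<and>
            (\<forall>u. is_retraction S f T u \<longrightarrow>
              (tilde S f T, u, J_obj S) \<in> weak_equivalences \<and> J_arr (S, f, T) = J_span S f T u)) \<and>
         fully_faithful_functor Trees Net2 J_obj J_arr"
  unfolding Trees_def
proof (intro conjI ballI)
  fix \<phi> :: "'a tree_arrow"
  assume "\<phi> \<in> Arr (full_subcategory Tree2_Epi1 (\<lambda>T. Lev T 1 \<noteq> {}))"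
  then show "case \<phi> of (S, f, T) \<Rightarrow> (\<exists>u. is_retraction S f T u) \<and>
      (\<forall>u. is_retraction S f T u \<longrightarrow>
        (tilde S f T, u, J_obj S) \<in> weak_equivalences \<and> J_arr (S, f, T) = J_span S f T u)"
    using retraction_exists retraction_we J_arr_eq by (cases \<phi>) auto
qed (rule fully_faithful_J)

end
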